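(* For every integer $k\geq 2$, $\mathsf{CERTAINTY}(\mathcal{AC}_k)$ is in $\mathbf{P}$, where $\mathcal{AC}_k=\{R_1(\underline{x_1},x_2), R_2(\underline{x_2},x_3),\dots,R_{k-1}(\underline{x_{k-1}},x_k), R_k(\underline{x_k},x_1), S_k(\underline{x_1,x_2,\dots,x_k})\}$ with $x_1,\dots,x_k$ distinct variables, $R_1,\dots,R_k,S_k$ distinct relation names, each $R_i$ of signature $[2,1]$ (first position is the primary key) and $S_k$ of signature $[k,k]$ (all positions form the primary key).
   Context: A relation name with signature $[n,k]$ has arity $n$ and primary key formed by positions $1,\dots,k$ (underlined). A fact is an atom with only constants; two facts are key-equal if they have the same relation name and agree on the primary-key positions. An uncertain database is a finite set of facts; a repair is a maximal subset containing no two distinct key-equal facts. A Boolean conjunctive query is a finite set of atoms, read as the existential closure of their conjunction; a database satisfies it if some assignment of constants to its variables maps every atom into the database. For a Boolean conjunctive query $q$, $\mathsf{CERTAINTY}(q)$ is the decision problem (with $q$ fixed) that asks, given an uncertain database ${\mathbf{db}}$, whether every repair of ${\mathbf{db}}$ satisfies $q$. *)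

theory Defs
  imports Main
begin

text \<open>A fact is a relation name together with a tuple of constants.
  A relation name r has arity ar r and primary key formed by the first kl r positions.\<close>

type_synonym ('r, 'c) fact = "'r \<times> 'c list"

definition key_equal :: "('r \<Rightarrow> nat) \<Rightarrow> ('r, 'c) fact \<Rightarrow> ('r, 'c) fact \<Rightarrow> bool" where
  "key_equal kl f g \<longleftrightarrow> fst f = fst g \<and> take (kl (fst f)) (snd f) = take (kl (fst g)) (snd g)"

definition consistent :: "('r \<Rightarrow> nat) \<Rightarrow> ('r, 'c) fact set \<Rightarrow> bool" where
  "consistent kl I \<longleftrightarrow> (\<forall>f\<in>I. \<forall>g\<in>I. key_equal kl f g \<longrightarrow> f = g)"

definition uncertain_db :: "('r \<Rightarrow> nat) \<Rightarrow> ('r, 'c) fact set \<Rightarrow> bool" where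
  "uncertain_db ar db \<longleftrightarrow> finite db \<and> (\<forall>f\<in>db. length (snd f) = ar (fst f))"

definition repair :: "('r \<Rightarrow> nat) \<Rightarrow> ('r, 'c) fact set \<Rightarrow> ('r, 'c) fact set \<Rightarrow> bool" where
  "repair kl db r \<longleftrightarrow> r \<subseteq> db \<and> consistent kl r \<and>
     (\<forall>r'. r \<subseteq> r' \<and> r' \<subseteq> db \<and> consistent kl r' \<longrightarrow> r' = r)"

datatype ('v, 'c) qterm = Var 'v | Const 'c

type_synonym ('r, 'v, 'c) atom = "'r \<times> ('v, 'c) qterm list"

fun inst :: "('v \<Rightarrow> 'c) \<Rightarrow> ('v, 'c) qterm \<Rightarrow> 'c" where
  "inst \<sigma> (Var v) = \<sigma> v"
| "inst \<sigma> (Const c) = c"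

definition satisfies :: "('r, 'c) fact set \<Rightarrow> ('r, 'v, 'c) atom set \<Rightarrow> bool" where
  "satisfies db q \<longleftrightarrow> (\<exists>\<sigma>. \<forall>a\<in>q. (fst a, map (inst \<sigma>) (snd a)) \<in> db)"

definition certain :: "('r \<Rightarrow> nat) \<Rightarrow> ('r, 'v, 'c) atom set \<Rightarrow> ('r, 'c) fact set \<Rightarrow> bool" where
  "certain kl q db \<longleftrightarrow> (\<forall>r. repair kl db r \<longrightarrow> satisfies r q)"

text \<open>Relation names: R i (i = 1..k, signature [2,1]) and S (signature [k,k]).
  Relation names R i with i outside 1..k may occur in databases as well (also [2,1]).\<close>
datatype rel = R nat | S

definition ac_arity :: "nat \<Rightarrow> rel \<Rightarrow> nat" where
  "ac_arity k r = (case r of R i \<Rightarrow> 2 | S \<Rightarrow> k)"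

definition ac_key :: "nat \<Rightarrow> rel \<Rightarrow> nat" where
  "ac_key k r = (case r of R i \<Rightarrow> 1 | S \<Rightarrow> k)"

definition AC :: "nat \<Rightarrow> (rel, nat, nat) atom set" where
  "AC k = {(R i, [Var i, Var (i + 1)]) | i. 1 \<le> i \<and> i < k}
        \<union> {(R k, [Var k, Var 1])}
        \<union> {(S, map Var [1..<k+1])}"

text \<open>Single-tape deterministic TM with finitely many states 0..nst-1 (start state 0),
  tape symbols 0..nsym-1 (0 is blank), transition function delta, accepting and rejecting state.
  Moves are -1, 0, 1.\<close>
datatype tm = TM (nst: nat) (nsym: nat) (delta: "nat \<Rightarrow> nat \<Rightarrow> nat \<times> nat \<times> int") (acc: nat) (rej: nat)

definition wf_tm :: "tm \<Rightarrow> bool" where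
  "wf_tm M \<longleftrightarrow> 5 \<le> nsym M \<and> 0 < nst M \<and> acc M < nst M \<and> rej M < nst M \<and> acc M \<noteq> rej M \<and>
     (\<forall>q < nst M. \<forall>a < nsym M. case delta M q a of (q', b, m) \<Rightarrow>
        q' < nst M \<and> b < nsym M \<and> m \<in> {-1, 0, 1})"

type_synonym config = "nat \<times> (int \<Rightarrow> nat) \<times> int"

definition step :: "tm \<Rightarrow> config \<Rightarrow> config" where
  "step M c = (case c of (q, T, h) \<Rightarrow>
     if q = acc M \<or> q = rej M then (q, T, h)
     else (case delta M q (T h) of (q', b, m) \<Rightarrow> (q', T(h := b), h + m)))"

definition init :: "nat list \<Rightarrow> config" where
  "init x = (0, \<lambda>i. if 0 \<le> i \<and> i < int (length x) then x ! nat i else 0, 0)"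

definition decides_within :: "tm \<Rightarrow> nat list \<Rightarrow> nat \<Rightarrow> bool \<Rightarrow> bool" where
  "decides_within M x t b \<longleftrightarrow>
     (let q = fst ((step M ^^ t) (init x)) in (q = acc M \<or> q = rej M) \<and> (q = acc M \<longleftrightarrow> b))"

text \<open>Input alphabet: 1 = bit 0, 2 = bit 1, 3 = token separator, 4 = end of fact.\<close>
fun bits :: "nat \<Rightarrow> nat list" where
  "bits n = (if n < 2 then [n + 1] else bits (n div 2) @ [n mod 2 + 1])"

definition rel_code :: "rel \<Rightarrow> nat" where
  "rel_code r = (case r of S \<Rightarrow> 0 | R i \<Rightarrow> i + 1)"

definition enc_fact :: "(rel, nat) fact \<Rightarrow> nat list" where
  "enc_fact f = bits (rel_code (fst f)) @ [3] @ concat (map (\<lambda>c. bits c @ [3]) (snd f)) @ [4]"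

definition enc_db :: "(rel, nat) fact list \<Rightarrow> nat list" where
  "enc_db xs = concat (map enc_fact xs)"

definition certainty_AC_in_P :: "nat \<Rightarrow> bool" where
  "certainty_AC_in_P k \<longleftrightarrow> (\<exists>M c d. wf_tm M \<and>
     (\<forall>xs. uncertain_db (ac_arity k) (set xs) \<longrightarrow>
        decides_within M (enc_db xs) (c * (length (enc_db xs) + 1) ^ d)
          (certain (ac_key k) (AC k) (set xs))))"

end

theory Submission
  imports Defs "HOL-Library.Nat_Bijection"
begin

text \<open>View a fact \<open>R\<^sub>i(a, b)\<close> as an edge from the vertex \<open>(i, a)\<close> to the vertex \<open>(i + 1, b)\<close>
  (indices modulo \<open>k\<close>). A repair chooses one outgoing edge per non-sink vertex, and it falsifies the
  query iff the chosen edges contain no \<open>k\<close>-cycle listed in \<open>S\<close>. Such a choice exists iff every edge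
  leads to a sink or to a good cycle, namely a \<open>k\<close>-cycle that is not listed or an elementary cycle
  that is longer than \<open>k\<close>: from a choice one follows its orbits, and conversely a maximal
  partial choice that is closed under successors is total. A long elementary cycle through a type-1
  vertex is a path of \<open>k\<close> edges followed by a path back to the start that avoids the sources of
  these \<open>k\<close> edges, so for fixed \<open>k\<close> the condition is first-order with reachability over the
  positions of the input word.

  Such conditions are evaluated by while-programs whose registers hold sets of input positions. All
  registers are kept as marks on the input cells, and one program step is one left-to-right sweep of
  a finite automaton over the tape, so a Turing machine simulates it in linear time.\<close>

section \<open>Programs over sets of positions\<close>

text \<open>Since all positions of \<open>S\<close> are key positions, every \<open>S\<close> fact
  of the database lies in every repair, so only the choice of edges matters. Layering makes every
  cycle length a multiple of \<open>k\<close>; a chosen elementary cycle longer than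
  \<open>k\<close> therefore can never be a match. The obstacle is that a long elementary cycle
  looks like a disjoint-paths problem. It disappears because only the first \<open>k\<close> edges
  have to be guessed: the way back may be any walk off their sources. Stepping to the start along
  shortest distances creates no cycle off the guessed path and no \<open>k\<close>-cycle meeting it.
  Closure under successors lets partial choices be combined: a vertex added later is not entered
  from the earlier choices, so it completes no listed cycle. On the machine side, constants are
  binary numbers of unbounded length. Skipping one is a reachability question, and comparing two
  amounts to moving two markers in parallel. The number of nested loops grows with \<open>k\<close>,
  which is harmless because \<open>k\<close> is fixed before the machine is built.\<close>

datatype instr = Nop | First nat | Shift nat nat | Pw nat "bool \<Rightarrow> bool \<Rightarrow> bool" nat nat | Test nat

datatype com = Skip | Halt bool | Op instr | Seq com com | Cond nat com com | While nat com

fun hd_instr :: "com \<Rightarrow> instr" where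
  "hd_instr Skip = Nop"
| "hd_instr (Halt b) = Nop"
| "hd_instr (Op i) = i"
| "hd_instr (Seq c1 c2) = (if c1 = Skip then Nop else hd_instr c1)"
| "hd_instr (Cond r c1 c2) = Test r"
| "hd_instr (While r c) = Test r"

text \<open>The bit \<open>b\<close> is the outcome of \<open>Test\<close>, true on an empty
  register; hence true selects the second branch of \<open>Cond\<close> and ends
  \<open>While\<close>.\<close>

fun nxt :: "bool \<Rightarrow> com \<Rightarrow> com" where
  "nxt b Skip = Skip"
| "nxt b (Halt v) = Halt v"
| "nxt b (Op i) = Skip"
| "nxt b (Seq c1 c2) = (if c1 = Skip then c2 else Seq (nxt b c1) c2)"
| "nxt b (Cond r c1 c2) = (if b then c2 else c1)"
| "nxt b (While r c) = (if b then Skip else Seq c (While r c))"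

fun eff :: "nat \<Rightarrow> instr \<Rightarrow> (nat \<Rightarrow> nat set) \<Rightarrow> nat \<Rightarrow> nat set" where
  "eff n (First x) s = s(x := {0})"
| "eff n (Shift x y) s = s(x := Suc ` s y \<inter> {..n})"
| "eff n (Pw x f y z) s = s(x := {p. p \<le> n \<and> f (p \<in> s y) (p \<in> s z)})"
| "eff n _ s = s"

text \<open>The final state of the automaton that performs the instruction; only the outcome of
  \<^const>\<open>Test\<close> (true iff the register is empty) influences the control flow.\<close>

fun carry :: "nat \<Rightarrow> instr \<Rightarrow> (nat \<Rightarrow> nat set) \<Rightarrow> bool" where
  "carry n (First x) s = False"
| "carry n (Shift x y) s = (n \<notin> s y)"
| "carry n (Test x) s = (s x \<inter> {..n} = {})"
| "carry n _ s = True"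

fun sstep :: "nat \<Rightarrow> com \<times> (nat \<Rightarrow> nat set) \<Rightarrow> com \<times> (nat \<Rightarrow> nat set)" where
  "sstep n (c, s) = (nxt (carry n (hd_instr c) s) c, eff n (hd_instr c) s)"

text \<open>The continuations that a program can reach: they become the control states.\<close>

fun points :: "com \<Rightarrow> com set" where
  "points Skip = {Skip}"
| "points (Halt b) = {Halt b}"
| "points (Op i) = {Op i, Skip}"
| "points (Seq c1 c2) = (\<lambda>c. Seq c c2) ` points c1 \<union> points c2"
| "points (Cond r c1 c2) = insert (Cond r c1 c2) (points c1 \<union> points c2)"
| "points (While r c) = {While r c, Skip} \<union> (\<lambda>c'. Seq c' (While r c)) ` points c"

lemma finite_points: "finite (points c)"
  by (induction c) auto

lemma self_in_points: "c \<in> points c"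
  by (induction c) auto

text \<open>This keeps the control finite: unfolding a loop only puts its body in front of the loop
  itself, so continuations do not pile up.\<close>

lemma nxt_in_points: "c' \<in> points c \<Longrightarrow> nxt b c' \<in> points c"
proof (induction c arbitrary: c')
  case (While r c)
  then show ?case using self_in_points[of c] by (auto split: if_splits)
qed (auto simp: self_in_points)

fun ifits :: "nat \<Rightarrow> instr \<Rightarrow> bool" where
  "ifits V Nop = True"
| "ifits V (First x) = (x < V)"
| "ifits V (Shift x y) = (x < V \<and> y < V)"
| "ifits V (Pw x f y z) = (x < V \<and> y < V \<and> z < V)"
| "ifits V (Test x) = (x < V)"

fun fits :: "nat \<Rightarrow> com \<Rightarrow> bool" where
  "fits V Skip = True"
| "fits V (Halt b) = True"
| "fits V (Op i) = ifits V i"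
| "fits V (Seq c1 c2) = (fits V c1 \<and> fits V c2)"
| "fits V (Cond r c1 c2) = (r < V \<and> fits V c1 \<and> fits V c2)"
| "fits V (While r c) = (r < V \<and> fits V c)"

lemma fits_mono: "fits V c \<Longrightarrow> V \<le> V' \<Longrightarrow> fits V' c"
proof (induction c)
  case (Op i) then show ?case by (cases i) auto
qed auto

lemma ex_fits: "\<exists>V\<ge>m. fits V c"
proof (induction c)
  case (Op i)
  show ?case
  proof (cases i)
    case (First x) then show ?thesis by (intro exI[of _ "m + x + 1"]) auto
  next
    case (Shift x y) then show ?thesis by (intro exI[of _ "m + x + y + 1"]) auto
  next
    case (Pw x f y z) then show ?thesis by (intro exI[of _ "m + x + y + z + 1"]) auto
  next
    case (Test x) then show ?thesis by (intro exI[of _ "m + x + 1"]) auto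
  qed auto
next
  case (Seq c1 c2)
  then obtain V1 V2 where "V1 \<ge> m" "fits V1 c1" "fits V2 c2" by auto
  then show ?case
    by (intro exI[of _ "max V1 V2"]) (auto intro: fits_mono simp: le_max_iff_disj)
next
  case (Cond r c1 c2)
  then obtain V1 V2 where "V1 \<ge> m" "fits V1 c1" "fits V2 c2" by auto
  then show ?case
    by (intro exI[of _ "V1 + V2 + r + 1"]) (auto intro: fits_mono)
next
  case (While r c)
  then obtain V1 where "V1 \<ge> m" "fits V1 c" by auto
  then show ?case by (intro exI[of _ "V1 + r + 1"]) (auto intro: fits_mono)
qed auto

lemma fits_hd: "fits V c \<Longrightarrow> ifits V (hd_instr c)"
  by (induction c) auto

lemma fits_nxt: "fits V c \<Longrightarrow> fits V (nxt b c)"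
  by (induction c) auto

section \<open>Simulation by a Turing machine\<close>

text \<open>Every sweep starts with carry true; hence a shift carries the negation of the bit to be moved.\<close>

fun act :: "instr \<Rightarrow> bool \<Rightarrow> nat set \<Rightarrow> bool \<times> nat set" where
  "act Nop b X = (b, X)"
| "act (First x) b X = (False, if b then insert x X else X - {x})"
| "act (Shift x y) b X = (y \<notin> X, if b then X - {x} else insert x X)"
| "act (Pw x f y z) b X = (b, if f (y \<in> X) (z \<in> X) then insert x X else X - {x})"
| "act (Test x) b X = (b \<and> x \<notin> X, X)"

fun mealy :: "(bool \<Rightarrow> nat set \<Rightarrow> bool \<times> nat set) \<Rightarrow> bool \<Rightarrow> nat set list \<Rightarrow> bool \<times> nat set list" where
  "mealy f b [] = (b, [])"
| "mealy f b (X # L) =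
    (let (b', Y) = f b X; (b'', L') = mealy f b' L in (b'', Y # L'))"

text \<open>Cutting off the marks from \<open>V\<close> on keeps every written symbol inside the
  finite alphabet in every control state, without an invariant on programs.\<close>

definition act_in :: "nat \<Rightarrow> instr \<Rightarrow> bool \<Rightarrow> nat set \<Rightarrow> bool \<times> nat set" where
  "act_in V i b X = (let (b', Y) = act i b X in (b', Y \<inter> {..<V}))"

definition cell :: "nat \<Rightarrow> (nat \<Rightarrow> nat set) \<Rightarrow> nat \<Rightarrow> nat set" where
  "cell V s p = {r. r < V \<and> p \<in> s r}"

definition cells :: "nat \<Rightarrow> nat \<Rightarrow> (nat \<Rightarrow> nat set) \<Rightarrow> nat set list" where
  "cells V n s = map (cell V s) [0..<n + 1]"

text \<open>\<open>\<beta> p\<close> is the state in which the automaton enters cell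
  \<open>p\<close>. A closed form of these states reduces a whole sweep to a check of single
  cells.\<close>

lemma mealy_map:
  assumes "\<And>p. i \<le> p \<Longrightarrow> p < m \<Longrightarrow> f (\<beta> p) (g p) = (\<beta> (Suc p), g' p)" and "i \<le> m"
  shows "mealy f (\<beta> i) (map g [i..<m]) = (\<beta> m, map g' [i..<m])"
  using assms(2,1)
proof (induction "m - i" arbitrary: i)
  case (Suc j)
  then have "i < m" by auto
  then have "[i..<m] = i # [Suc i..<m]" by (simp add: upt_conv_Cons)
  moreover have "mealy f (\<beta> (Suc i)) (map g [Suc i..<m]) = (\<beta> m, map g' [Suc i..<m])"
    using Suc by auto
  ultimately show ?case using Suc(4)[of i] \<open>i < m\<close> by simp
qed auto

lemma mealy_cells:
  assumes "ifits V i"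
  shows "mealy (act_in V i) True (cells V n s) = (carry n i s, cells V n (eff n i s))"
proof -
  \<comment> \<open>For \<open>Shift\<close> the carry is the negation of the bit of cell
    \<open>p - 1\<close>; being true at 0, it shifts nothing into the first cell. For
    \<open>Test\<close> it says that no mark has been met so far.\<close>
  define \<beta> where "\<beta> = (\<lambda>p. case i of First x \<Rightarrow> p = 0 | Shift x y \<Rightarrow> p = 0 \<or> p - 1 \<notin> s y
     | Test x \<Rightarrow> (\<forall>q<p. q \<notin> s x) | _ \<Rightarrow> True)"
  have st: "act_in V i (\<beta> p) (cell V s p) = (\<beta> (Suc p), cell V (eff n i s) p)" if "p < n + 1" for p
  proof (cases i)
    case (Shift x y)
    have "p \<in> Suc ` s y \<longleftrightarrow> p \<noteq> 0 \<and> p - 1 \<in> s y" by (cases p) auto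
    then show ?thesis using assms that Shift by (auto simp: act_in_def \<beta>_def cell_def)
  next
    case (Test x)
    then show ?thesis using assms that
      by (auto simp: act_in_def \<beta>_def cell_def less_Suc_eq)
  qed (use assms that in \<open>auto simp: act_in_def \<beta>_def cell_def\<close>)
  have "\<beta> 0" by (cases i) (auto simp: \<beta>_def)
  moreover have "\<beta> (n + 1) = carry n i s"
    by (cases i) (auto simp: \<beta>_def)
  moreover have "mealy (act_in V i) (\<beta> 0) (map (cell V s) [0..<n+1])
      = (\<beta> (n+1), map (cell V (eff n i s)) [0..<n+1])"
    by (rule mealy_map) (use st in auto)
  ultimately show ?thesis by (simp add: cells_def)
qed

definition astep :: "('s \<Rightarrow> nat \<Rightarrow> 's \<times> nat \<times> int) \<Rightarrow> 's \<Rightarrow> 's \<Rightarrow> 's \<times> (int \<Rightarrow> nat) \<times> int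
    \<Rightarrow> 's \<times> (int \<Rightarrow> nat) \<times> int" where
  "astep \<delta> sa sr = (\<lambda>(q, T, h). if q = sa \<or> q = sr then (q, T, h)
     else (case \<delta> q (T h) of (q', b, m) \<Rightarrow> (q', T(h := b), h + m)))"

text \<open>The start state of a \<open>tm\<close> is fixed to be 0, so an arbitrary numbering is
  composed with the transposition of 0 and the number of \<open>s\<close>.\<close>

lemma ex_enum_with_zero:
  assumes "finite Q" "s \<in> Q"
  shows "\<exists>f. bij_betw f Q {..<card Q} \<and> f s = (0::nat)"
proof -
  obtain g where g: "bij_betw g Q {..<card Q}"
    using ex_bij_betw_finite_nat[OF assms(1)] by (auto simp: atLeast0LessThan)
  let ?t = "\<lambda>n. if n = g s then 0 else if n = 0 then g s else n"
  have "g s < card Q" using g assms(2) by (auto simp: bij_betw_def)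
  then have "bij_betw ?t {..<card Q} {..<card Q}"
    by (intro bij_betw_byWitness[where f' = ?t]) auto
  from bij_betw_trans[OF g this] show ?thesis by (intro exI[of _ "?t \<circ> g"]) auto
qed

lemma tm_of_finite_machine:
  fixes \<delta> :: "'s \<Rightarrow> nat \<Rightarrow> 's \<times> nat \<times> int"
  assumes "finite Q" "s0 \<in> Q" "sa \<in> Q" "sr \<in> Q" "sa \<noteq> sr" "5 \<le> N"
    and closed: "\<And>q a. q \<in> Q \<Longrightarrow> a < N \<Longrightarrow>
      (case \<delta> q a of (q', b, m) \<Rightarrow> q' \<in> Q \<and> b < N \<and> m \<in> {-1, 0, 1})"
  shows "\<exists>M. wf_tm M \<and> (\<forall>x t v. set x \<subseteq> {..<N} \<longrightarrow>
     fst ((astep \<delta> sa sr ^^ t) (s0, snd (init x))) = (if v then sa else sr) \<longrightarrow> decides_within M x t v)"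
proof -
  obtain f where f: "bij_betw f Q {..<card Q}" and f0: "f s0 = 0"
    using ex_enum_with_zero[OF assms(1,2)] by blast
  define g where "g = inv_into Q f"
  have gf: "g (f q) = q" if "q \<in> Q" for q
    using f that by (auto simp: g_def bij_betw_def inv_into_f_f)
  have gQ: "g n \<in> Q" if "n < card Q" for n
    using f that by (auto simp: g_def bij_betw_def inv_into_into)
  have fQ: "f q < card Q" if "q \<in> Q" for q using f that by (auto simp: bij_betw_def)
  have finj: "f q = f q' \<longleftrightarrow> q = q'" if "q \<in> Q" "q' \<in> Q" for q q'
    using gf that by metis
  define M where "M = TM (card Q) N (\<lambda>n a. case \<delta> (g n) a of (q', b, m) \<Rightarrow> (f q', b, m)) (f sa) (f sr)"
  have wf: "wf_tm M"
    unfolding wf_tm_def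
  proof (intro conjI allI impI)
    fix q a assume "q < nst M" "a < nsym M"
    then have "q < card Q" "a < N" by (auto simp: M_def)
    with closed[OF gQ, of q a] fQ show "case delta M q a of (q', b, m) \<Rightarrow>
        q' < nst M \<and> b < nsym M \<and> m \<in> {-1, 0, 1}"
      by (auto simp: M_def split: prod.splits)
  qed (use assms fQ finj in \<open>auto simp: M_def card_gt_0_iff\<close>)
  have sim: "\<exists>q T h. (astep \<delta> sa sr ^^ t) (s0, snd (init x)) = (q, T, h) \<and>
     (step M ^^ t) (init x) = (f q, T, h) \<and> q \<in> Q \<and> (\<forall>i. T i < N)" if "set x \<subseteq> {..<N}" for x t
  proof (induction t)
    case 0
    have "\<And>i. i < length x \<Longrightarrow> x ! i < N" using that nth_mem by fastforce
    then show ?case using assms f0 by (auto simp: init_def)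
  next
    case (Suc t)
    then obtain q T h where 1: "(astep \<delta> sa sr ^^ t) (s0, snd (init x)) = (q, T, h)"
      "(step M ^^ t) (init x) = (f q, T, h)" "q \<in> Q" "\<forall>i. T i < N" by auto
    obtain q' b m where d: "\<delta> q (T h) = (q', b, m)" by (metis surj_pair)
    have 2: "astep \<delta> sa sr (q, T, h) = (if q = sa \<or> q = sr then (q, T, h) else (q', T(h := b), h + m))"
      using d by (simp add: astep_def)
    have 3: "step M (f q, T, h) = (if q = sa \<or> q = sr then (f q, T, h) else (f q', T(h := b), h + m))"
      using d 1(3) assms by (simp add: step_def M_def finj gf)
    have 4: "q' \<in> Q \<and> b < N" using closed[OF 1(3), of "T h"] 1(4) d by simp
    show ?case using 1 4 by (simp add: 2 3)
  qed
  have "decides_within M x t v" if "set x \<subseteq> {..<N}"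
    "fst ((astep \<delta> sa sr ^^ t) (s0, snd (init x))) = (if v then sa else sr)" for x t v
    using sim[OF that(1), of t] that(2) assms finj
    by (auto simp: decides_within_def M_def Let_def split: if_splits)
  with wf show ?thesis by blast
qed

text \<open>Symbols below 5 are input letters or blank; \<open>5 + set_encode X\<close> is a cell with the set \<open>X\<close> of
  register marks. Thus both ends of the converted part are recognised by a symbol below 5.\<close>

datatype tstate = Conv | Back com | Go com bool

definition code :: "nat set \<Rightarrow> nat" where
  "code X = 5 + set_encode X"

text \<open>\<open>Conv\<close> also turns the blank behind the input into an empty cell, so that a
  word of length \<open>n\<close> provides the positions 0 to \<open>n\<close>, including the one
  just past its last letter.\<close>

fun trans :: "nat \<Rightarrow> com \<Rightarrow> tstate \<Rightarrow> nat \<Rightarrow> tstate \<times> nat \<times> int" where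
  "trans V c0 Conv a = (if a = 0 then (Back c0, code {}, -1)
      else if a < 5 then (Conv, code {a}, 1) else (Conv, a, 0))"
| "trans V c0 (Back c) a = (if a < 5 then (Go c True, a, 1) else (Back c, a, -1))"
| "trans V c0 (Go c b) a = (if a < 5 then (Back (nxt b c), a, -1)
      else (case act_in V (hd_instr c) b (set_decode (a - 5)) of (b', X) \<Rightarrow> (Go c b', code X, 1)))"

definition tape_of :: "nat set list \<Rightarrow> int \<Rightarrow> nat" where
  "tape_of L i = (if 0 \<le> i \<and> i < int (length L) then code (L ! nat i) else 0)"

lemma code_less: "X \<subseteq> {..<V} \<Longrightarrow> code X < 5 + 2 ^ V"
proof -
  assume X: "X \<subseteq> {..<V}"
  have "set_encode X \<le> set_encode {..<V}"
    unfolding set_encode_def by (rule sum_mono2) (use X in auto)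
  also have "\<dots> < 2 ^ V" unfolding set_encode_def by (induction V) (auto simp: lessThan_Suc)
  finally show ?thesis by (simp add: code_def)
qed

abbreviation tstep :: "nat \<Rightarrow> com \<Rightarrow> tstate \<times> (int \<Rightarrow> nat) \<times> int \<Rightarrow> tstate \<times> (int \<Rightarrow> nat) \<times> int" where
  "tstep V c0 \<equiv> astep (trans V c0) (Go (Halt True) True) (Go (Halt False) True)"

lemma tape_of_upd: "(tape_of (D @ X # L))(int (length D) := code Y) = tape_of (D @ Y # L)"
  by (rule ext) (auto simp: tape_of_def nth_append nth_Cons split: nat.splits)

lemma tape_of_mid: "tape_of (D @ X # L) (int (length D)) = code X"
  by (auto simp: tape_of_def)

lemma Go_sweep:
  assumes "\<And>b. c \<noteq> Halt b" and "\<forall>X\<in>set L. finite X" and "mealy (act_in V (hd_instr c)) b L = (b', L')"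
  shows "(tstep V c0 ^^ length L) (Go c b, tape_of (D @ L), int (length D))
     = (Go c b', tape_of (D @ L'), int (length D + length L))"
  using assms(2,3)
proof (induction L arbitrary: D b L')
  case (Cons X L)
  obtain b1 Y where 1: "act_in V (hd_instr c) b X = (b1, Y)" by fastforce
  obtain L1 where 2: "mealy (act_in V (hd_instr c)) b1 L = (b', L1)" "L' = Y # L1"
    using Cons.prems 1 by (auto split: prod.splits)
  have "tstep V c0 (Go c b, tape_of (D @ X # L), int (length D)) =
    (Go c b1, tape_of ((D @ [Y]) @ L), int (length (D @ [Y])))"
    using assms(1) Cons.prems(1) 1 tape_of_upd[of D X L Y]
    by (simp add: astep_def tape_of_mid code_def)
  moreover have "(tstep V c0 ^^ length L) (Go c b1, tape_of ((D @ [Y]) @ L), int (length (D @ [Y]))) =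
    (Go c b', tape_of ((D @ [Y]) @ L1), int (length (D @ [Y]) + length L))"
    by (rule Cons.IH) (use Cons.prems 2 in auto)
  ultimately show ?case using 2 by (simp add: funpow_Suc_right del: funpow.simps)
qed simp

lemma Back_sweep:
  assumes "m \<le> length L"
  shows "(tstep V c0 ^^ (m + 1)) (Back c, tape_of L, int m - 1) = (Go c True, tape_of L, 0)"
  using assms
proof (induction m)
  case 0
  show ?case by (auto simp: astep_def tape_of_def)
next
  case (Suc m)
  have "tstep V c0 (Back c, tape_of L, int (Suc m) - 1) = (Back c, tape_of L, int m - 1)"
    using Suc.prems by (auto simp: astep_def tape_of_def code_def)
  with Suc show ?case by (simp add: funpow_Suc_right del: funpow.simps)
qed

lemma length_cells [simp]: "length (cells V n s) = n + 1"
  by (simp add: cells_def)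

lemma finite_cells: "X \<in> set (cells V n s) \<Longrightarrow> finite X"
  by (auto simp: cells_def cell_def)

lemma funpow_apply_add: "(f ^^ (m + n)) x = (f ^^ n) ((f ^^ m) x)"
  by (metis add.commute comp_apply funpow_add)

lemma funpow_one: "(f ^^ 1) x = f x" for f :: "'a \<Rightarrow> 'a"
  by simp

text \<open>The count consists of \<open>n + 1\<close> cells to the right, one turn at the right
  blank, \<open>n + 1\<close> cells back and one turn at the left blank. A halted program is a fixed
  point on both sides.\<close>

lemma sweep_simulates_sstep:
  assumes "fits V c"
  shows "(tstep V c0 ^^ (2 * n + 4)) (Go c True, tape_of (cells V n s), 0)
    = (case sstep n (c, s) of (c', s') \<Rightarrow> (Go c' True, tape_of (cells V n s'), 0))"
proof (cases "\<exists>b. c = Halt b")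
  case True
  then obtain b where b: "c = Halt b" by auto
  have fix': "tstep V c0 (Go c True, tape_of (cells V n s), 0) = (Go c True, tape_of (cells V n s), 0)"
    using b by (cases b) (auto simp: astep_def)
  have "(tstep V c0 ^^ m) (Go c True, tape_of (cells V n s), 0) = (Go c True, tape_of (cells V n s), 0)" for m
    by (induction m) (use fix' in auto)
  then show ?thesis using b by simp
next
  case False
  let ?c = "nxt (carry n (hd_instr c) s) c" and ?s = "eff n (hd_instr c) s"
  have 1: "(tstep V c0 ^^ (n + 1)) (Go c True, tape_of (cells V n s), 0)
     = (Go c (carry n (hd_instr c) s), tape_of (cells V n ?s), int n + 1)"
    using Go_sweep[of c "cells V n s" V True _ _ c0 "[]"] mealy_cells[OF fits_hd[OF assms], of n s]
      finite_cells False by (auto simp del: funpow.simps)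
  have 2: "tstep V c0 (Go c (carry n (hd_instr c) s), tape_of (cells V n ?s), int n + 1)
     = (Back ?c, tape_of (cells V n ?s), int (n + 1) - 1)"
    using False by (auto simp: astep_def tape_of_def)
  have 3: "(tstep V c0 ^^ ((n + 1) + 1)) (Back ?c, tape_of (cells V n ?s), int (n + 1) - 1)
     = (Go ?c True, tape_of (cells V n ?s), 0)"
    by (rule Back_sweep) simp
  have "2 * n + 4 = (n + 1) + (1 + ((n + 1) + 1))" by simp
  then show ?thesis using 1 2 3
    by (simp only: funpow_apply_add funpow_one sstep.simps prod.case)
qed

text \<open>The initial store: register \<open>a\<close> holds the positions of the letter \<open>a\<close>.\<close>

definition letters :: "nat list \<Rightarrow> nat \<Rightarrow> nat set" where
  "letters w a = (if 1 \<le> a \<and> a \<le> 4 then {p. p < length w \<and> w ! p = a} else {})"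

lemma Conv_sweep:
  assumes "set w \<subseteq> {1..4}" "5 \<le> V" "m \<le> length w"
  shows "(tstep V c0 ^^ m) (Conv, snd (init w)) =
    (Conv, (\<lambda>i. if 0 \<le> i \<and> i < int (length w)
       then (if i < int m then code {w ! nat i} else w ! nat i) else 0), int m)"
  using assms(3)
proof (induction m)
  case 0
  then show ?case by (auto simp: init_def)
next
  case (Suc m)
  then have "w ! m \<in> {1..4}" using assms(1) by (meson Suc_le_eq nth_mem subsetD)
  with Suc show ?case by (auto simp: astep_def)
qed

lemma init_simulation:
  assumes "set w \<subseteq> {1..4}" "5 \<le> V"
  shows "(tstep V c0 ^^ (2 * length w + 2)) (Conv, snd (init w)) =
    (Go c0 True, tape_of (cells V (length w) (letters w)), 0)"
proof -
  let ?n = "length w" and ?L = "cells V (length w) (letters w)"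
  have c: "cell V (letters w) p = {w ! p}" if "p < ?n" for p
  proof -
    have "w ! p \<in> {1..4}" using assms(1) that by (meson nth_mem subsetD)
    with that assms(2) show ?thesis by (auto simp: cell_def letters_def)
  qed
  have c': "cell V (letters w) ?n = {}" by (auto simp: cell_def letters_def)
  have L: "?L ! i = cell V (letters w) i" if "i < ?n + 1" for i
    using that unfolding cells_def by (subst nth_map) (auto simp del: upt_Suc)
  have 1: "(tstep V c0 ^^ 1) ((tstep V c0 ^^ ?n) (Conv, snd (init w))) = (Back c0, tape_of ?L, int ?n - 1)"
    unfolding Conv_sweep[OF assms order_refl] using c c' L
    by (auto simp: astep_def tape_of_def fun_eq_iff)
  have "2 * ?n + 2 = ?n + (1 + (?n + 1))" by simp
  then show ?thesis using Back_sweep[of ?n ?L V c0 c0] 1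
    by (simp only: funpow_apply_add) simp
qed

text \<open>The accepting and rejecting states are fixed points, so the verdict persists. Stating it
  for all later times allows any majorant of the running time as a clock.\<close>

lemma tm_of_com:
  "\<exists>M. wf_tm M \<and> (\<forall>w t v s. set w \<subseteq> {1..4} \<longrightarrow>
    (sstep (length w) ^^ t) (c, letters w) = (Halt v, s) \<longrightarrow>
    (\<forall>t' \<ge> 2 * length w + 2 + t * (2 * length w + 4). decides_within M w t' v))"
proof -
  obtain V where V: "V \<ge> 5" "fits V c" using ex_fits by blast
  \<comment> \<open>Both \<open>Halt\<close> states are added because the accepting and rejecting
    states must exist even if \<open>c\<close> never mentions one of them.\<close>
  let ?P = "points c \<union> {Halt True, Halt False}"
  let ?Q = "{Conv} \<union> Back ` ?P \<union> (\<lambda>(c, b). Go c b) ` (?P \<times> UNIV)"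
  have "finite ?Q" using finite_points by auto
  have ind: "(tstep V c ^^ (t * (2 * length w + 4))) (Go c True, tape_of (cells V (length w) (letters w)), 0)
    = (case (sstep (length w) ^^ t) (c, letters w) of (c', s') \<Rightarrow>
         (Go c' True, tape_of (cells V (length w) s'), 0))
    \<and> fits V (fst ((sstep (length w) ^^ t) (c, letters w)))" for t w
  proof (induction t)
    case 0
    then show ?case using V by simp
  next
    case (Suc t)
    obtain c' s' where cs: "(sstep (length w) ^^ t) (c, letters w) = (c', s')" by fastforce
    have "Suc t * (2 * length w + 4) = t * (2 * length w + 4) + (2 * length w + 4)" by simp
    then have 1: "(tstep V c ^^ (Suc t * (2 * length w + 4))) x =
        (tstep V c ^^ (2 * length w + 4)) ((tstep V c ^^ (t * (2 * length w + 4))) x)" for x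
      by (simp only: funpow_apply_add)
    show ?case using Suc cs sweep_simulates_sstep[of V c' "length w" c s'] fits_nxt[of V c']
      unfolding 1 by simp
  qed
  have P: "nxt b q \<in> ?P" if "q \<in> ?P" for b q using that nxt_in_points by auto
  have "\<exists>M. wf_tm M \<and> (\<forall>x t v. set x \<subseteq> {..<5 + 2 ^ V} \<longrightarrow>
     fst ((tstep V c ^^ t) (Conv, snd (init x))) = (if v then Go (Halt True) True else Go (Halt False) True)
     \<longrightarrow> decides_within M x t v)"
  proof (rule tm_of_finite_machine)
    fix q and a :: nat assume q: "q \<in> ?Q" and a: "a < 5 + 2 ^ V"
    show "case trans V c q a of (q', b, m) \<Rightarrow> q' \<in> ?Q \<and> b < 5 + 2 ^ V \<and> m \<in> {- 1, 0, 1}"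
    proof (cases q)
      case Conv
      then show ?thesis using self_in_points V a by (auto simp: code_less)
    next
      case (Back c')
      then show ?thesis using q a by auto
    next
      case (Go c' b)
      then have c': "c' \<in> ?P" using q by auto
      obtain b' X where bX: "act_in V (hd_instr c') b (set_decode (a - 5)) = (b', X)" by fastforce
      then have "X \<subseteq> {..<V}" by (auto simp: act_in_def split: prod.splits)
      then have "code X < 5 + 2 ^ V" by (rule code_less)
      then show ?thesis using Go c' P[OF c', of b] a bX by auto
    qed
  qed (use \<open>finite ?Q\<close> in auto)
  then obtain M where M: "wf_tm M" "\<And>x t v. set x \<subseteq> {..<5 + 2 ^ V} \<Longrightarrow>
     fst ((tstep V c ^^ t) (Conv, snd (init x))) = (if v then Go (Halt True) True else Go (Halt False) True)
     \<Longrightarrow> decides_within M x t v" by blast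
  have "decides_within M w t' v" if w: "set w \<subseteq> {1..4}"
    and r: "(sstep (length w) ^^ t) (c, letters w) = (Halt v, s)"
    and t': "t' \<ge> 2 * length w + 2 + t * (2 * length w + 4)" for w t v s t'
  proof (rule M(2))
    show "set w \<subseteq> {..<5 + 2 ^ V}" using w by fastforce
    let ?e = "(Go (Halt v) True, tape_of (cells V (length w) s), 0)"
    have 1: "(tstep V c ^^ ((2 * length w + 2) + t * (2 * length w + 4))) (Conv, snd (init w)) = ?e"
      using r ind[of t w] init_simulation[OF w V(1), of c]
      by (simp only: funpow_apply_add) simp
    have st: "tstep V c ?e = ?e" by (cases v) (auto simp: astep_def)
    have "(tstep V c ^^ m) ?e = ?e" for m
      by (induction m) (use st in auto)
    moreover obtain m where "t' = ((2 * length w + 2) + t * (2 * length w + 4)) + m"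
      using t' by (auto simp: le_iff_add)
    ultimately have "(tstep V c ^^ t') (Conv, snd (init w)) = ?e"
      using 1 by (simp only: funpow_apply_add)
    then show "fst ((tstep V c ^^ t') (Conv, snd (init w))) =
      (if v then Go (Halt True) True else Go (Halt False) True)"
      by simp
  qed
  with M(1) show ?thesis by blast
qed

section \<open>Program logic\<close>

type_synonym store = "nat \<Rightarrow> nat set"

text \<open>Total correctness with a time bound: as \<open>Skip\<close> is a fixed point of
  \<open>sstep\<close>, being there after exactly \<open>t\<close> steps means termination within
  \<open>t\<close> steps. A program that ends in \<open>Halt\<close> never satisfies it.\<close>

definition wp :: "nat \<Rightarrow> nat \<Rightarrow> com \<Rightarrow> (store \<Rightarrow> bool) \<Rightarrow> store \<Rightarrow> bool" where
  "wp n t c Q s \<longleftrightarrow> (\<exists>s'. (sstep n ^^ t) (c, s) = (Skip, s') \<and> Q s')"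

lemma sstep_Skip: "(sstep n ^^ t) (Skip, s) = (Skip, s)"
  by (induction t) auto

lemma wp_Skip: "Q s \<Longrightarrow> wp n t Skip Q s"
  by (simp add: wp_def sstep_Skip)

lemma wp_mono:
  assumes "wp n t c Q s" "t \<le> t'" "\<And>s. Q s \<Longrightarrow> Q' s"
  shows "wp n t' c Q' s"
proof -
  obtain m where "t' = t + m" using assms(2) by (auto simp: le_iff_add)
  with assms(1,3) show ?thesis by (auto simp: wp_def funpow_apply_add sstep_Skip)
qed

lemma wp_step:
  assumes "wp n t (nxt (carry n (hd_instr c) s) c) Q (eff n (hd_instr c) s)"
  shows "wp n (Suc t) c Q s"
  using assms by (simp add: wp_def funpow_Suc_right del: funpow.simps)

lemma wp_Op: "Q (eff n i s) \<Longrightarrow> wp n 1 (Op i) Q s"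
  using wp_step[of n 0 "Op i" s Q] by (simp add: wp_Skip)

text \<open>Stated separately from \<open>wp_Seq\<close> because the complete program ends in
  \<open>Halt\<close>, which \<open>wp\<close> does not cover. The extra step discards the finished
  \<open>Skip\<close>.\<close>

lemma Seq_reaches_second:
  assumes "wp n t c Q s"
  shows "\<exists>t'\<le>t + 1. \<exists>s'. (sstep n ^^ t') (Seq c c', s) = (c', s') \<and> Q s'"
  using assms
proof (induction t arbitrary: c s)
  case 0
  then have "c = Skip" "Q s" by (auto simp: wp_def)
  then show ?case by (intro exI[of _ 1]) auto
next
  case (Suc t)
  show ?case
  proof (cases "c = Skip")
    case True
    with Suc.prems have "Q s" by (auto simp: wp_def sstep_Skip simp del: funpow.simps)
    then show ?thesis using True by (intro exI[of _ 1]) auto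
  next
    case False
    have "wp n t (nxt (carry n (hd_instr c) s) c) Q (eff n (hd_instr c) s)"
      using Suc.prems by (simp add: wp_def funpow_Suc_right del: funpow.simps)
    from Suc.IH[OF this] obtain t' s' where t': "t' \<le> t + 1" "Q s'"
      "(sstep n ^^ t') (Seq (nxt (carry n (hd_instr c) s) c) c', eff n (hd_instr c) s) = (c', s')" by blast
    then have "(sstep n ^^ Suc t') (Seq c c', s) = (c', s')"
      using False by (simp add: funpow_Suc_right del: funpow.simps)
    then show ?thesis using t' by (intro exI[of _ "Suc t'"]) auto
  qed
qed

lemma wp_Seq:
  assumes "wp n t1 c1 (\<lambda>s'. wp n t2 c2 Q s') s"
  shows "wp n (t1 + t2 + 1) (Seq c1 c2) Q s"
proof -
  obtain t' s' where t': "t' \<le> t1 + 1" "(sstep n ^^ t') (Seq c1 c2, s) = (c2, s')" "wp n t2 c2 Q s'"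
    using Seq_reaches_second[OF assms] by blast
  then have "wp n (t' + t2) (Seq c1 c2) Q s" by (simp add: wp_def funpow_apply_add)
  then show ?thesis by (rule wp_mono) (use t'(1) in auto)
qed

lemma wp_Cond:
  assumes "s r \<inter> {..n} \<noteq> {} \<Longrightarrow> wp n t c1 Q s" "s r \<inter> {..n} = {} \<Longrightarrow> wp n t c2 Q s"
  shows "wp n (t + 1) (Cond r c1 c2) Q s"
  using assms wp_step[of n t "Cond r c1 c2" s Q] by auto

text \<open>The counter is a singleton \<open>{p}\<close>. Shifting it past position
  \<open>n\<close> empties the register, which ends the loop after \<open>n + 1\<close>
  rounds.\<close>

definition For :: "nat \<Rightarrow> com \<Rightarrow> com" where
  "For r c = Seq (Op (First r)) (While r (Seq c (Op (Shift r r))))"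

text \<open>A round costs 4 steps besides the body: the test, the shift and two discarded
  \<open>Skip\<close>s. The final 3 are \<open>First\<close>, its discarded \<open>Skip\<close> and
  the last test. The frame condition makes the invariant independent of the counter, which the loop
  itself overwrites.\<close>

lemma wp_For:
  assumes body: "\<And>p s. p \<le> n \<Longrightarrow> I p s \<Longrightarrow> s r = {p} \<Longrightarrow> wp n t c (\<lambda>s'. I (Suc p) s' \<and> s' r = {p}) s"
    and frame: "\<And>p s X. I p s \<Longrightarrow> I p (s(r := X))"
    and "I 0 s"
  shows "wp n ((n + 1) * (t + 4) + 3) (For r c) (I (Suc n)) s"
proof -
  let ?W = "While r (Seq c (Op (Shift r r)))"
  have loop: "wp n ((n + 1 - p) * (t + 4) + 1) ?W (I (Suc n)) s"
    if "p \<le> n + 1" "I p s" "s r = {p} \<inter> {..n}" for p s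
    using that
  proof (induction "n + 1 - p" arbitrary: p s)
    case 0
    then show ?case using wp_step[of n 0 ?W s] by (simp add: wp_Skip)
  next
    case (Suc m)
    then have p: "p \<le> n" by simp
    have "wp n 1 (Op (Shift r r)) (\<lambda>s. I (Suc p) s \<and> s r = {Suc p} \<inter> {..n}) s"
      if "I (Suc p) s \<and> s r = {p}" for s
      using that frame by (intro wp_Op) auto
    then have 1: "wp n (t + 1 + 1) (Seq c (Op (Shift r r))) (\<lambda>s. I (Suc p) s \<and> s r = {Suc p} \<inter> {..n}) s"
      using Suc.prems(3) p by (intro wp_Seq wp_mono[OF body[OF p Suc.prems(2)]]) auto
    have m: "m = n + 1 - Suc p" using Suc(2) by simp
    have "wp n (m * (t + 4) + 1) ?W (I (Suc n)) s" if "I (Suc p) s \<and> s r = {Suc p} \<inter> {..n}" for s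
      using Suc.hyps(1)[OF m] that p m by simp
    then have "wp n ((t + 1 + 1) + (m * (t + 4) + 1) + 1) (Seq (Seq c (Op (Shift r r))) ?W) (I (Suc n)) s"
      by (intro wp_Seq wp_mono[OF 1]) auto
    then have "wp n (Suc ((t + 1 + 1) + (m * (t + 4) + 1) + 1)) ?W (I (Suc n)) s"
      using Suc.prems(3) p by (intro wp_step) auto
    moreover have "n + 1 - p = Suc m" using Suc(2) by simp
    ultimately show ?case by (elim wp_mono) auto
  qed
  have "wp n (1 + ((n + 1 - 0) * (t + 4) + 1) + 1) (For r c) (I (Suc n)) s"
    unfolding For_def using assms(3) by (intro wp_Seq wp_Op loop) (auto intro: frame)
  then show ?thesis by (rule wp_mono) auto
qed

definition poly :: "(nat \<Rightarrow> nat) \<Rightarrow> bool" where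
  "poly f \<longleftrightarrow> (\<exists>c d. \<forall>n. f n \<le> c * (n + 1) ^ d)"

lemma poly_const [intro]: "poly (\<lambda>n. c)"
  unfolding poly_def by (intro exI[of _ c] exI[of _ 0]) auto

lemma poly_id [intro]: "poly (\<lambda>n. n)"
  unfolding poly_def by (intro exI[of _ 1]) auto

lemma poly_add [intro]:
  assumes "poly f" "poly g" shows "poly (\<lambda>n. f n + g n)"
proof -
  obtain c d c' d' where 1: "\<And>n. f n \<le> c * (n + 1) ^ d" "\<And>n. g n \<le> c' * (n + 1) ^ d'"
    using assms by (auto simp: poly_def)
  have "f n + g n \<le> (c + c') * (n + 1) ^ (d + d')" for n
  proof -
    have "c * (n + 1) ^ d \<le> c * (n + 1) ^ (d + d')" "c' * (n + 1) ^ d' \<le> c' * (n + 1) ^ (d + d')"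
      by (intro mult_left_mono power_increasing; simp)+
    with 1[of n] show ?thesis unfolding add_mult_distrib by linarith
  qed
  then show ?thesis unfolding poly_def by blast
qed

lemma poly_mult [intro]:
  assumes "poly f" "poly g" shows "poly (\<lambda>n. f n * g n)"
proof -
  obtain c d c' d' where 1: "\<And>n. f n \<le> c * (n + 1) ^ d" "\<And>n. g n \<le> c' * (n + 1) ^ d'"
    using assms by (auto simp: poly_def)
  have "f n * g n \<le> (c * c') * (n + 1) ^ (d + d')" for n
    using mult_le_mono[OF 1(1)[of n] 1(2)[of n]] by (simp add: power_add algebra_simps)
  then show ?thesis unfolding poly_def by blast
qed

section \<open>Predicates decidable in polynomial time\<close>

text \<open>Register 0 holds \<open>{0}\<close>, registers 1 to 4 the letters and register 5 the result. The \<open>v\<close>-th position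
  variable lives in \<open>vr v\<close> and is accompanied by the scratch register \<open>sr v\<close>. A program at level \<open>d\<close>
  uses the variables below \<open>d\<close> as input and changes no register of these, except for register 5.\<close>

definition vr :: "nat \<Rightarrow> nat" where "vr v = 6 + 2 * v"
definition sr :: "nat \<Rightarrow> nat" where "sr v = 7 + 2 * v"

definition ok :: "nat list \<Rightarrow> nat \<Rightarrow> (nat \<Rightarrow> nat) \<Rightarrow> store \<Rightarrow> bool" where
  "ok w d e s \<longleftrightarrow> s 0 = {0} \<and> (\<forall>a\<in>{1..4}. s a = letters w a) \<and>
     (\<forall>v<d. s (vr v) = {e v} \<and> e v \<le> length w)"

definition same :: "nat \<Rightarrow> store \<Rightarrow> store \<Rightarrow> bool" where
  "same d s s' \<longleftrightarrow> (\<forall>r<6 + 2 * d. r \<noteq> 5 \<longrightarrow> s' r = s r)"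

definition computes :: "com \<Rightarrow> (nat \<Rightarrow> nat) \<Rightarrow> nat \<Rightarrow> (nat list \<Rightarrow> (nat \<Rightarrow> nat) \<Rightarrow> bool) \<Rightarrow> bool" where
  "computes c t d P \<longleftrightarrow> poly t \<and> (\<forall>w e s. ok w d e s \<longrightarrow> wp (length w) (t (length w)) c
     (\<lambda>s'. (s' 5 \<inter> {..length w} \<noteq> {} \<longleftrightarrow> P w e) \<and> same d s s') s)"

definition dec :: "nat \<Rightarrow> (nat list \<Rightarrow> (nat \<Rightarrow> nat) \<Rightarrow> bool) \<Rightarrow> bool" where
  "dec d P \<longleftrightarrow> (\<exists>c t. computes c t d P)"

lemma computes_poly: "computes c t d P \<Longrightarrow> poly t"
  by (simp add: computes_def)

lemmas poly_intros = poly_add poly_mult poly_const poly_id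

lemma decI:
  assumes "poly t" "\<And>w e s. ok w d e s \<Longrightarrow> wp (length w) (t (length w)) c
     (\<lambda>s'. (s' 5 \<inter> {..length w} \<noteq> {} \<longleftrightarrow> P w e) \<and> same d s s') s"
  shows "dec d P"
  using assms unfolding dec_def computes_def by blast

lemma computesD:
  assumes "computes c t d P" "ok w d e s"
   "\<And>s'. s' 5 \<inter> {..length w} \<noteq> {} \<longleftrightarrow> P w e \<Longrightarrow> same d s s' \<Longrightarrow> Q s'"
  shows "wp (length w) (t (length w)) c Q s"
proof -
  have "wp (length w) (t (length w)) c (\<lambda>s'. (s' 5 \<inter> {..length w} \<noteq> {} \<longleftrightarrow> P w e) \<and> same d s s') s"
    using assms(1,2) by (simp add: computes_def)
  then show ?thesis by (rule wp_mono) (use assms(3) in auto)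
qed

lemma ok_same: "ok w d e s \<Longrightarrow> same d s s' \<Longrightarrow> ok w d e s'"
  by (auto simp: ok_def same_def vr_def)

lemma same_refl [simp]: "same d s s" by (simp add: same_def)

lemma same_trans: "same d s s' \<Longrightarrow> same d s' s'' \<Longrightarrow> same d s s''"
  by (simp add: same_def)

lemma same_mono: "same d' s s' \<Longrightarrow> d \<le> d' \<Longrightarrow> same d s s'"
  by (simp add: same_def)

lemma same_upd: "same d s s' \<Longrightarrow> r = 5 \<or> r \<ge> 6 + 2 * d \<Longrightarrow> same d s (s'(r := X))"
  by (auto simp: same_def)

section \<open>Atomic formulas, Boolean connectives and bounded quantifiers\<close>

lemma dec_letter:
  assumes "x < d" "1 \<le> a" "a \<le> 4"
  shows "dec d (\<lambda>w e. e x < length w \<and> w ! e x = a)"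
proof (rule decI)
  show "wp (length w) 1 (Op (Pw 5 (\<and>) (vr x) a))
     (\<lambda>s'. (s' 5 \<inter> {..length w} \<noteq> {} \<longleftrightarrow> e x < length w \<and> w ! e x = a) \<and> same d s s') s"
    if "ok w d e s" for w e s
    using that assms by (intro wp_Op) (auto simp: ok_def letters_def same_upd)
qed auto

lemma dec_eq:
  assumes "x < d" "y < d"
  shows "dec d (\<lambda>w e. e x = e y)"
proof (rule decI)
  show "wp (length w) 1 (Op (Pw 5 (\<and>) (vr x) (vr y)))
     (\<lambda>s'. (s' 5 \<inter> {..length w} \<noteq> {} \<longleftrightarrow> e x = e y) \<and> same d s s') s"
    if "ok w d e s" for w e s
    using that assms by (intro wp_Op) (auto simp: ok_def same_upd)
qed auto

lemma dec_zero:
  assumes "x < d"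
  shows "dec d (\<lambda>w e. e x = 0)"
proof (rule decI)
  show "wp (length w) 1 (Op (Pw 5 (\<and>) (vr x) 0))
     (\<lambda>s'. (s' 5 \<inter> {..length w} \<noteq> {} \<longleftrightarrow> e x = 0) \<and> same d s s') s"
    if "ok w d e s" for w e s
    using that assms by (intro wp_Op) (auto simp: ok_def same_upd)
qed auto

lemma dec_Suc:
  assumes "x < d" "y < d"
  shows "dec d (\<lambda>w e. e y = Suc (e x))"
proof (rule decI)
  show "wp (length w) (1 + 1 + 1) (Seq (Op (Shift 5 (vr x))) (Op (Pw 5 (\<and>) 5 (vr y))))
     (\<lambda>s'. (s' 5 \<inter> {..length w} \<noteq> {} \<longleftrightarrow> e y = Suc (e x)) \<and> same d s s') s"
    if "ok w d e s" for w e s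
    using that assms by (intro wp_Seq wp_Op) (auto simp: ok_def same_upd vr_def)
qed auto

lemma dec_const: "dec d (\<lambda>w e. b)"
proof (rule decI)
  show "wp (length w) 1 (Op (Pw 5 (\<lambda>_ _. b) 5 5))
     (\<lambda>s'. (s' 5 \<inter> {..length w} \<noteq> {} \<longleftrightarrow> b) \<and> same d s s') s"
    if "ok w d e s" for w e s
    using that by (intro wp_Op) (auto simp: same_upd)
qed auto

lemma dec_not:
  assumes "dec d P"
  shows "dec d (\<lambda>w e. \<not> P w e)"
proof -
  obtain c t where c: "computes c t d P" using assms by (auto simp: dec_def)
  let ?c = "Seq c (Cond 5 (Op (Pw 5 (\<lambda>_ _. False) 5 5)) (Op (First 5)))"
  show ?thesis
  proof (rule decI)
    show "poly (\<lambda>n. t n + (1 + 1) + 1)" by (intro poly_intros computes_poly[OF c])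
    show "wp (length w) (t (length w) + (1 + 1) + 1) ?c
       (\<lambda>s'. (s' 5 \<inter> {..length w} \<noteq> {} \<longleftrightarrow> \<not> P w e) \<and> same d s s') s"
      if "ok w d e s" for w e s
      by (intro wp_Seq computesD[OF c that] wp_Cond wp_Op) (auto simp: same_upd)
  qed
qed

lemma dec_conj:
  assumes "dec d P" "dec d Q"
  shows "dec d (\<lambda>w e. P w e \<and> Q w e)"
proof -
  obtain c t c' t' where c: "computes c t d P" "computes c' t' d Q" using assms by (auto simp: dec_def)
  let ?c = "Seq c (Cond 5 c' Skip)"
  show ?thesis
  proof (rule decI)
    show "poly (\<lambda>n. t n + (t' n + 1) + 1)" by (intro poly_intros c[THEN computes_poly])
    show "wp (length w) (t (length w) + (t' (length w) + 1) + 1) ?c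
       (\<lambda>s'. (s' 5 \<inter> {..length w} \<noteq> {} \<longleftrightarrow> P w e \<and> Q w e) \<and> same d s s') s"
      if o: "ok w d e s" for w e s
    proof (intro wp_Seq computesD[OF c(1) o] wp_Cond)
      fix s' assume s': "s' 5 \<inter> {..length w} \<noteq> {} \<longleftrightarrow> P w e" "same d s s'"
      show "wp (length w) (t' (length w)) c' (\<lambda>s'. (s' 5 \<inter> {..length w} \<noteq> {} \<longleftrightarrow> P w e \<and> Q w e) \<and> same d s s') s'"
        if "s' 5 \<inter> {..length w} \<noteq> {}"
        by (rule computesD[OF c(2) ok_same[OF o s'(2)]]) (use that s' in \<open>auto intro: same_trans\<close>)
      show "wp (length w) (t' (length w)) Skip (\<lambda>s'. (s' 5 \<inter> {..length w} \<noteq> {} \<longleftrightarrow> P w e \<and> Q w e) \<and> same d s s') s'"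
        if "s' 5 \<inter> {..length w} = {}"
        by (rule wp_Skip) (use that s' in auto)
    qed
  qed
qed

lemma dec_disj: "dec d P \<Longrightarrow> dec d Q \<Longrightarrow> dec d (\<lambda>w e. P w e \<or> Q w e)"
  using dec_not[OF dec_conj[OF dec_not[of d P] dec_not[of d Q]]] by simp

lemma dec_all_less: "(\<And>i::nat. i < m \<Longrightarrow> dec d (\<lambda>w e. P i w e)) \<Longrightarrow> dec d (\<lambda>w e. \<forall>i<m. P i w e)"
proof (induction m)
  case 0
  then show ?case using dec_const[of d True] by simp
next
  case (Suc m)
  then have "dec d (\<lambda>w e. P m w e \<and> (\<forall>i<m. P i w e))" by (intro dec_conj) auto
  then show ?case by (simp add: All_less_Suc)
qed

lemma dec_ex_less: "(\<And>i::nat. i < m \<Longrightarrow> dec d (\<lambda>w e. P i w e)) \<Longrightarrow> dec d (\<lambda>w e. \<exists>i<m. P i w e)"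
  using dec_not[OF dec_all_less[of m d "\<lambda>i w e. \<not> P i w e"]] dec_not by simp

text \<open>Exhaustive search. Each run of the body overwrites register 5, so success is recorded in
  \<open>sr d\<close>, which belongs to the registers that a program at level \<open>Suc d\<close>
  preserves.\<close>

lemma dec_ex_upd:
  assumes "dec (Suc d) P"
  shows "dec d (\<lambda>w e. \<exists>p\<le>length w. P w (e(d := p)))"
proof -
  obtain c t where c: "computes c t (Suc d) P" using assms by (auto simp: dec_def)
  let ?c = "Seq c (Cond 5 (Op (First (sr d))) Skip)"
  let ?p = "Seq (Op (Pw (sr d) (\<lambda>_ _. False) 5 5)) (Seq (For (vr d) ?c) (Op (Pw 5 (\<and>) (sr d) (sr d))))"
  show ?thesis
  proof (rule decI)
    show "poly (\<lambda>n. 1 + (((n + 1) * ((t n + (1 + 1) + 1) + 4) + 3) + 1 + 1) + 1)"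
      by (intro poly_intros computes_poly[OF c])
    fix w e s assume o: "ok w d e s"
    let ?n = "length w"
    define I where "I = (\<lambda>p s'. same d s s' \<and> s' (sr d) \<subseteq> {..?n} \<and>
       (s' (sr d) \<noteq> {} \<longleftrightarrow> (\<exists>q<p. q \<le> ?n \<and> P w (e(d := q)))))"
    have body: "wp ?n (t ?n + (1 + 1) + 1) ?c (\<lambda>s''. I (Suc p) s'' \<and> s'' (vr d) = {p}) s'"
      if p: "p \<le> ?n" "I p s'" "s' (vr d) = {p}" for p s'
    proof -
      have o': "ok w (Suc d) (e(d := p)) s'"
        using ok_same[OF o, of s'] p by (auto simp: ok_def I_def less_Suc_eq)
      have "wp ?n (1 + 1) (Cond 5 (Op (First (sr d))) Skip)
         (\<lambda>s''. I (Suc p) s'' \<and> s'' (vr d) = {p}) s''"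
        if s: "s'' 5 \<inter> {..?n} \<noteq> {} \<longleftrightarrow> P w (e(d := p))" "same (Suc d) s' s''" for s''
      proof -
        have "s'' (sr d) = s' (sr d)" "s'' (vr d) = s' (vr d)" "same d s s''"
          using s(2) p(2) by (auto simp: same_def sr_def vr_def I_def)
        then show ?thesis using p s(1)
          by (intro wp_Cond wp_Op wp_Skip) (auto simp: I_def less_Suc_eq sr_def vr_def intro!: same_upd)
      qed
      then show ?thesis by (intro wp_Seq computesD[OF c o'])
    qed
    have frame: "I p (s'(vr d := X))" if "I p s'" for p s' X
      using that by (auto simp: I_def sr_def vr_def intro: same_upd)
    have fin: "wp ?n 1 (Op (Pw 5 (\<and>) (sr d) (sr d))) (\<lambda>s'. (s' 5 \<inter> {..?n} \<noteq> {} \<longleftrightarrow>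
         (\<exists>p\<le>?n. P w (e(d := p)))) \<and> same d s s') s'" if "I (Suc ?n) s'" for s'
    proof -
      have "{p. p \<le> ?n \<and> p \<in> s' (sr d)} = s' (sr d)" using that by (auto simp: I_def)
      then show ?thesis using that
        by (intro wp_Op) (auto simp: I_def less_Suc_eq_le intro!: same_upd)
    qed
    have 0: "I 0 (s(sr d := {}))" by (auto simp: I_def sr_def intro!: same_upd)
    have "wp ?n ((?n + 1) * ((t ?n + (1 + 1) + 1) + 4) + 3) (For (vr d) ?c) (I (Suc ?n)) (s(sr d := {}))"
      using wp_For[OF body frame 0] by (rule wp_mono) auto
    then have "wp ?n ((?n + 1) * ((t ?n + (1 + 1) + 1) + 4) + 3) (For (vr d) ?c)
      (\<lambda>s'. wp ?n 1 (Op (Pw 5 (\<and>) (sr d) (sr d))) (\<lambda>s'. (s' 5 \<inter> {..?n} \<noteq> {} \<longleftrightarrow>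
         (\<exists>p\<le>?n. P w (e(d := p)))) \<and> same d s s') s') (s(sr d := {}))"
      by (rule wp_mono) (use fin in auto)
    then show "wp ?n (1 + (((?n + 1) * ((t ?n + (1 + 1) + 1) + 4) + 3) + 1 + 1) + 1) ?p
      (\<lambda>s'. (s' 5 \<inter> {..?n} \<noteq> {} \<longleftrightarrow> (\<exists>p\<le>?n. P w (e(d := p)))) \<and> same d s s') s"
      by (intro wp_Seq wp_Op) simp
  qed
qed

text \<open>The second hypothesis says that \<open>Q\<close> sees the new variable only through its
  last argument. This removes the updated environment from the conclusion, so that the rule applies
  to formulas as they are written.\<close>

lemma dec_ex:
  assumes "dec (Suc d) (\<lambda>w e. Q w e (e d))" "\<And>w e p. Q w (e(d := p)) p = Q w e p"
  shows "dec d (\<lambda>w e. \<exists>p\<le>length w. Q w e p)"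
  using dec_ex_upd[OF assms(1)] assms(2) by simp

lemma ok_upd2:
  assumes "ok w d e s" "same d s s'" "s' (vr d) = {u}" "s' (vr (Suc d)) = {v}" "u \<le> length w" "v \<le> length w"
  shows "ok w (Suc (Suc d)) (e(d := u, Suc d := v)) s'"
  using ok_same[OF assms(1,2)] assms(3-) by (auto simp: ok_def less_Suc_eq)

text \<open>The index \<open>m\<close> at which \<open>A\<close> first fails is found by moving two markers in parallel.\<close>

lemma dec_sync:
  assumes "dec (Suc (Suc d)) A" "dec (Suc (Suc d)) Q" "x < d" "y < d"
    and lt: "\<And>w e. A w e \<Longrightarrow> e d < length w \<and> e (Suc d) < length w"
  shows "dec d (\<lambda>w e. \<exists>m. (\<forall>t<m. A w (e(d := e x + t, Suc d := e y + t))) \<and>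
    \<not> A w (e(d := e x + m, Suc d := e y + m)) \<and> Q w (e(d := e x + m, Suc d := e y + m)))"
proof -
  obtain c t where c: "computes c t (Suc (Suc d)) A" using assms(1) by (auto simp: dec_def)
  obtain c' t' where c': "computes c' t' (Suc (Suc d)) Q" using assms(2) by (auto simp: dec_def)
  let ?i = "vr d" and ?j = "vr (Suc d)" and ?r = "sr d"
  let ?b = "Seq c (Cond 5 (Seq (Op (Shift ?i ?i)) (Op (Shift ?j ?j))) Skip)"
  let ?p = "Seq (Op (Pw ?i (\<and>) (vr x) (vr x))) (Seq (Op (Pw ?j (\<and>) (vr y) (vr y))) (Seq (For ?r ?b) c'))"
  show ?thesis
  proof (rule decI)
    show "poly (\<lambda>n. 1 + (1 + (((n + 1) * ((t n + (1 + 1 + 1 + 1) + 1) + 4) + 3) + t' n + 1) + 1) + 1)"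
      by (intro poly_intros computes_poly[OF c] computes_poly[OF c'])
    fix w e s assume o: "ok w d e s"
    let ?n = "length w"
    define es where "es = (\<lambda>m. e(d := e x + m, Suc d := e y + m))"
    have es: "e(d := e x + m, Suc d := e y + m) = es m" for m by (simp add: es_def)
    let ?P = "\<exists>m. (\<forall>t<m. A w (es t)) \<and> \<not> A w (es m) \<and> Q w (es m)"
    \<comment> \<open>Until \<open>A\<close> fails, the offset \<open>m\<close> equals the number of
      rounds; afterwards the markers rest at the first failure for the remaining rounds.\<close>
    define I where "I = (\<lambda>p s'. same d s s' \<and> (\<exists>m. (\<forall>t<m. A w (es t)) \<and> s' ?i = {e x + m} \<and>
       s' ?j = {e y + m} \<and> e x + m \<le> ?n \<and> e y + m \<le> ?n \<and> (m = p \<or> \<not> A w (es m))))"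
    have body: "wp ?n (t ?n + (1 + 1 + 1 + 1) + 1) ?b (\<lambda>s''. I (Suc p) s'' \<and> s'' ?r = {p}) s'"
      if p: "p \<le> ?n" "I p s'" "s' ?r = {p}" for p s'
    proof -
      obtain m where m: "\<forall>t<m. A w (es t)" "s' ?i = {e x + m}" "s' ?j = {e y + m}"
        "e x + m \<le> ?n" "e y + m \<le> ?n" "m = p \<or> \<not> A w (es m)" and sm: "same d s s'"
        using p(2) by (auto simp: I_def)
      have o': "ok w (Suc (Suc d)) (es m) s'"
        unfolding es_def by (rule ok_upd2[OF o sm m(2-5)])
      have "wp ?n (1 + 1 + 1 + 1) (Cond 5 (Seq (Op (Shift ?i ?i)) (Op (Shift ?j ?j))) Skip)
         (\<lambda>s''. I (Suc p) s'' \<and> s'' ?r = {p}) s''"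
        if s: "s'' 5 \<inter> {..?n} \<noteq> {} \<longleftrightarrow> A w (es m)" "same (Suc (Suc d)) s' s''" for s''
      proof -
        have e: "s'' ?r = {p}" "s'' ?i = {e x + m}" "s'' ?j = {e y + m}"
          using s(2) m p by (auto simp: same_def sr_def vr_def)
        have sm': "same d s s''" using same_trans[OF sm same_mono[OF s(2)]] by simp
        show ?thesis
        proof (intro wp_Cond wp_Seq wp_Op wp_Skip)
          assume "s'' 5 \<inter> {..?n} \<noteq> {}"
          then have A: "A w (es m)" using s by simp
          then have "e x + m < ?n" "e y + m < ?n" using lt[OF A] by (auto simp: es_def)
          define t where "t = eff ?n (Shift ?j ?j) (eff ?n (Shift ?i ?i) s'')"
          have "same d s t" unfolding t_def using sm' by (auto simp: vr_def intro!: same_upd)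
          moreover have "t ?i = {e x + Suc m}" "t ?j = {e y + Suc m}" "t ?r = {p}"
            unfolding t_def using e \<open>e x + m < ?n\<close> \<open>e y + m < ?n\<close> by (auto simp: vr_def sr_def)
          moreover have "\<forall>t<Suc m. A w (es t)" using A m(1) less_Suc_eq by auto
          moreover have "m = p" using A m(6) by simp
          ultimately have "I (Suc p) t \<and> t ?r = {p}"
            using \<open>e x + m < ?n\<close> \<open>e y + m < ?n\<close> unfolding I_def
            by (intro conjI exI[of _ "Suc m"]) auto
          then show "I (Suc p) (eff ?n (Shift ?j ?j) (eff ?n (Shift ?i ?i) s'')) \<and>
            eff ?n (Shift ?j ?j) (eff ?n (Shift ?i ?i) s'') ?r = {p}"
            unfolding t_def .
        next
          assume "s'' 5 \<inter> {..?n} = {}"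
          then have A: "\<not> A w (es m)" using s by simp
          then show "I (Suc p) s'' \<and> s'' ?r = {p}"
            using m e sm' by (auto simp: I_def)
        qed
      qed
      then show ?thesis by (intro wp_Seq computesD[OF c o'])
    qed
    have frame: "I p (s'(?r := X))" if "I p s'" for p s' X
      using that by (auto simp: I_def sr_def vr_def intro: same_upd)
    have fin: "wp ?n (t' ?n) c' (\<lambda>s'. (s' 5 \<inter> {..?n} \<noteq> {} \<longleftrightarrow> ?P) \<and> same d s s') s'"
      if Is: "I (Suc ?n) s'" for s'
    proof -
      obtain m where m: "\<forall>t<m. A w (es t)" "s' ?i = {e x + m}" "s' ?j = {e y + m}"
        "e x + m \<le> ?n" "e y + m \<le> ?n" "m = Suc ?n \<or> \<not> A w (es m)" and sm: "same d s s'"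
        using Is by (auto simp: I_def)
      \<comment> \<open>The alternative \<open>m = Suc ?n\<close> would push the marker beyond
        position \<open>?n\<close>, so the loop has run long enough to meet a failure.\<close>
      have nA: "\<not> A w (es m)" using m by auto
      have "m' = m" if "(\<forall>t<m'. A w (es t)) \<and> \<not> A w (es m')" for m'
        using that m(1) nA by (metis nat_neq_iff)
      then have P: "?P \<longleftrightarrow> Q w (es m)" using m(1) nA by blast
      have o': "ok w (Suc (Suc d)) (es m) s'"
        unfolding es_def by (rule ok_upd2[OF o sm m(2-5)])
      show ?thesis
      proof (rule computesD[OF c' o'])
        fix s'' assume s: "s'' 5 \<inter> {..?n} \<noteq> {} \<longleftrightarrow> Q w (es m)" "same (Suc (Suc d)) s' s''"
        then show "(s'' 5 \<inter> {..?n} \<noteq> {} \<longleftrightarrow> ?P) \<and> same d s s''"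
          using same_trans[OF sm same_mono[OF s(2)]] P by simp
      qed
    qed
    let ?s = "s(?i := {e x}, ?j := {e y})"
    have xy: "s (vr x) = {e x}" "e x \<le> ?n" "s (vr y) = {e y}" "e y \<le> ?n"
      using o assms(3,4) by (auto simp: ok_def)
    have s1: "eff ?n (Pw ?j (\<and>) (vr y) (vr y)) (eff ?n (Pw ?i (\<and>) (vr x) (vr x)) s) = ?s"
      using xy assms(3,4) by (auto simp: vr_def fun_eq_iff)
    have "I 0 ?s" using xy by (auto simp: I_def vr_def intro!: same_upd)
    then have "wp ?n ((?n + 1) * ((t ?n + (1 + 1 + 1 + 1) + 1) + 4) + 3) (For ?r ?b) (I (Suc ?n)) ?s"
      using wp_For[where I = I, OF body frame] by blast
    then have "wp ?n ((?n + 1) * ((t ?n + (1 + 1 + 1 + 1) + 1) + 4) + 3) (For ?r ?b)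
      (\<lambda>s'. wp ?n (t' ?n) c' (\<lambda>s'. (s' 5 \<inter> {..?n} \<noteq> {} \<longleftrightarrow> ?P) \<and> same d s s') s') ?s"
      by (rule wp_mono[OF _ order_refl fin])
    then show "wp ?n (1 + (1 + (((?n + 1) * ((t ?n + (1 + 1 + 1 + 1) + 1) + 4) + 3) + t' ?n + 1) + 1) + 1) ?p
      (\<lambda>s'. (s' 5 \<inter> {..?n} \<noteq> {} \<longleftrightarrow> (\<exists>m. (\<forall>t<m. A w (e(d := e x + t, Suc d := e y + t))) \<and>
    \<not> A w (e(d := e x + m, Suc d := e y + m)) \<and> Q w (e(d := e x + m, Suc d := e y + m)))) \<and> same d s s') s"
      unfolding es by (intro wp_Seq wp_Op) (simp only: s1)
  qed
qed

text \<open>The sets reached in at most \<open>p\<close> steps increase within \<open>A\<close>, and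
  each determines the next. Once two consecutive ones agree the sequence is constant, which happens
  after at most \<open>card A\<close> strict increases.\<close>

lemma rtrancl_Image_bounded:
  assumes G: "G \<subseteq> A \<times> A" and fin: "finite A" and x: "x \<in> A"
  shows "G\<^sup>* `` {x} = {v. \<exists>j\<le>card A. (x, v) \<in> G ^^ j}"
proof -
  define f where "f = (\<lambda>p. {v. \<exists>j\<le>p. (x, v) \<in> G ^^ j})"
  have step: "f (Suc p) = insert x (G `` f p)" for p
  proof (intro equalityI subsetI)
    fix v assume "v \<in> f (Suc p)"
    then obtain j where j: "j \<le> Suc p" "(x, v) \<in> G ^^ j" by (auto simp: f_def)
    then show "v \<in> insert x (G `` f p)" by (cases j) (auto simp: f_def)
  next
    fix v assume v: "v \<in> insert x (G `` f p)"
    show "v \<in> f (Suc p)"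
    proof (cases "v = x")
      case True
      then show ?thesis by (auto simp: f_def intro: exI[of _ 0])
    next
      case False
      then obtain u j where "j \<le> p" "(x, u) \<in> G ^^ j" "(u, v) \<in> G" using v by (auto simp: f_def)
      then have "Suc j \<le> Suc p" "(x, v) \<in> G ^^ Suc j" by auto
      then show ?thesis unfolding f_def by blast
    qed
  qed
  have sub: "f i \<subseteq> A" for i
  proof (cases i)
    case 0
    then show ?thesis using x by (auto simp: f_def)
  next
    case (Suc p)
    then show ?thesis using x G by (auto simp: step)
  qed
  have "mono f" by (auto simp: mono_def f_def intro: order_trans)
  moreover have "finite (range f)" by (rule finite_subset[of _ "Pow A"]) (use sub fin in auto)
  moreover have "\<forall>n. f n = f (Suc n) \<longrightarrow> f (Suc n) = f (Suc (Suc n))" by (metis step)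
  ultimately have "\<exists>N. (\<forall>n\<le>N. \<forall>m\<le>N. m < n \<longrightarrow> f m \<subset> f n) \<and> (\<forall>n\<ge>N. f N = f n)"
    by (intro finite_mono_remains_stable_implies_strict_prefix) auto
  from finite_mono_strict_prefix_implies_finite_fixpoint[OF sub fin this]
  have "f (card A) = (\<Union>n. f n)" .
  also have "\<dots> = G\<^sup>* `` {x}"
    by (fastforce simp: f_def rtrancl_power)
  finally show ?thesis by (auto simp: f_def)
qed

text \<open>Closure by rounds: \<open>sr d\<close> holds the vertices reached so far, each round
  runs through all pairs of positions, and \<open>sr (Suc d)\<close> counts \<open>n + 1\<close>
  rounds, one per position. Both registers are preserved by the edge test, which works two levels
  higher.\<close>

lemma dec_reach_upd:
  assumes "dec (Suc (Suc d)) E" "x < d" "y < d"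
  shows "dec d (\<lambda>w e. (e x, e y) \<in> {(u, v). u \<le> length w \<and> v \<le> length w \<and> E w (e(d := u, Suc d := v))}\<^sup>*)"
proof -
  obtain c t where c: "computes c t (Suc (Suc d)) E" using assms(1) by (auto simp: dec_def)
  let ?i = "vr d" and ?j = "vr (Suc d)" and ?B = "sr d" and ?r = "sr (Suc d)"
  let ?b = "Seq (Op (Pw 5 (\<and>) ?B ?i)) (Cond 5 (Seq c (Cond 5 (Op (Pw ?B (\<or>) ?B ?j)) Skip)) Skip)"
  let ?p = "Seq (Op (Pw ?B (\<and>) (vr x) (vr x))) (Seq (For ?r (For ?i (For ?j ?b))) (Op (Pw 5 (\<and>) ?B (vr y))))"
  define T1 where "T1 = (\<lambda>n. 1 + ((t n + (1 + 1) + 1) + 1) + 1)"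
  define T2 where "T2 = (\<lambda>n. (n + 1) * (T1 n + 4) + 3)"
  define T3 where "T3 = (\<lambda>n. (n + 1) * (T2 n + 4) + 3)"
  define T4 where "T4 = (\<lambda>n. (n + 1) * (T3 n + 4) + 3)"
  show ?thesis
  proof (rule decI)
    show "poly (\<lambda>n. 1 + (T4 n + 1 + 1) + 1)"
      unfolding T4_def T3_def T2_def T1_def by (intro poly_intros computes_poly[OF c])
    fix w e s assume o: "ok w d e s"
    let ?n = "length w"
    define G where "G = {(u, v). u \<le> length w \<and> v \<le> length w \<and> E w (e(d := u, Suc d := v))}"
    define N where "N = (\<lambda>p. {v. \<exists>j\<le>p. (e x, v) \<in> G ^^ j})"
    \<comment> \<open>A vertex found in a round may be used later in that same round. Hence the
      register is not exactly \<open>N p\<close>, only enclosed between \<open>N p\<close> and the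
      full closure.\<close>
    define I where "I = (\<lambda>p s'. same d s s' \<and> s' ?B \<subseteq> {..?n} \<and> s' ?B \<subseteq> G\<^sup>* `` {e x} \<and> N p \<subseteq> s' ?B)"
    define I2 where "I2 = (\<lambda>p u s'. s' ?r = {p} \<and> I p s' \<and> (\<forall>u'<u. u' \<in> N p \<longrightarrow> G `` {u'} \<subseteq> s' ?B))"
    define I3 where "I3 = (\<lambda>p u v s'. s' ?i = {u} \<and> I2 p u s' \<and> (\<forall>v'<v. u \<in> N p \<longrightarrow> (u, v') \<in> G \<longrightarrow> v' \<in> s' ?B))"
    have G: "G \<subseteq> {..?n} \<times> {..?n}" by (auto simp: G_def)
    have ne [simp]: "?j \<noteq> ?i" "?B \<noteq> ?i" "?r \<noteq> ?i" "?B \<noteq> ?j" "?r \<noteq> ?j" "?r \<noteq> ?B"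
      "?i \<noteq> ?j" "?i \<noteq> ?B" "?i \<noteq> ?r" "?j \<noteq> ?B" "?j \<noteq> ?r" "?B \<noteq> ?r" "?i \<ge> 6 + 2 * d" "?j \<ge> 6 + 2 * d"
      "?B \<ge> 6 + 2 * d" "?r \<ge> 6 + 2 * d" "5 \<noteq> ?i" "5 \<noteq> ?j" "5 \<noteq> ?B" "5 \<noteq> ?r"
      "?i \<noteq> 5" "?j \<noteq> 5" "?B \<noteq> 5" "?r \<noteq> 5"
      by (auto simp: vr_def sr_def)
    have I2_Suc: "I2 p (Suc u) s' \<longleftrightarrow> I2 p u s' \<and> (u \<in> N p \<longrightarrow> G `` {u} \<subseteq> s' ?B)"
      for p u s' by (auto simp: I2_def less_Suc_eq)
    have I3_Suc: "I3 p u (Suc v) s' \<longleftrightarrow> I3 p u v s' \<and> (u \<in> N p \<longrightarrow> (u, v) \<in> G \<longrightarrow> v \<in> s' ?B)"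
      for p u v s' by (auto simp: I3_def less_Suc_eq)
    have grow: "I3 p u v (s'(?B := insert v (s' ?B)))"
      if "I3 p u v s'" "v \<le> ?n" "v \<in> G\<^sup>* `` {e x}" for p u v s'
    proof -
      have "same d s (s'(?B := insert v (s' ?B)))"
        by (rule same_upd) (use that in \<open>simp_all add: I3_def I2_def I_def\<close>)
      moreover define s2 where "s2 = s'(?B := insert v (s' ?B))"
      ultimately have "same d s s2" by simp
      moreover have "s2 ?i = s' ?i" "s2 ?r = s' ?r" "s2 ?B = insert v (s' ?B)"
        by (simp_all add: s2_def)
      moreover have f: "s' ?i = {u}" "s' ?r = {p}" "s' ?B \<subseteq> {..?n}" "s' ?B \<subseteq> G\<^sup>* `` {e x}"
        "N p \<subseteq> s' ?B" "\<forall>u'<u. u' \<in> N p \<longrightarrow> G `` {u'} \<subseteq> s' ?B"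
        "\<forall>v'<v. u \<in> N p \<longrightarrow> (u, v') \<in> G \<longrightarrow> v' \<in> s' ?B"
        using that(1) unfolding I3_def I2_def I_def by simp_all
      ultimately have "I3 p u v s2"
        using that(2,3) unfolding I3_def I2_def I_def
        by (simp only: insert_subset atMost_iff simp_thms) (meson insertI2 subset_insertI2)
      then show ?thesis unfolding s2_def .
    qed
    have body: "wp ?n (T1 ?n) ?b (\<lambda>s''. I3 p u (Suc v) s'' \<and> s'' ?j = {v}) s'"
      if p: "p \<le> ?n" "u \<le> ?n" "v \<le> ?n" "I3 p u v s'" "s' ?j = {v}" for p u v s'
    proof -
      let ?s = "s'(5 := {q. q \<le> ?n \<and> q \<in> s' ?B \<and> q \<in> s' ?i})"
      have sm: "same d s ?s" by (rule same_upd) (use p in \<open>auto simp: I3_def I2_def I_def\<close>)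
      then have I3s: "I3 p u v ?s" "?s ?j = {v}" "?s ?i = {u}" using p
        by (auto simp: I3_def I2_def I_def)
      have uB: "?s 5 \<inter> {..?n} \<noteq> {} \<longleftrightarrow> u \<in> s' ?B" using p by (auto simp: I3_def)
      have NB: "N p \<subseteq> s' ?B" using p by (auto simp: I3_def I2_def I_def)
      have o': "ok w (Suc (Suc d)) (e(d := u, Suc d := v)) ?s"
        by (rule ok_upd2[OF o sm I3s(3,2) p(2,3)])
      have sk: "I3 p u (Suc v) ?s \<and> ?s ?j = {v}" if "u \<notin> s' ?B"
        using I3s that NB by (auto simp: I3_Suc)
      have "wp ?n (1 + 1) (Cond 5 (Op (Pw ?B (\<or>) ?B ?j)) Skip)
         (\<lambda>s''. I3 p u (Suc v) s'' \<and> s'' ?j = {v}) s''"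
        if u: "u \<in> s' ?B" and s: "s'' 5 \<inter> {..?n} \<noteq> {} \<longleftrightarrow> E w (e(d := u, Suc d := v))" "same (Suc (Suc d)) ?s s''" for s''
      proof -
        have e: "s'' ?r = ?s ?r" "s'' ?i = ?s ?i" "s'' ?j = ?s ?j" "s'' ?B = ?s ?B"
          using s(2) by (auto simp: same_def sr_def vr_def)
        have I3s'': "I3 p u v s''" using I3s e same_trans[OF _ same_mono[OF s(2)], of d s]
          by (auto simp: I3_def I2_def I_def)
        have B: "s' ?B \<subseteq> {..?n}" using p by (auto simp: I3_def I2_def I_def)
        show ?thesis
        proof (intro wp_Cond wp_Op wp_Skip)
          assume "s'' 5 \<inter> {..?n} \<noteq> {}"
          then have uv: "(u, v) \<in> G" using s p by (simp add: G_def)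
          have B': "{q. q \<le> ?n \<and> (q \<in> s'' ?B \<or> q \<in> s'' ?j)} = insert v (s'' ?B)"
            using e B p by auto
          have "u \<in> G\<^sup>* `` {e x}" using u p by (auto simp: I3_def I2_def I_def)
          then have "v \<in> G\<^sup>* `` {e x}" using uv by (auto intro: rtrancl_into_rtrancl)
          then show "I3 p u (Suc v) (eff ?n (Pw ?B (\<or>) ?B ?j) s'') \<and> eff ?n (Pw ?B (\<or>) ?B ?j) s'' ?j = {v}"
            using grow[OF I3s'' p(3)] e(3) p(5) unfolding eff.simps B' by (simp add: I3_Suc)
        next
          assume "s'' 5 \<inter> {..?n} = {}"
          then have "(u, v) \<notin> G" using s by (simp add: G_def)
          then show "I3 p u (Suc v) s'' \<and> s'' ?j = {v}"
            using I3s'' e(3) p(5) by (simp add: I3_Suc)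
        qed
      qed
      note inner = this
      have "wp ?n ((t ?n + (1 + 1) + 1) + 1) (Cond 5 (Seq c (Cond 5 (Op (Pw ?B (\<or>) ?B ?j)) Skip)) Skip)
        (\<lambda>s''. I3 p u (Suc v) s'' \<and> s'' ?j = {v}) ?s"
      proof (rule wp_Cond)
        assume "?s 5 \<inter> {..?n} \<noteq> {}"
        then have "u \<in> s' ?B" using uB by simp
        from inner[OF this] show "wp ?n (t ?n + (1 + 1) + 1) (Seq c (Cond 5 (Op (Pw ?B (\<or>) ?B ?j)) Skip))
          (\<lambda>s''. I3 p u (Suc v) s'' \<and> s'' ?j = {v}) ?s"
          by (intro wp_Seq computesD[OF c o'])
      next
        assume "?s 5 \<inter> {..?n} = {}"
        then have "u \<notin> s' ?B" using uB by simp
        from sk[OF this] show "wp ?n (t ?n + (1 + 1) + 1) Skip (\<lambda>s''. I3 p u (Suc v) s'' \<and> s'' ?j = {v}) ?s"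
          by (rule wp_Skip)
      qed
      then show ?thesis unfolding T1_def by (intro wp_Seq wp_Op) (simp only: eff.simps)
    qed
    have loop3: "wp ?n (T2 ?n) (For ?j ?b) (\<lambda>s''. I2 p (Suc u) s'' \<and> s'' ?i = {u}) s'"
      if p: "p \<le> ?n" "u \<le> ?n" "I2 p u s'" "s' ?i = {u}" for p u s'
    proof -
      have "wp ?n (T2 ?n) (For ?j ?b) (I3 p u (Suc ?n)) s'"
        unfolding T2_def
      proof (rule wp_For)
        show "I3 p u v (s'(?j := X))" if "I3 p u v s'" for v s' X
          using that by (auto simp: I3_def I2_def I_def intro!: same_upd)
      qed (use body p in \<open>auto simp: I3_def\<close>)
      moreover have "I2 p (Suc u) s'' \<and> s'' ?i = {u}" if "I3 p u (Suc ?n) s''" for s''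
      proof -
        have "v \<in> s'' ?B" if "u \<in> N p" "(u, v) \<in> G" for v
        proof -
          have "v < Suc ?n" using G that(2) by auto
          then show ?thesis using \<open>I3 p u (Suc ?n) s''\<close> that unfolding I3_def by blast
        qed
        then show ?thesis using that by (auto simp: I3_def I2_Suc)
      qed
      ultimately show ?thesis by (rule wp_mono[OF _ order_refl])
    qed
    have loop2: "wp ?n (T3 ?n) (For ?i (For ?j ?b)) (\<lambda>s''. I (Suc p) s'' \<and> s'' ?r = {p}) s'"
      if p: "p \<le> ?n" "I p s'" "s' ?r = {p}" for p s'
    proof -
      have "wp ?n (T3 ?n) (For ?i (For ?j ?b)) (I2 p (Suc ?n)) s'"
        unfolding T3_def
      proof (rule wp_For)
        show "I2 p u (s'(?i := X))" if "I2 p u s'" for u s' X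
          using that by (auto simp: I2_def I_def intro!: same_upd)
      qed (use loop3 p in \<open>auto simp: I2_def\<close>)
      moreover have "I (Suc p) s' \<and> s' ?r = {p}" if "I2 p (Suc ?n) s'" for s'
      proof -
        have "v \<in> s' ?B" if v: "(e x, v) \<in> G ^^ Suc p" for v
        proof -
          obtain u where u: "(e x, u) \<in> G ^^ p" "(u, v) \<in> G" using v by auto
          then have "u \<in> N p" "u < Suc ?n" using G by (auto simp: N_def)
          then show ?thesis using \<open>I2 p (Suc ?n) s'\<close> u(2) unfolding I2_def by blast
        qed
        then have "N (Suc p) \<subseteq> s' ?B"
          using that by (auto simp: I2_def I_def N_def le_Suc_eq simp del: relpow.simps)
        then show ?thesis using that by (auto simp: I2_def I_def)
      qed
      ultimately show ?thesis by (rule wp_mono[OF _ order_refl])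
    qed
    let ?s = "s(?B := {e x})"
    have xy: "s (vr x) = {e x}" "e x \<le> ?n" "s (vr y) = {e y}" "e y \<le> ?n"
      using o assms(2,3) by (auto simp: ok_def)
    have s1: "eff ?n (Pw ?B (\<and>) (vr x) (vr x)) s = ?s"
      using xy by (auto simp: fun_eq_iff)
    have "I 0 ?s" using xy by (auto simp: I_def N_def intro!: same_upd)
    then have "wp ?n (T4 ?n) (For ?r (For ?i (For ?j ?b))) (I (Suc ?n)) ?s"
      unfolding T4_def
    proof (rule wp_For[rotated 2])
      show "I p (s'(?r := X))" if "I p s'" for p s' X
        using that by (auto simp: I_def intro!: same_upd)
    qed (use loop2 in auto)
    moreover have "wp ?n 1 (Op (Pw 5 (\<and>) ?B (vr y))) (\<lambda>s'. (s' 5 \<inter> {..?n} \<noteq> {} \<longleftrightarrow> (e x, e y) \<in> G\<^sup>*) \<and> same d s s') s'"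
      if Is: "I (Suc ?n) s'" for s'
    proof -
      have "G\<^sup>* `` {e x} \<subseteq> N (Suc ?n)"
        using rtrancl_Image_bounded[OF G, of "e x"] xy by (simp add: N_def)
      then have B: "s' ?B = G\<^sup>* `` {e x}" using Is by (auto simp: I_def)
      have y: "s' (vr y) = {e y}" using Is xy assms(3) by (auto simp: I_def same_def vr_def)
      show ?thesis using Is B y xy by (intro wp_Op) (auto simp: I_def intro!: same_upd)
    qed
    ultimately have "wp ?n (T4 ?n) (For ?r (For ?i (For ?j ?b)))
      (\<lambda>s'. wp ?n 1 (Op (Pw 5 (\<and>) ?B (vr y))) (\<lambda>s'. (s' 5 \<inter> {..?n} \<noteq> {} \<longleftrightarrow> (e x, e y) \<in> G\<^sup>*) \<and> same d s s') s') ?s"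
      by (rule wp_mono[OF _ order_refl])
    then show "wp ?n (1 + (T4 ?n + 1 + 1) + 1) ?p
      (\<lambda>s'. (s' 5 \<inter> {..?n} \<noteq> {} \<longleftrightarrow> (e x, e y) \<in> {(u, v). u \<le> length w \<and> v \<le> length w \<and> E w (e(d := u, Suc d := v))}\<^sup>*) \<and> same d s s') s"
      unfolding G_def[symmetric] by (intro wp_Seq wp_Op) (simp only: s1)
  qed
qed

section \<open>Choice functions on layered graphs\<close>

lemma rtrancl_crossing:
  assumes "(v, u) \<in> E\<^sup>*" "v \<notin> Z" "u \<in> Z"
  shows "\<exists>a b. (a, b) \<in> E \<and> a \<notin> Z \<and> b \<in> Z"
  using assms by (induction rule: rtrancl_induct) blast+

locale layered_graph =
  fixes k :: nat and G :: "((nat \<times> 'c) \<times> (nat \<times> 'c)) set" and X :: "'c list set"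
  assumes k: "2 \<le> k" and fin: "finite G"
    and layer: "\<And>v w. (v, w) \<in> G \<Longrightarrow> fst v < k \<and> fst w = Suc (fst v) mod k"
    and lenX: "\<And>x. x \<in> X \<Longrightarrow> length x = k"
begin

text \<open>The layers are numbered from 0. The tuples in \<open>X\<close> are the listed cycles; \<open>forb m x\<close> says that
  the choice \<open>m\<close> contains the cycle \<open>x\<close>.\<close>

definition forb :: "(nat \<times> 'c \<Rightarrow> (nat \<times> 'c) option) \<Rightarrow> 'c list \<Rightarrow> bool" where
  "forb m x \<longleftrightarrow> (\<forall>i<k. m (i, x ! i) = Some (Suc i mod k, x ! (Suc i mod k)))"

text \<open>The safe maps with domain \<open>Domain G\<close> are the falsifying repairs. For a
  partial map the closure condition keeps the orbit of a chosen vertex within the domain until it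
  ends in a sink; this is what makes safe maps extendable.\<close>

definition safe :: "(nat \<times> 'c \<Rightarrow> (nat \<times> 'c) option) \<Rightarrow> bool" where
  "safe m \<longleftrightarrow> (\<forall>v w. m v = Some w \<longrightarrow> (v, w) \<in> G \<and> (w \<in> dom m \<or> w \<notin> Domain G)) \<and> (\<forall>x\<in>X. \<not> forb m x)"

text \<open>Reachability is expressed between edges because input positions stand for facts, hence
  for edges; a vertex has no position of its own.\<close>

definition line :: "(((nat \<times> 'c) \<times> (nat \<times> 'c)) \<times> ((nat \<times> 'c) \<times> (nat \<times> 'c))) set" where
  "line = {(e, e'). e \<in> G \<and> e' \<in> G \<and> snd e = fst e'}"

text \<open>Edges \<open>g\<^sub>0, \<dots>, g\<^sub>k\<^sub>-\<^sub>1\<close>, one per layer; the chain is good if it closes to an unlisted cycle, or if it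
  does not close but its end leads back to its start while avoiding its vertices.\<close>

definition chain :: "((nat \<times> 'c) \<times> (nat \<times> 'c)) list \<Rightarrow> bool" where
  "chain gs \<longleftrightarrow> length gs = k \<and> (\<forall>i<k. gs ! i \<in> G \<and> fst (fst (gs ! i)) = i) \<and>
     (\<forall>i<k - 1. snd (gs ! i) = fst (gs ! Suc i))"

text \<open>Only the second edge of a step is restricted: the walk starts with the last edge of the
  chain, whose source lies on the chain.\<close>

definition avoiding :: "((nat \<times> 'c) \<times> (nat \<times> 'c)) list \<Rightarrow> (((nat \<times> 'c) \<times> (nat \<times> 'c)) \<times> ((nat \<times> 'c) \<times> (nat \<times> 'c))) set" where
  "avoiding gs = {(e, e'). (e, e') \<in> line \<and> (\<forall>i<k. fst e' \<noteq> fst (gs ! i))}"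

definition good_chain :: "((nat \<times> 'c) \<times> (nat \<times> 'c)) list \<Rightarrow> bool" where
  "good_chain gs \<longleftrightarrow> chain gs \<and>
     (if snd (gs ! (k - 1)) = fst (gs ! 0) then map (snd \<circ> fst) gs \<notin> X
      else (\<exists>h\<in>G. (gs ! (k - 1), h) \<in> (avoiding gs)\<^sup>* \<and> snd h = fst (gs ! 0)))"

definition escapes :: "(nat \<times> 'c) \<times> (nat \<times> 'c) \<Rightarrow> bool" where
  "escapes e \<longleftrightarrow> (\<exists>e'\<in>G. (e, e') \<in> line\<^sup>* \<and> (snd e' \<notin> Domain G \<or> (\<exists>gs. good_chain gs \<and> gs ! 0 = e')))"

lemma cyclic_propagation:
  assumes "\<And>i. i < k \<Longrightarrow> Q i \<Longrightarrow> Q (Suc i mod k)" "Q i0" "i0 < k" "i < k"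
  shows "Q i"
proof -
  have "Q ((i0 + n) mod k)" for n
  proof (induction n)
    case (Suc n)
    have "(i0 + n) mod k < k" using k by simp
    from assms(1)[OF this Suc] show ?case by (simp add: mod_Suc_eq)
  qed (use assms in simp)
  from this[of "k - i0 + i"] show ?thesis using assms(3,4) by simp
qed

lemma safe_edge: "safe m \<Longrightarrow> m v = Some w \<Longrightarrow> (v, w) \<in> G"
  unfolding safe_def by blast

lemma safe_closed: "safe m \<Longrightarrow> m v = Some w \<Longrightarrow> w \<in> dom m \<or> w \<notin> Domain G"
  unfolding safe_def by blast

lemma safe_Domain: "safe m \<Longrightarrow> dom m \<subseteq> Domain G"
  unfolding safe_def by (meson DomainI domD subsetI)

lemma safe_empty: "safe Map.empty"
  using k by (auto simp: safe_def forb_def intro: exI[of _ 0])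

text \<open>Both maps are closed under successors, so a cycle of the union lies within one of them.\<close>

lemma safe_map_add:
  assumes m: "safe m" and c: "safe c"
  shows "safe (c ++ m)"
  unfolding safe_def
proof (intro conjI allI impI ballI notI)
  fix v w assume "(c ++ m) v = Some w"
  then have "m v = Some w \<or> c v = Some w" by auto
  then show "(v, w) \<in> G" "w \<in> dom (c ++ m) \<or> w \<notin> Domain G"
    using m c unfolding safe_def dom_map_add by blast+
next
  fix x assume x: "x \<in> X" and f: "forb (c ++ m) x"
  have "(i, x ! i) \<in> Domain G" if "i < k" for i
  proof -
    have "m (i, x ! i) = Some (Suc i mod k, x ! (Suc i mod k)) \<or> c (i, x ! i) = Some (Suc i mod k, x ! (Suc i mod k))"
      using f that by (auto simp: forb_def map_add_Some_iff)
    then show ?thesis using m c safe_edge by (meson DomainI)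
  qed
  then have D: "(Suc i mod k, x ! (Suc i mod k)) \<in> Domain G" for i using k by simp
  show False
  proof (cases "\<exists>i<k. (i, x ! i) \<in> dom m")
    case True
    then obtain i0 where "i0 < k" "(i0, x ! i0) \<in> dom m" by auto
    have "(Suc i mod k, x ! (Suc i mod k)) \<in> dom m" if "i < k" "(i, x ! i) \<in> dom m" for i
    proof -
      have "m (i, x ! i) = Some (Suc i mod k, x ! (Suc i mod k))"
        using that f by (auto simp: forb_def map_add_def split: option.splits)
      then show ?thesis using m D unfolding safe_def by blast
    qed
    from cyclic_propagation[of "\<lambda>i. (i, x ! i) \<in> dom m", OF this \<open>(i0, x ! i0) \<in> dom m\<close> \<open>i0 < k\<close>]
    have "forb m x" using f unfolding forb_def map_add_Some_iff by (meson domIff)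
    then show False using m x by (auto simp: safe_def)
  next
    case False
    then have "forb c x" using f unfolding forb_def map_add_Some_iff by blast
    then show False using c x by (auto simp: safe_def)
  qed
qed

text \<open>A new vertex \<open>v\<close> lies on no listed cycle of the extension: its predecessor
  there would be mapped to \<open>v\<close> by \<open>m\<close>, and closure of \<open>m\<close>
  would already have put the non-sink \<open>v\<close> into its domain.\<close>

lemma safe_extend:
  assumes m: "safe m" and v: "v \<notin> dom m" "(v, w) \<in> G" and w: "w \<in> dom m \<or> w \<notin> Domain G"
  shows "safe (m(v \<mapsto> w))"
  unfolding safe_def
proof (intro conjI allI impI ballI notI)
  fix a b assume "(m(v \<mapsto> w)) a = Some b"
  then have "m a = Some b \<or> a = v \<and> b = w" by (auto split: if_splits)
  then show "(a, b) \<in> G" "b \<in> dom (m(v \<mapsto> w)) \<or> b \<notin> Domain G"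
    using v w safe_edge[OF m, of a b] safe_closed[OF m, of a b] by (auto simp del: split_paired_Ex split_paired_All)
next
  fix x assume x: "x \<in> X" and f: "forb (m(v \<mapsto> w)) x"
  have "v \<noteq> (Suc i mod k, x ! (Suc i mod k))" if i: "i < k" for i
  proof
    assume eq: "v = (Suc i mod k, x ! (Suc i mod k))"
    \<comment> \<open>As \<open>k\<close> is at least 2, the predecessor of \<open>v\<close> on the
      cycle differs from \<open>v\<close>, so its value comes from \<open>m\<close>.\<close>
    have "Suc i mod k \<noteq> i" using i k by (cases "Suc i = k") auto
    then have "m (i, x ! i) = Some v" using f i eq by (auto simp: forb_def split: if_splits)
    then show False using safe_closed[OF m] v by blast
  qed
  moreover have "\<exists>j<k. i = Suc j mod k" if "i < k" for i
  proof (cases i)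
    case 0
    have "k - 1 < k" "Suc (k - 1) mod k = 0" using k by simp_all
    then show ?thesis using 0 by metis
  next
    case (Suc j)
    then have "j < k" "i = Suc j mod k" using that by simp_all
    then show ?thesis by blast
  qed
  ultimately have "(i, x ! i) \<noteq> v" if "i < k" for i using that by metis
  then have "forb m x" using f by (auto simp: forb_def)
  then show False using m x by (auto simp: safe_def)
qed

text \<open>A safe map with the largest domain is total. Otherwise the path from a missing vertex
  ends in a sink or in the domain (by maximality against \<open>safe_map_add\<close>), so some edge
  of the path enters that set from outside, and \<open>safe_extend\<close> can add its
  source.\<close>

lemma safe_total:
  assumes "\<And>v. v \<in> Domain G \<Longrightarrow> \<exists>u. (v, u) \<in> G\<^sup>* \<and> (u \<notin> Domain G \<or> (\<exists>c. safe c \<and> u \<in> dom c))"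
  shows "\<exists>m. safe m \<and> dom m = Domain G"
proof -
  have fD: "finite (Domain G)" using fin by (simp add: finite_Domain)
  have "\<exists>m. safe m \<and> (\<forall>m'. safe m' \<longrightarrow> card (dom m') \<le> card (dom m))"
  proof (rule ex_has_greatest_nat)
    show "\<forall>m. safe m \<longrightarrow> card (dom m) < Suc (card (Domain G))"
      using card_mono[OF fD safe_Domain] by (simp add: less_Suc_eq_le)
  qed (rule safe_empty)
  then obtain m where m: "safe m" and max: "\<And>m'. safe m' \<Longrightarrow> card (dom m') \<le> card (dom m)" by auto
  have no: "\<not> dom m \<subset> dom m'" if "safe m'" for m'
  proof
    assume "dom m \<subset> dom m'"
    then have "card (dom m) < card (dom m')"
      using finite_subset[OF safe_Domain[OF that] fD] by (rule psubset_card_mono[rotated])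
    then show False using max[OF that] by simp
  qed
  have "Domain G \<subseteq> dom m"
  proof (rule ccontr)
    assume "\<not> Domain G \<subseteq> dom m"
    then obtain v where v: "v \<in> Domain G" "v \<notin> dom m" by auto
    obtain u where u: "(v, u) \<in> G\<^sup>*" "u \<notin> Domain G \<or> (\<exists>c. safe c \<and> u \<in> dom c)"
      using assms v(1) by blast
    let ?Z = "dom m \<union> - Domain G"
    have "u \<in> ?Z"
    proof (rule ccontr)
      assume nZ: "u \<notin> ?Z"
      then obtain c where "safe c" "u \<in> dom c" using u(2) by auto
      then have "dom m \<subset> dom (c ++ m)" "safe (c ++ m)" using nZ safe_map_add[OF m] by auto
      then show False using no by metis
    qed
    moreover have "v \<notin> ?Z" using v by simp
    ultimately obtain a b where ab: "(a, b) \<in> G" "a \<notin> ?Z" "b \<in> ?Z"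
      using rtrancl_crossing[OF u(1), of ?Z] by metis
    then have "safe (m(a \<mapsto> b))" by (intro safe_extend[OF m]) auto
    moreover have "dom m \<subset> dom (m(a \<mapsto> b))" using ab by auto
    ultimately show False using no by metis
  qed
  then show ?thesis using m safe_Domain[OF m] by auto
qed

text \<open>A chain has exactly one source in each layer. An end in layer 0 that differs from the
  start therefore lies off the chain.\<close>

lemma chain_closing:
  assumes "chain gs"
  shows "fst (snd (gs ! (k - 1))) = 0"
proof -
  have "gs ! (k - 1) \<in> G" "fst (fst (gs ! (k - 1))) = k - 1" using assms k by (auto simp: chain_def)
  then show ?thesis using layer[of "fst (gs ! (k - 1))" "snd (gs ! (k - 1))"] k by simp
qed

text \<open>If the chain closes, it is itself the choice, and its only cycle is unlisted. If not,
  the walk back need not be elementary: it only shows that the start is reachable off the chain, and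
  shortest-distance steps replace it.\<close>

lemma good_chain_safe:
  assumes "good_chain gs"
  shows "\<exists>c. safe c \<and> fst (gs ! 0) \<in> dom c"
proof -
  have ch: "chain gs" using assms by (simp add: good_chain_def)
  have len: "length gs = k" and gsG: "\<And>i. i < k \<Longrightarrow> (fst (gs ! i), snd (gs ! i)) \<in> G"
    and tyg: "\<And>i. i < k \<Longrightarrow> fst (fst (gs ! i)) = i"
    and link: "\<And>i. i < k - 1 \<Longrightarrow> snd (gs ! i) = fst (gs ! Suc i)"
    using ch by (auto simp: chain_def)
  let ?u0 = "fst (gs ! 0)" and ?b = "snd (gs ! (k - 1))"
  \<comment> \<open>The vertices of the chain; a vertex can only be the one that the chain has in
    its own layer.\<close>
  define U where "U = {v. fst v < k \<and> v = fst (gs ! fst v)}"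
  have UI: "fst (gs ! i) \<in> U" if "i < k" for i using that tyg by (auto simp: U_def)
  have UE: "\<exists>i<k. v = fst (gs ! i)" if "v \<in> U" for v using that by (auto simp: U_def)
  show ?thesis
  proof (cases "?b = ?u0")
    case True
    define c where "c = (\<lambda>v. if v \<in> U then Some (snd (gs ! fst v)) else None)"
    have "safe c"
      unfolding safe_def
    proof (intro conjI allI impI ballI notI)
      fix v w assume "c v = Some w"
      then have v: "v \<in> U" "w = snd (gs ! fst v)" by (auto simp: c_def split: if_splits)
      then obtain i where "i < k" "v = fst (gs ! i)" using UE by blast
      with v tyg have i: "i < k" "v = fst (gs ! i)" "w = snd (gs ! i)" by auto
      then show "(v, w) \<in> G" using gsG by simp
      have "w \<in> U"
      proof (cases "i < k - 1")
        case True
        then show ?thesis using i link UI[of "Suc i"] by simp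
      next
        case False
        then have "i = k - 1" using i by simp
        then show ?thesis using i \<open>?b = ?u0\<close> UI[of 0] by simp
      qed
      then show "w \<in> dom c \<or> w \<notin> Domain G" by (simp add: c_def dom_def)
    next
      fix x assume x: "x \<in> X" "forb c x"
      have "(i, x ! i) \<in> U" if "i < k" for i
        using x(2) that by (auto simp: forb_def c_def split: if_splits)
      then have "x ! i = snd (fst (gs ! i))" if "i < k" for i
        using that by (metis UE tyg fst_conv snd_conv)
      then have "x = map (snd \<circ> fst) gs"
        using lenX[OF x(1)] len by (intro nth_equalityI) auto
      then show False using x(1) assms True by (simp add: good_chain_def)
    qed
    moreover have "?u0 \<in> dom c" using UI[of 0] k by (simp add: c_def dom_def)
    ultimately show ?thesis by blast
  next
    case False
    then obtain h where h: "h \<in> G" "(gs ! (k - 1), h) \<in> (avoiding gs)\<^sup>*" "snd h = ?u0"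
      using assms by (auto simp: good_chain_def)
    \<comment> \<open>Only sources have to lie off the chain, so that a path may end at
      \<open>?u0\<close>, while no edge of \<open>W\<close> leaves a chain vertex.\<close>
    define W where "W = {(a, b). (a, b) \<in> G \<and> a \<notin> U}"
    have "(?b, snd h) \<in> W\<^sup>*"
      using h(2)
    proof (induction rule: rtrancl_induct)
      case (step y z)
      then have "(snd y, snd z) \<in> W"
        by (cases z) (auto simp: W_def avoiding_def line_def U_def)
      then show ?case using step by auto
    qed auto
    then have bW: "(?b, ?u0) \<in> W\<^sup>*" using h by simp
    have bU: "?b \<notin> U" using chain_closing[OF ch] False by (auto simp: U_def)
    \<comment> \<open>Outside the chain, step to a vertex closer to \<open>?u0\<close>. A cycle of length \<open>k\<close> then would have
      to pass through the whole chain, whose end does not return to \<open>?u0\<close> directly.\<close>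
    define d where "d = (\<lambda>v. LEAST n. (v, ?u0) \<in> W ^^ n)"
    have ex: "\<exists>w. (v, w) \<in> W \<and> (w, ?u0) \<in> W\<^sup>* \<and> d w < d v" if v: "v \<notin> U" "(v, ?u0) \<in> W\<^sup>*" for v
    proof -
      have dv: "(v, ?u0) \<in> W ^^ d v"
        unfolding d_def by (rule LeastI_ex) (use v(2) in \<open>simp add: rtrancl_power\<close>)
      have "d v \<noteq> 0" using dv v UI[of 0] k by (cases "d v") auto
      then obtain n where n: "d v = Suc n" by (cases "d v") auto
      then obtain w where w: "(v, w) \<in> W" "(w, ?u0) \<in> W ^^ n" using dv by (metis relpow_Suc_D2)
      then have "d w \<le> n" unfolding d_def by (intro Least_le)
      then show ?thesis using w n by (intro exI[of _ w]) (auto dest: relpow_imp_rtrancl)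
    qed
    define nx where "nx = (\<lambda>v. SOME w. (v, w) \<in> W \<and> (w, ?u0) \<in> W\<^sup>* \<and> d w < d v)"
    have nx: "(v, nx v) \<in> W" "(nx v, ?u0) \<in> W\<^sup>*" "d (nx v) < d v" if v: "v \<notin> U" "(v, ?u0) \<in> W\<^sup>*" for v
      using someI_ex[OF ex[OF v]] by (auto simp: nx_def)
    \<comment> \<open>From a chain vertex only the empty \<open>W\<close>-path exists, so the chain
      can be entered nowhere but at \<open>?u0\<close>.\<close>
    have nxU: "nx v = ?u0" if v: "v \<notin> U" "(v, ?u0) \<in> W\<^sup>*" "nx v \<in> U" for v
      using nx(2)[OF v(1,2)] v(3) by (auto simp: W_def elim: converse_rtranclE)
    define c where "c = (\<lambda>v. if v \<in> U then Some (snd (gs ! fst v))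
       else if (v, ?u0) \<in> W\<^sup>* then Some (nx v) else None)"
    have cU: "c v = Some (snd (gs ! fst v))" if "v \<in> U" for v using that by (simp add: c_def)
    have domc: "v \<in> dom c \<longleftrightarrow> v \<in> U \<or> (v, ?u0) \<in> W\<^sup>*" for v by (simp add: c_def dom_def)
    have "safe c"
      unfolding safe_def
    proof (intro conjI allI impI ballI notI)
      fix v w assume vw: "c v = Some w"
      have "(v, w) \<in> G \<and> w \<in> dom c"
      proof (cases "v \<in> U")
        case True
        then have w: "w = snd (gs ! fst v)" using vw cU by simp
        obtain i where "i < k" "v = fst (gs ! i)" using UE[OF True] by blast
        with w tyg have i: "i < k" "v = fst (gs ! i)" "w = snd (gs ! i)" by simp_all
        have "w \<in> dom c"
        proof (cases "i < k - 1")
          case True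
          then show ?thesis using i link UI[of "Suc i"] by (simp add: domc)
        next
          case False
          then have "i = k - 1" using i by simp
          then show ?thesis using i bW by (simp add: domc)
        qed
        then show ?thesis using i gsG by simp
      next
        case False
        then have "(v, ?u0) \<in> W\<^sup>*" "w = nx v" using vw by (auto simp: c_def split: if_splits)
        then show ?thesis using nx[OF False] by (auto simp: domc W_def)
      qed
      then show "(v, w) \<in> G" "w \<in> dom c \<or> w \<notin> Domain G" by auto
    next
      fix x assume x: "x \<in> X" "forb c x"
      define y where "y = (\<lambda>i. (i, x ! i))"
      have y: "c (y i) = Some (y (Suc i mod k))" if "i < k" for i
        using x(2) that by (simp add: forb_def y_def)
      have yW: "(y i, ?u0) \<in> W\<^sup>*" "y (Suc i mod k) = nx (y i)" if "i < k" "y i \<notin> U" for i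
        using y[OF that(1)] that(2) by (auto simp: c_def split: if_splits)
      show False
      proof (cases "\<exists>i<k. y i \<in> U")
        case True
        then obtain i where i: "i < k" "y i \<in> U" by auto
        \<comment> \<open>A cycle that meets the chain follows it up to layer \<open>k - 1\<close>
          and thus has \<open>?b\<close>, off the chain, as its vertex in layer 0.\<close>
        have st: "y (Suc j) \<in> U" if "y j \<in> U" "j < k - 1" for j
        proof -
          have "y (Suc j) = snd (gs ! j)" using y[of j] cU[OF that(1)] that(2) by (simp add: y_def)
          then show ?thesis using link[OF that(2)] UI[of "Suc j"] that(2) by simp
        qed
        have "y (i + n) \<in> U" if "i + n < k" for n
          using that by (induction n) (use i st in auto)
        from this[of "k - 1 - i"] have yk: "y (k - 1) \<in> U" using i by simp
        then have "y 0 = ?b" using y[of "k - 1"] cU[OF yk] k by (simp add: y_def)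
        then have y0: "y 0 \<notin> U" using bU by simp
        \<comment> \<open>From \<open>?b\<close> on, the chain could be entered again only at
          \<open>?u0\<close>, in layer 0. The layers 1 to \<open>k - 1\<close> of the cycle thus
          stay off the chain, against \<open>yk\<close>.\<close>
        have "y n \<notin> U" if "n < k" for n
          using that
        proof (induction n)
          case (Suc n)
          show ?case
          proof
            assume u: "y (Suc n) \<in> U"
            have n: "n < k" "y n \<notin> U" using Suc by auto
            have eq: "y (Suc n) = nx (y n)" using yW(2)[OF n] Suc.prems by simp
            have "nx (y n) = ?u0" by (rule nxU[OF n(2) yW(1)[OF n]]) (use eq u in simp)
            then have "Suc n = fst (?u0)" using eq by (simp add: y_def) (metis fst_conv)
            then show False using tyg[of 0] k by simp
          qed
        qed (use y0 in simp)
        then show False using yk k by simp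
      next
        case False
        \<comment> \<open>A cycle entirely off the chain would decrease the distance to
          \<open>?u0\<close> at every step, which fails at the minimum.\<close>
        have lt: "d (y (Suc i mod k)) < d (y i)" if "i < k" for i
          using that False yW[of i] nx(3)[of "y i"] by simp
        let ?m = "Min ((d \<circ> y) ` {..<k})"
        have "?m \<in> (d \<circ> y) ` {..<k}" using k by (intro Min_in) (auto simp: lessThan_empty_iff)
        then obtain i where i: "i < k" "d (y i) = ?m" by auto
        have "Suc i mod k < k" using k by simp
        then have "?m \<le> d (y (Suc i mod k))" by (intro Min_le) auto
        then show False using lt[OF i(1)] i(2) by simp
      qed
    qed
    moreover have "?u0 \<in> dom c" by (simp add: domc)
    ultimately show ?thesis by blast
  qed
qed

lemma line_reach: "(e, e') \<in> line\<^sup>* \<Longrightarrow> (snd e, snd e') \<in> G\<^sup>*"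
proof (induction rule: rtrancl_induct)
  case (step y z)
  then have "(snd y, snd z) \<in> G" by (cases z) (auto simp: line_def)
  then show ?case using step by auto
qed auto

lemma safe_of_escapes:
  assumes "\<And>e. e \<in> G \<Longrightarrow> escapes e"
  shows "\<exists>m. safe m \<and> dom m = Domain G"
proof (rule safe_total)
  fix v assume "v \<in> Domain G"
  then obtain w where vw: "(v, w) \<in> G" by auto
  then obtain e where e: "e \<in> G" "((v, w), e) \<in> line\<^sup>*"
    and c: "snd e \<notin> Domain G \<or> (\<exists>gs. good_chain gs \<and> gs ! 0 = e)"
    using assms[OF vw] unfolding escapes_def by blast
  have vr: "(v, snd e) \<in> G\<^sup>*" using vw line_reach[OF e(2)] by auto
  show "\<exists>u. (v, u) \<in> G\<^sup>* \<and> (u \<notin> Domain G \<or> (\<exists>c. safe c \<and> u \<in> dom c))"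
    using c
  proof
    assume "\<exists>gs. good_chain gs \<and> gs ! 0 = e"
    then obtain c where c: "safe c" "fst e \<in> dom c" using good_chain_safe by blast
    consider "e = (v, w)" | y where "((v, w), y) \<in> line\<^sup>*" "(y, e) \<in> line"
      using e(2) by (metis rtranclE)
    then have "(v, fst e) \<in> G\<^sup>*"
    proof cases
      case (2 y)
      then have "(w, snd y) \<in> G\<^sup>*" "snd y = fst e" using line_reach[OF 2(1)] by (auto simp: line_def)
      then show ?thesis using vw by (metis converse_rtrancl_into_rtrancl)
    qed auto
    then show ?thesis using c by blast
  qed (use vr in blast)
qed

text \<open>Follow the choice from the target of \<open>e\<close>. The orbit ends in a sink or
  becomes periodic; in the latter case the periodic part, read from a vertex in layer 0, begins with
  a good chain.\<close>

lemma escapes_of_safe: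
  assumes m: "safe m" "dom m = Domain G" and e: "e \<in> G"
  shows "escapes e"
proof -
  define f where "f = (\<lambda>v. the (m v))"
  have fG: "(v, f v) \<in> G" "m v = Some (f v)" if "v \<in> Domain G" for v
  proof -
    obtain w where "m v = Some w" using m(2) \<open>v \<in> Domain G\<close> by blast
    then show "(v, f v) \<in> G" "m v = Some (f v)" using safe_edge[OF m(1)] by (simp_all add: f_def)
  qed
  let ?v = "snd e"
  have orb: "(e, ((f ^^ n) ?v, f ((f ^^ n) ?v))) \<in> line\<^sup>*" if "\<forall>j\<le>n. (f ^^ j) ?v \<in> Domain G" for n
    using that
  proof (induction n)
    case 0
    then have "(e, (?v, f ?v)) \<in> line" using e fG[of ?v] by (auto simp: line_def)
    then show ?case by simp
  next
    case (Suc n)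
    have D: "(f ^^ n) ?v \<in> Domain G" "(f ^^ Suc n) ?v \<in> Domain G" using Suc.prems le_SucI by blast+
    have "(((f ^^ n) ?v, f ((f ^^ n) ?v)), ((f ^^ Suc n) ?v, f ((f ^^ Suc n) ?v))) \<in> line"
      using fG(1)[OF D(1)] fG(1)[OF D(2)] by (auto simp: line_def)
    then show ?case using Suc by (meson le_SucI rtrancl.rtrancl_into_rtrancl)
  qed
  show ?thesis
  proof (cases "\<forall>j. (f ^^ j) ?v \<in> Domain G")
    case False
    define n where "n = (LEAST n. (f ^^ n) ?v \<notin> Domain G)"
    have n: "(f ^^ n) ?v \<notin> Domain G" unfolding n_def by (rule LeastI_ex) (use False in simp)
    have lt: "(f ^^ j) ?v \<in> Domain G" if "j < n" for j
      using not_less_Least[of j "\<lambda>n. (f ^^ n) ?v \<notin> Domain G"] that by (auto simp: n_def)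
    show ?thesis
    proof (cases n)
      case 0
      then show ?thesis using n e by (auto simp: escapes_def)
    next
      case (Suc n')
      let ?e = "((f ^^ n') ?v, f ((f ^^ n') ?v))"
      have "(e, ?e) \<in> line\<^sup>*" by (rule orb) (use lt Suc in auto)
      moreover have "?e \<in> G" using fG lt Suc by simp
      moreover have "snd ?e \<notin> Domain G" using n Suc by simp
      ultimately show ?thesis unfolding escapes_def by blast
    qed
  next
    case True
    define u where "u = (\<lambda>j. (f ^^ j) ?v)"
    have uD: "u j \<in> Domain G" for j using True by (simp add: u_def)
    have uS: "u (Suc j) = f (u j)" for j by (simp add: u_def)
    have uadd: "u (i + j) = (f ^^ j) (u i)" for i j
      by (simp add: u_def funpow_add add.commute[of i j])
    have ty0: "fst ?v < k" using e layer[of "fst e" ?v] k by simp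
    have ty: "fst (u j) = (fst ?v + j) mod k" for j
    proof (induction j)
      case 0
      then show ?case using ty0 by (simp add: u_def)
    next
      case (Suc j)
      then show ?case using layer[OF fG(1)[OF uD[of j]]] uS by (simp add: mod_Suc_eq)
    qed
    have "\<not> inj u"
    proof
      assume "inj u"
      then have "infinite (range u)" using finite_imageD infinite_UNIV_nat by blast
      moreover have "finite (range u)" by (rule finite_subset[of _ "Domain G"]) (use uD fin in \<open>auto simp: finite_Domain\<close>)
      ultimately show False by simp
    qed
    then obtain a b where "a \<noteq> b" "u a = u b" by (auto simp: inj_def)
    then obtain a b where ab: "a < b" "u a = u b" by (metis nat_neq_iff)
    \<comment> \<open>a vertex of layer 0 on the periodic part of the orbit\<close>
    define N where "N = k * Suc a - fst ?v"
    have kk: "fst ?v \<le> k * Suc a" using ty0 k by (simp add: trans_le_add1)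
    have "a \<le> k * a" using k by simp
    then have aN: "a \<le> N" using ty0 unfolding N_def mult_Suc_right by linarith
    have tyN: "fst (u N) = 0" using ty[of N] kk by (simp add: N_def)
    define y where "y = (\<lambda>j. u (N + j))"
    have yS: "y (Suc j) = f (y j)" for j by (simp add: y_def uS)
    have yadd: "y (i + j) = (f ^^ j) (y i)" for i j using uadd[of "N + i" j] by (simp add: y_def add.assoc)
    have yD: "y j \<in> Domain G" for j by (simp add: y_def uD)
    have tyy: "fst (y j) = j mod k" for j
    proof -
      have "(fst ?v + N) mod k = 0" using tyN ty by simp
      then have "(fst ?v + (N + j)) mod k = j mod k"
        by (metis add.assoc add.left_neutral mod_add_left_eq)
      then show ?thesis by (simp add: y_def ty)
    qed
    have per: "y (b - a) = y 0"
    proof -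
      have "y (b - a) = u ((b + (N - a)))" using aN ab by (simp add: y_def add.commute)
      also have "\<dots> = u (a + (N - a))" unfolding uadd using ab by simp
      finally show ?thesis using aN by (simp add: y_def)
    qed
    define p where "p = (LEAST p. 0 < p \<and> y p = y 0)"
    have "\<exists>p. 0 < p \<and> y p = y 0" by (rule exI[of _ "b - a"]) (use per ab in auto)
    from LeastI_ex[OF this] have p: "0 < p" "y p = y 0" unfolding p_def by blast+
    have pmin: "y q \<noteq> y 0" if "0 < q" "q < p" for q
      using not_less_Least[of q "\<lambda>p. 0 < p \<and> y p = y 0"] that by (auto simp: p_def)
    define ed where "ed = (\<lambda>j. (y j, y (Suc j)))"
    have edG: "ed j \<in> G" for j using fG(1)[OF yD[of j]] by (simp add: ed_def yS)
    let ?gs = "map ed [0..<k]"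
    have gsi: "?gs ! i = ed i" if "i < k" for i using that by simp
    have ch: "chain ?gs" using edG tyy k by (auto simp: chain_def ed_def)
    have reach: "(e, ed 0) \<in> line\<^sup>*"
      using orb[of N] True by (simp add: ed_def y_def u_def)
    have "good_chain ?gs"
    proof (cases "y k = y 0")
      case eq: True
      have "map (snd \<circ> fst) ?gs \<notin> X"
      proof
        assume x: "map (snd \<circ> fst) ?gs \<in> X"
        let ?x = "map (snd \<circ> fst) ?gs"
        have xi: "(i, ?x ! i) = y i" if "i < k" for i
          using that tyy[of i] by (simp add: ed_def prod_eq_iff)
        have "m (i, ?x ! i) = Some (Suc i mod k, ?x ! (Suc i mod k))" if i: "i < k" for i
        proof -
          have "y (Suc i) = y (Suc i mod k)"
            using i eq by (cases "Suc i = k") auto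
          then show ?thesis using xi[OF i] xi[of "Suc i mod k"] fG(2)[OF yD[of i]] yS[of i] k by simp
        qed
        then have "forb m ?x" unfolding forb_def by blast
        then show False using m(1) x by (auto simp: safe_def)
      qed
      then show ?thesis using ch eq k gsi[of "k - 1"] gsi[of 0] by (simp add: good_chain_def ed_def)
    next
      case ne: False
      \<comment> \<open>Returning to the same vertex means returning to the same layer, so the
        period is a multiple of \<open>k\<close>, and a larger one than \<open>k\<close>
        here.\<close>
      have "k dvd p" using tyy[of p] tyy[of 0] p by (simp add: mod_eq_0_iff_dvd)
      then have kp: "k < p" using ne p by (metis dvd_imp_le le_neq_implies_less)
      \<comment> \<open>Two equal vertices within one period, moved on by \<open>p - j\<close>
        steps, would produce a return to \<open>y 0\<close> before time \<open>p\<close>.\<close>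
      have av: "y j \<noteq> y i" if "i < k" "k \<le> j" "j < p" for i j
      proof
        assume "y j = y i"
        then have "y (i + (p - j)) = y (j + (p - j))" by (simp add: yadd)
        then have "y (i + (p - j)) = y 0" using that p by simp
        moreover have "0 < i + (p - j)" "i + (p - j) < p" using that by auto
        ultimately show False using pmin by metis
      qed
      have "(ed (k - 1), ed (k - 1 + n)) \<in> (avoiding ?gs)\<^sup>*" if "k - 1 + n < p" for n
        using that
      proof (induction n)
        case (Suc n)
        have "(ed (k - 1 + n), ed (k - 1 + Suc n)) \<in> line"
          using edG[of "k - 1 + n"] edG[of "k - 1 + Suc n"] by (simp add: line_def ed_def)
        moreover have "fst (ed (k - 1 + Suc n)) \<noteq> fst (?gs ! i)" if "i < k" for i
          using av[of i "k - 1 + Suc n"] Suc.prems that k by (simp add: ed_def)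
        ultimately have "(ed (k - 1 + n), ed (k - 1 + Suc n)) \<in> avoiding ?gs" unfolding avoiding_def by blast
        moreover have "(ed (k - 1), ed (k - 1 + n)) \<in> (avoiding ?gs)\<^sup>*"
          by (rule Suc.IH) (use Suc.prems in simp)
        ultimately show ?case by (rule rtrancl_into_rtrancl[rotated])
      qed simp
      from this[of "p - k"] have r: "(?gs ! (k - 1), ed (p - 1)) \<in> (avoiding ?gs)\<^sup>*"
        using kp k gsi[of "k - 1"] by simp
      moreover have "snd (ed (p - 1)) = fst (?gs ! 0)" using p kp k by (simp add: ed_def)
      moreover have "snd (?gs ! (k - 1)) \<noteq> fst (?gs ! 0)" using ne k gsi[of "k - 1"] by (simp add: ed_def)
      ultimately show ?thesis using ch edG[of "p - 1"] unfolding good_chain_def by metis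
    qed
    moreover have "?gs ! 0 = ed 0" using k by simp
    ultimately show ?thesis using reach edG unfolding escapes_def by blast
  qed
qed

lemma safe_iff_escapes: "(\<exists>m. safe m \<and> dom m = Domain G) \<longleftrightarrow> (\<forall>e\<in>G. escapes e)"
  using safe_of_escapes escapes_of_safe by blast

end

section \<open>Databases as words\<close>

declare bits.simps [simp del]

lemma set_bits: "set (bits n) \<subseteq> {1, 2}"
  by (induction n rule: bits.induct) (subst bits.simps, auto simp: less_2_cases_iff)

lemma bits_inj: "bits m = bits n \<Longrightarrow> m = n"
proof -
  define dcd where "dcd = foldl (\<lambda>a b. 2 * a + (b - 1)) (0::nat)"
  have "dcd (bits n) = n" for n
  proof (induction n rule: bits.induct)
    case (1 n)
    then show ?case by (subst bits.simps) (auto simp: dcd_def)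
  qed
  then show "bits m = bits n \<Longrightarrow> m = n" by metis
qed

section \<open>Unique readability of the encoding\<close>

definition tk :: "nat \<Rightarrow> nat list" where
  "tk c = bits c @ [3]"

definition toks :: "(rel, nat) fact \<Rightarrow> nat list" where
  "toks f = rel_code (fst f) # snd f"

lemma enc_fact_toks: "enc_fact f = concat (map tk (toks f)) @ [4]"
  by (simp add: enc_fact_def toks_def tk_def[abs_def])

lemma rel_code_inj: "rel_code r = rel_code r' \<Longrightarrow> r = r'"
  by (auto simp: rel_code_def split: rel.splits)

lemma toks_inj: "toks f = toks g \<Longrightarrow> f = g"
  by (auto simp: toks_def prod_eq_iff dest: rel_code_inj)

lemma append_sep_eq:
  assumes "a @ z # u = b @ z # v" "z \<notin> set a" "z \<notin> set b"
  shows "a = b \<and> u = v"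
  using assms
proof (induction a arbitrary: b)
  case Nil
  then show ?case by (cases b) auto
next
  case (Cons x a)
  then show ?case by (cases b) auto
qed

lemma bits_no_sep: "3 \<notin> set (bits c)" "4 \<notin> set (bits c)"
  using set_bits[of c] by auto

lemma tk_prefix: "tk c @ u = tk c' @ v \<Longrightarrow> c = c' \<and> u = v"
  using append_sep_eq[of "bits c" 3 u "bits c'" v] bits_no_sep bits_inj by (auto simp: tk_def)

lemma concat_tk_inj: "concat (map tk cs) = concat (map tk ds) \<Longrightarrow> cs = ds"
proof (induction cs arbitrary: ds)
  case Nil
  then show ?case by (cases ds) (auto simp: tk_def)
next
  case (Cons c cs)
  then obtain e ds' where ds: "ds = e # ds'" by (cases ds) (auto simp: tk_def)
  with Cons.prems have "tk c @ concat (map tk cs) = tk e @ concat (map tk ds')" by simp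
  then show ?case using tk_prefix Cons.IH ds by blast
qed

lemma no4: "4 \<notin> set (concat (map tk cs))"
  using bits_no_sep by (auto simp: tk_def)

lemma enc_fact_prefix: "enc_fact f @ u = enc_fact g @ v \<Longrightarrow> f = g"
  using append_sep_eq[of "concat (map tk (toks f))" 4 u "concat (map tk (toks g))" v, OF _ no4 no4]
    concat_tk_inj toks_inj by (auto simp: enc_fact_toks)

lemma set_enc_db: "set (enc_db xs) \<subseteq> {1..4}"
proof -
  have "x = 1 \<or> x = 2" if "x \<in> set (bits c)" for x c using set_bits[of c] that by auto
  then have "x \<in> {1..4}" if "x \<in> set (bits c)" for x c using that by fastforce
  then show ?thesis unfolding enc_db_def enc_fact_def by (auto split: if_splits)
qed

text \<open>In an encoded database the letter 4 occurs only at the ends of facts, so these are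
  exactly the positions at which a fact begins.\<close>

definition start :: "nat list \<Rightarrow> nat \<Rightarrow> bool" where
  "start w p \<longleftrightarrow> p < length w \<and> (p = 0 \<or> w ! (p - 1) = 4)"

definition loc :: "nat list \<Rightarrow> nat \<Rightarrow> (rel, nat) fact \<Rightarrow> bool" where
  "loc w p f \<longleftrightarrow> start w p \<and> (\<exists>v. drop p w = enc_fact f @ v)"

lemma loc_unique: "loc w p f \<Longrightarrow> loc w p g \<Longrightarrow> f = g"
  unfolding loc_def using enc_fact_prefix by metis

lemma loc_exists: "f \<in> set xs \<Longrightarrow> \<exists>p. loc (enc_db xs) p f"
proof -
  assume "f \<in> set xs"
  then obtain ys zs where xs: "xs = ys @ f # zs" by (meson split_list)
  have "start (enc_db xs) (length (enc_db ys))"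
  proof (cases ys rule: rev_cases)
    case Nil
    then show ?thesis by (simp add: start_def enc_db_def xs enc_fact_def)
  next
    case (snoc ys' g)
    then have "enc_db ys = (enc_db ys' @ concat (map tk (toks g))) @ [4]"
      by (simp add: enc_db_def enc_fact_toks)
    moreover have "enc_db xs = enc_db ys @ enc_fact f @ enc_db zs" by (simp add: enc_db_def xs)
    ultimately show ?thesis by (simp add: start_def nth_append enc_fact_def)
  qed
  moreover have "drop (length (enc_db ys)) (enc_db xs) = enc_fact f @ enc_db zs"
    by (simp add: enc_db_def xs)
  ultimately show ?thesis unfolding loc_def by blast
qed

lemma start_loc: "start (enc_db xs) p \<Longrightarrow> \<exists>f\<in>set xs. loc (enc_db xs) p f"
proof -
  have "\<exists>f\<in>set xs. \<exists>v. drop p (enc_db xs) = enc_fact f @ v" if "start (enc_db xs) p"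
    using that
  proof (induction xs arbitrary: p)
    case Nil
    then show ?case by (simp add: start_def enc_db_def)
  next
    case (Cons f xs)
    have w: "enc_db (f # xs) = enc_fact f @ enc_db xs" by (simp add: enc_db_def)
    let ?n = "length (enc_fact f)"
    show ?case
    proof (cases "p = 0")
      case True
      then show ?thesis using w by auto
    next
      case False
      have p: "p < length (enc_db (f # xs))" "enc_db (f # xs) ! (p - 1) = 4"
        using Cons.prems False by (auto simp: start_def)
      \<comment> \<open>A position inside the first fact, other than its beginning, is preceded by a
        letter of some token, and tokens do not contain 4.\<close>
      have "?n \<le> p"
      proof (rule ccontr)
        assume "\<not> ?n \<le> p"
        then have "p - 1 < length (concat (map tk (toks f)))" using False by (simp add: enc_fact_toks)
        then have "enc_db (f # xs) ! (p - 1) \<in> set (concat (map tk (toks f)))"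
          unfolding w enc_fact_toks by (simp only: append_assoc nth_append if_True nth_mem)
        then show False using p(2) no4 by metis
      qed
      then have "start (enc_db xs) (p - ?n)"
      proof (cases "p = ?n")
        case True
        then show ?thesis using p by (simp add: start_def w)
      next
        case False
        then have "\<not> p - 1 < ?n" "p - 1 - ?n = p - ?n - 1" using \<open>?n \<le> p\<close> by auto
        then show ?thesis using p \<open>?n \<le> p\<close> by (simp add: start_def w nth_append)
      qed
      then obtain g v where "g \<in> set xs" "drop (p - ?n) (enc_db xs) = enc_fact g @ v"
        using Cons.IH by blast
      then show ?thesis using \<open>?n \<le> p\<close> by (auto simp: w)
    qed
  qed
  then show "start (enc_db xs) p \<Longrightarrow> \<exists>f\<in>set xs. loc (enc_db xs) p f"
    unfolding loc_def by blast
qed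

lemma loc_mem: "loc (enc_db xs) p f \<Longrightarrow> f \<in> set xs"
  using start_loc loc_unique loc_def by metis

text \<open>Relation code and arguments are the tokens of a fact; \<open>token w j p q\<close> says that the \<open>j\<close>-th token of
  the fact at \<open>p\<close> starts at \<open>q\<close>, with the relation code as token 0.\<close>

definition letter :: "nat list \<Rightarrow> nat \<Rightarrow> nat \<Rightarrow> bool" where
  "letter w a p \<longleftrightarrow> p < length w \<and> w ! p = a"

text \<open>Numbers have no bounded length, so their ends cannot be found by a fixed number of
  successor steps; reachability along bit letters finds them.\<close>

definition bit_steps :: "nat list \<Rightarrow> (nat \<times> nat) set" where
  "bit_steps w = {(u, v). u \<le> length w \<and> v \<le> length w \<and> (letter w 1 u \<or> letter w 2 u) \<and> v = Suc u}"

definition next_token :: "nat list \<Rightarrow> nat \<Rightarrow> nat \<Rightarrow> bool" where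
  "next_token w p q \<longleftrightarrow> (\<exists>z\<le>length w. (p, z) \<in> (bit_steps w)\<^sup>* \<and> letter w 3 z \<and> q = Suc z)"

fun token :: "nat list \<Rightarrow> nat \<Rightarrow> nat \<Rightarrow> nat \<Rightarrow> bool" where
  "token w 0 p q \<longleftrightarrow> p = q"
| "token w (Suc j) p q \<longleftrightarrow> (\<exists>s\<le>length w. token w j p s \<and> next_token w s q)"

definition agree :: "nat list \<Rightarrow> nat \<Rightarrow> nat \<Rightarrow> bool" where
  "agree w u v \<longleftrightarrow> letter w 1 u \<and> letter w 1 v \<or> letter w 2 u \<and> letter w 2 v"

text \<open>This has the shape required by \<open>dec_sync\<close>: at the first offset without
  equal bits, both tokens must have reached their separator.\<close>

definition same_token :: "nat list \<Rightarrow> nat \<Rightarrow> nat \<Rightarrow> bool" where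
  "same_token w p q \<longleftrightarrow> (\<exists>m. (\<forall>t<m. agree w (p + t) (q + t)) \<and> \<not> agree w (p + m) (q + m) \<and>
     letter w 3 (p + m) \<and> letter w 3 (q + m))"

lemma drop_eq_letter: "drop p w = u @ a # v \<Longrightarrow> letter w b (p + length u) \<longleftrightarrow> b = a"
proof -
  assume d: "drop p w = u @ a # v"
  then have "length w - p = length u + Suc (length v)" by (metis length_append length_drop length_Cons)
  moreover have "w ! (p + length u) = drop p w ! length u" using calculation by (simp add: nth_drop)
  ultimately show ?thesis by (auto simp: letter_def d)
qed

lemma drop_eq_letter_nth:
  assumes "drop p w = u @ v" "i < length u"
  shows "letter w b (p + i) \<longleftrightarrow> b = u ! i"
proof -
  have "u = take i u @ u ! i # drop (Suc i) u" using assms(2) by (simp add: id_take_nth_drop)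
  then have "drop p w = take i u @ u ! i # (drop (Suc i) u @ v)"
    using assms(1) by (metis append.assoc append_Cons)
  from drop_eq_letter[OF this, of b] show ?thesis using assms(2) by simp
qed

text \<open>Steps leave only bit letters, so the walk cannot pass the separator behind the number;
  before it there is no letter 3.\<close>

lemma bit_steps_reach:
  assumes "drop p w = bits c @ 3 # v" "letter w 3 z"
  shows "(p, z) \<in> (bit_steps w)\<^sup>* \<longleftrightarrow> z = p + length (bits c)"
proof
  assume "(p, z) \<in> (bit_steps w)\<^sup>*"
  then have "z \<in> {p..p + length (bits c)}"
  proof (induction rule: rtrancl_induct)
    case (step y z)
    then obtain "y \<le> p + length (bits c)" "letter w 1 y \<or> letter w 2 y" "z = Suc y" "p \<le> y"
      by (auto simp: bit_steps_def)
    then show ?case using drop_eq_letter[OF assms(1)] by (cases "y = p + length (bits c)") auto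
  qed auto
  then obtain i where i: "z = p + i" "i \<le> length (bits c)" by (auto simp: le_iff_add)
  show "z = p + length (bits c)"
  proof (rule ccontr)
    assume "z \<noteq> p + length (bits c)"
    then have "i < length (bits c)" using i by simp
    then have "3 = bits c ! i" using drop_eq_letter_nth[OF assms(1)] assms(2) i by metis
    then show False using bits_no_sep(1)[of c] \<open>i < length (bits c)\<close> by (metis nth_mem)
  qed
next
  assume z: "z = p + length (bits c)"
  have "(p, p + i) \<in> (bit_steps w)\<^sup>*" if "i \<le> length (bits c)" for i
    using that
  proof (induction i)
    case (Suc i)
    have "bits c ! i \<in> {1, 2}" using Suc.prems set_bits[of c] nth_mem[of i "bits c"] by (metis Suc_le_eq subsetD)
    then have "letter w 1 (p + i) \<or> letter w 2 (p + i)"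
      using drop_eq_letter_nth[OF assms(1), of i "bits c ! i"] Suc.prems by auto
    then have "(p + i, p + Suc i) \<in> bit_steps w" by (auto simp: bit_steps_def letter_def)
    then show ?case using Suc by (meson Suc_leD rtrancl.rtrancl_into_rtrancl)
  qed auto
  then show "(p, z) \<in> (bit_steps w)\<^sup>*" using z by simp
qed

lemma next_token_iff:
  assumes "drop p w = tk c @ v"
  shows "next_token w p q \<longleftrightarrow> q = p + length (tk c)"
proof -
  have d: "drop p w = bits c @ 3 # v" using assms by (simp add: tk_def)
  have "letter w 3 (p + length (bits c))" using drop_eq_letter[OF d, of 3] by simp
  then show ?thesis using bit_steps_reach[OF d]
    by (auto simp: next_token_def tk_def letter_def)
qed

lemma drop_length_le: "drop p w = u @ v \<Longrightarrow> u \<noteq> [] \<Longrightarrow> p + length u \<le> length w"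
proof -
  assume "drop p w = u @ v" "u \<noteq> []"
  then have "length w - p = length u + length v" "length u > 0"
    by (metis length_append length_drop) (use \<open>u \<noteq> []\<close> in simp)
  then show ?thesis by linarith
qed

lemma drop_append_drop: "drop p w = u @ v \<Longrightarrow> drop (p + length u) w = v"
  by (metis add.commute append_eq_conv_conj drop_drop)

lemma token_iff:
  assumes "drop p w = concat (map tk cs) @ v" "j \<le> length cs"
  shows "token w j p q \<longleftrightarrow> q = p + length (concat (map tk (take j cs)))"
  using assms(2)
proof (induction j arbitrary: q)
  case (Suc j)
  let ?s = "p + length (concat (map tk (take j cs)))"
  have cs: "cs = take j cs @ cs ! j # drop (Suc j) cs" using Suc.prems by (simp add: id_take_nth_drop)
  have "drop p w = concat (map tk (take j cs)) @ (tk (cs ! j) @ (concat (map tk (drop (Suc j) cs)) @ v))"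
    unfolding assms(1) by (subst cs) simp
  from drop_append_drop[OF this] have d: "drop ?s w = tk (cs ! j) @ (concat (map tk (drop (Suc j) cs)) @ v)" .
  have "?s \<le> length w" using drop_length_le[OF d] by (simp add: tk_def)
  then have "token w (Suc j) p q \<longleftrightarrow> next_token w ?s q"
    using Suc by auto
  then show ?case using next_token_iff[OF d] Suc.prems by (simp add: take_Suc_conv_app_nth add.assoc)
qed auto

lemma same_token_iff:
  assumes p: "drop p w = tk c @ u" and q: "drop q w = tk c' @ v"
  shows "same_token w p q \<longleftrightarrow> c = c'"
proof -
  have p': "drop p w = bits c @ 3 # u" and q': "drop q w = bits c' @ 3 # v"
    using assms by (auto simp: tk_def)
  have bit: "bits c ! i = 1 \<or> bits c ! i = 2" if "i < length (bits c)" for c i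
    using that set_bits[of c] nth_mem by blast
  show ?thesis
  proof
    assume "same_token w p q"
    then obtain m where m: "\<forall>t<m. agree w (p + t) (q + t)" "letter w 3 (p + m)" "letter w 3 (q + m)"
      by (auto simp: same_token_def)
    have len: "m = length (bits c)" if d: "drop p w = bits c @ 3 # u" "letter w 3 (p + m)"
      "\<forall>t<m. letter w 1 (p + t) \<or> letter w 2 (p + t)" for p c u
    proof (rule antisym)
      show "m \<le> length (bits c)"
      proof (rule ccontr)
        assume "\<not> m \<le> length (bits c)"
        then have "letter w 1 (p + length (bits c)) \<or> letter w 2 (p + length (bits c))" using d(3) by simp
        then show False using drop_eq_letter[OF d(1)] by simp
      qed
      show "length (bits c) \<le> m"
      proof (rule ccontr)
        assume "\<not> length (bits c) \<le> m"
        then show False using drop_eq_letter_nth[OF d(1), of m 3] d(2) bit[of m c] by simp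
      qed
    qed
    have l: "m = length (bits c)" by (rule len[OF p' m(2)]) (use m(1) in \<open>auto simp: agree_def\<close>)
    have l': "m = length (bits c')" by (rule len[OF q' m(3)]) (use m(1) in \<open>auto simp: agree_def\<close>)
    have "bits c = bits c'"
    proof (rule nth_equalityI)
      fix i assume i: "i < length (bits c)"
      then have "agree w (p + i) (q + i)" using m(1) l by simp
      then show "bits c ! i = bits c' ! i"
        using drop_eq_letter_nth[OF p' i] drop_eq_letter_nth[OF q', of i] i l l' by (auto simp: agree_def)
    qed (use l l' in simp)
    then show "c = c'" by (rule bits_inj)
  next
    assume c: "c = c'"
    let ?m = "length (bits c)"
    have "letter w 3 (p + ?m)" "letter w 3 (q + ?m)"
      using drop_eq_letter[OF p', of 3] drop_eq_letter[OF q', of 3] c by simp_all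
    moreover have "agree w (p + t) (q + t)" if "t < ?m" for t
      using drop_eq_letter_nth[OF p' that] drop_eq_letter_nth[OF q', of t] that c bit[OF that]
      by (auto simp: agree_def)
    moreover have "\<not> agree w (p + ?m) (q + ?m)"
      using drop_eq_letter[OF p'] by (auto simp: agree_def)
    ultimately show "same_token w p q" unfolding same_token_def by blast
  qed
qed

definition prefix_at :: "nat list \<Rightarrow> nat list \<Rightarrow> nat \<Rightarrow> bool" where
  "prefix_at w u p \<longleftrightarrow> p \<le> length w \<and> (\<exists>v. drop p w = u @ v)"

lemma loc_prefix_at: "loc w p f \<Longrightarrow> prefix_at w (tk c) p \<longleftrightarrow> rel_code (fst f) = c"
proof -
  assume "loc w p f"
  then obtain v where v: "drop p w = enc_fact f @ v" "p < length w" by (auto simp: loc_def start_def)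
  then have d: "drop p w = tk (rel_code (fst f)) @ (concat (map tk (snd f)) @ [4] @ v)"
    by (simp add: enc_fact_toks toks_def)
  show ?thesis using tk_prefix v(2) unfolding prefix_at_def d by (metis order_less_imp_le)
qed

definition same_arg :: "nat list \<Rightarrow> nat \<Rightarrow> nat \<Rightarrow> nat \<Rightarrow> nat \<Rightarrow> bool" where
  "same_arg w i p j q \<longleftrightarrow> (\<exists>a\<le>length w. \<exists>b\<le>length w. token w (Suc i) p a \<and> token w (Suc j) q b \<and> same_token w a b)"

lemma loc_token:
  assumes "loc w p f" "i < length (snd f)"
  shows "\<exists>a\<le>length w. (\<forall>q. token w (Suc i) p q \<longleftrightarrow> q = a) \<and> (\<exists>v. drop a w = tk (snd f ! i) @ v)"
proof -
  obtain v where v: "drop p w = concat (map tk (toks f)) @ [4] @ v"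
    using assms(1) by (auto simp: loc_def enc_fact_toks)
  let ?cs = "toks f" and ?j = "Suc i"
  let ?s = "p + length (concat (map tk (take ?j ?cs)))"
  have l: "?j < length ?cs" and n: "?cs ! ?j = snd f ! i" using assms(2) by (auto simp: toks_def)
  have cs: "?cs = take ?j ?cs @ ?cs ! ?j # drop (Suc ?j) ?cs" using l by (simp add: id_take_nth_drop)
  have "drop p w = concat (map tk (take ?j ?cs)) @ (tk (?cs ! ?j) @ (concat (map tk (drop (Suc ?j) ?cs)) @ [4] @ v))"
    unfolding v by (subst cs) simp
  from drop_append_drop[OF this] n
  have d: "drop ?s w = tk (snd f ! i) @ (concat (map tk (drop (Suc ?j) ?cs)) @ [4] @ v)" by simp
  have "?s \<le> length w" using drop_length_le[OF d] by (simp add: tk_def)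
  moreover have "\<forall>q. token w (Suc i) p q \<longleftrightarrow> q = ?s" using token_iff[OF v, of ?j] l by simp
  ultimately show ?thesis using d by blast
qed

lemma loc_same_arg:
  assumes "loc w p f" "i < length (snd f)" "loc w q g" "j < length (snd g)"
  shows "same_arg w i p j q \<longleftrightarrow> snd f ! i = snd g ! j"
proof -
  obtain a u where a: "a \<le> length w" "\<And>q. token w (Suc i) p q \<longleftrightarrow> q = a" "drop a w = tk (snd f ! i) @ u"
    using loc_token[OF assms(1,2)] by blast
  obtain b v where b: "b \<le> length w" "\<And>p. token w (Suc j) q p \<longleftrightarrow> p = b" "drop b w = tk (snd g ! j) @ v"
    using loc_token[OF assms(3,4)] by blast
  have "same_arg w i p j q \<longleftrightarrow> same_token w a b"
    using a(1,2) b(1,2) unfolding same_arg_def by (simp del: token.simps)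
  then show ?thesis using same_token_iff[OF a(3) b(3)] by simp
qed

section \<open>The condition on positions\<close>

lemma dec_reach:
  assumes "dec (Suc (Suc d)) (\<lambda>w e. E w e (e d) (e (Suc d)))"
    and "\<And>w e u v. E w (e(d := u, Suc d := v)) u v = E w e u v" and "x < d" "y < d"
  shows "dec d (\<lambda>w e. (e x, e y) \<in> {(u, v). u \<le> length w \<and> v \<le> length w \<and> E w e u v}\<^sup>*)"
  using dec_reach_upd[OF assms(1,3,4)] assms(2) by simp

text \<open>A tuple of fixed length \<open>m\<close> is a block of \<open>m\<close> nested
  quantifiers over the variables from \<open>d\<close> on; the induction removes the innermost one.
  This is where the running time acquires an exponent depending on \<open>k\<close>.\<close>

lemma dec_ex_list:
  assumes "dec (d + m) (\<lambda>w e. Q w e (map e [d..<d + m]))"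
    and "\<And>w e v p ps. d \<le> v \<Longrightarrow> Q w (e(v := p)) ps = Q w e ps"
  shows "dec d (\<lambda>w e. \<exists>ps. length ps = m \<and> set ps \<subseteq> {..length w} \<and> Q w e ps)"
  using assms
proof (induction m arbitrary: Q)
  case 0
  then show ?case by simp
next
  case (Suc m)
  have "dec (d + m) (\<lambda>w e. \<exists>p\<le>length w. Q w e (map e [d..<d + m] @ [p]))"
  proof (rule dec_ex)
    show "dec (Suc (d + m)) (\<lambda>w e. Q w e (map e [d..<d + m] @ [e (d + m)]))"
      using Suc.prems(1) by simp
    show "Q w (e(d + m := p)) (map (e(d + m := p)) [d..<d + m] @ [p]) = Q w e (map e [d..<d + m] @ [p])" for w e p
    proof -
      have "map (e(d + m := p)) [d..<d + m] = map e [d..<d + m]" by (rule map_cong) auto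
      show ?thesis unfolding \<open>map (e(d + m := p)) [d..<d + m] = map e [d..<d + m]\<close>
        by (rule Suc.prems(2)) simp
    qed
  qed
  from Suc.IH[where Q = "\<lambda>w e ps. \<exists>p\<le>length w. Q w e (ps @ [p])", OF this]
  have "dec d (\<lambda>w e. \<exists>ps. length ps = m \<and> set ps \<subseteq> {..length w} \<and> (\<exists>p\<le>length w. Q w e (ps @ [p])))"
    using Suc.prems(2) by simp
  moreover have "(\<exists>ps. length ps = m \<and> set ps \<subseteq> {..length w} \<and> (\<exists>p\<le>length w. Q w e (ps @ [p])))
     \<longleftrightarrow> (\<exists>ps. length ps = Suc m \<and> set ps \<subseteq> {..length w} \<and> Q w e ps)" (is "?L \<longleftrightarrow> ?R") for w e
  proof
    assume ?L
    then obtain ps p where "length ps = m" "set ps \<subseteq> {..length w}" "p \<le> length w" "Q w e (ps @ [p])" by blast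
    then show ?R by (intro exI[of _ "ps @ [p]"]) auto
  next
    assume ?R
    then obtain qs where qs: "length qs = Suc m" "set qs \<subseteq> {..length w}" "Q w e qs" by blast
    then obtain ps p where "qs = ps @ [p]" by (metis length_Suc_conv_rev)
    with qs show ?L by (intro exI[of _ ps]) auto
  qed
  ultimately show ?case by simp
qed

lemma dec_letter': "x < d \<Longrightarrow> 1 \<le> a \<Longrightarrow> a \<le> 4 \<Longrightarrow> dec d (\<lambda>w e. letter w a (e x))"
  unfolding letter_def by (rule dec_letter)

lemma dec_agree: "x < d \<Longrightarrow> y < d \<Longrightarrow> dec d (\<lambda>w e. agree w (e x) (e y))"
  unfolding agree_def by (intro dec_disj dec_conj dec_letter') auto

lemma dec_same_token:
  assumes "x < d" "y < d"
  shows "dec d (\<lambda>w e. same_token w (e x) (e y))"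
proof -
  have A: "dec (Suc (Suc d)) (\<lambda>w e. agree w (e d) (e (Suc d)))" by (rule dec_agree) auto
  have Q: "dec (Suc (Suc d)) (\<lambda>w e. letter w 3 (e d) \<and> letter w 3 (e (Suc d)))"
    by (intro dec_conj dec_letter') auto
  have lt: "e d < length w \<and> e (Suc d) < length w" if "agree w (e d) (e (Suc d))" for w and e :: "nat \<Rightarrow> nat"
    using that by (auto simp: agree_def letter_def)
  show ?thesis using dec_sync[OF A Q assms lt] by (simp add: same_token_def)
qed

lemma dec_bit_steps:
  assumes "x < d" "y < d"
  shows "dec d (\<lambda>w e. (e x, e y) \<in> (bit_steps w)\<^sup>*)"
  unfolding bit_steps_def
  by (rule dec_reach[where E = "\<lambda>w e u v. (letter w 1 u \<or> letter w 2 u) \<and> v = Suc u"])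
    (use assms in \<open>auto intro!: dec_conj dec_disj dec_letter' dec_Suc\<close>)

lemma dec_next_token: "x < d \<Longrightarrow> y < d \<Longrightarrow> dec d (\<lambda>w e. next_token w (e x) (e y))"
  unfolding next_token_def
  by (rule dec_ex) (auto intro!: dec_conj dec_bit_steps dec_letter' dec_Suc)

lemma dec_token: "x < d \<Longrightarrow> y < d \<Longrightarrow> dec d (\<lambda>w e. token w j (e x) (e y))"
proof (induction j arbitrary: d x y)
  case 0
  then show ?case by (simp add: dec_eq)
next
  case (Suc j)
  then show ?case
    by (simp, intro dec_ex) (auto intro!: dec_conj dec_next_token)
qed

lemma dec_same_arg: "x < d \<Longrightarrow> y < d \<Longrightarrow> dec d (\<lambda>w e. same_arg w i (e x) j (e y))"
  unfolding same_arg_def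
  by (rule dec_ex, rule dec_ex) (auto intro!: dec_conj dec_token dec_same_token simp del: token.simps)

lemma prefix_at_Cons:
  "prefix_at w (a # u) p \<longleftrightarrow> letter w a p \<and> (\<exists>q\<le>length w. q = Suc p \<and> prefix_at w u q)"
proof -
  have "(\<exists>v. drop p w = a # u @ v) \<longleftrightarrow> letter w a p \<and> (\<exists>v. drop (Suc p) w = u @ v)"
  proof (cases "p < length w")
    case True
    then show ?thesis by (auto simp: letter_def Cons_nth_drop_Suc[symmetric])
  qed (auto simp: letter_def)
  then show ?thesis by (auto simp: prefix_at_def letter_def)
qed

lemma dec_le_length: "x < d \<Longrightarrow> dec d (\<lambda>w e. e x \<le> length w)"
proof -
  assume "x < d"
  then have "dec d (\<lambda>w e. \<exists>p\<le>length w. p = e x)"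
    by (intro dec_ex) (auto intro!: dec_eq)
  then show ?thesis by simp
qed

lemma dec_prefix_at: "x < d \<Longrightarrow> set u \<subseteq> {1..4} \<Longrightarrow> dec d (\<lambda>w e. prefix_at w u (e x))"
proof (induction u arbitrary: d x)
  case Nil
  then show ?case by (simp add: prefix_at_def dec_le_length)
next
  case (Cons a u)
  then show ?case
    unfolding prefix_at_Cons
    by (intro dec_conj dec_letter' dec_ex) (auto intro!: dec_conj dec_Suc)
qed

lemma dec_start: "x < d \<Longrightarrow> dec d (\<lambda>w e. start w (e x))"
proof -
  assume "x < d"
  \<comment> \<open>Comparison with the length and the predecessor are both rephrased through
    \<open>Suc\<close> and a quantified position, for which programs exist.\<close>
  then have "dec d (\<lambda>w e. (\<exists>q\<le>length w. q = Suc (e x)) \<and> (e x = 0 \<or> (\<exists>q\<le>length w. letter w 4 q \<and> e x = Suc q)))"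
    by (intro dec_conj dec_disj dec_zero dec_ex) (auto intro!: dec_conj dec_letter' dec_Suc)
  moreover have "start w p \<longleftrightarrow> (\<exists>q\<le>length w. q = Suc p) \<and> (p = 0 \<or> (\<exists>q\<le>length w. letter w 4 q \<and> p = Suc q))"
    for w p by (cases p) (auto simp: start_def letter_def Suc_le_eq)
  ultimately show ?thesis by simp
qed

section \<open>The graph condition as a formula over positions\<close>

definition at_rel :: "nat list \<Rightarrow> rel \<Rightarrow> nat \<Rightarrow> bool" where
  "at_rel w r p \<longleftrightarrow> start w p \<and> prefix_at w (tk (rel_code r)) p"

definition edge_pos :: "nat \<Rightarrow> nat list \<Rightarrow> nat \<Rightarrow> bool" where
  "edge_pos k w p \<longleftrightarrow> (\<exists>i<k. at_rel w (R (Suc i)) p)"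

definition follows :: "nat \<Rightarrow> nat list \<Rightarrow> nat \<Rightarrow> nat \<Rightarrow> bool" where
  "follows k w p q \<longleftrightarrow> (\<exists>i<k. at_rel w (R (Suc i)) p \<and> at_rel w (R (Suc (Suc i mod k))) q \<and> same_arg w 1 p 0 q)"

definition same_source :: "nat \<Rightarrow> nat list \<Rightarrow> nat \<Rightarrow> nat \<Rightarrow> bool" where
  "same_source k w p q \<longleftrightarrow> (\<exists>i<k. at_rel w (R (Suc i)) p \<and> at_rel w (R (Suc i)) q \<and> same_arg w 0 p 0 q)"

definition listed_pos :: "nat \<Rightarrow> nat list \<Rightarrow> nat list \<Rightarrow> bool" where
  "listed_pos k w ps \<longleftrightarrow> (\<exists>s\<le>length w. at_rel w S s \<and> (\<forall>i<k. same_arg w i s 0 (ps ! i)))"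

definition chain_pos :: "nat \<Rightarrow> nat list \<Rightarrow> nat list \<Rightarrow> bool" where
  "chain_pos k w ps \<longleftrightarrow> (\<forall>i<k. at_rel w (R (Suc i)) (ps ! i)) \<and> (\<forall>i<k - 1. follows k w (ps ! i) (ps ! Suc i))"

definition line_pos :: "nat \<Rightarrow> nat list \<Rightarrow> (nat \<times> nat) set" where
  "line_pos k w = {(u, v). u \<le> length w \<and> v \<le> length w \<and> follows k w u v}"

definition avoiding_pos :: "nat \<Rightarrow> nat list \<Rightarrow> nat list \<Rightarrow> (nat \<times> nat) set" where
  "avoiding_pos k w ps = {(u, v). u \<le> length w \<and> v \<le> length w \<and>
     follows k w u v \<and> (\<forall>i<k. \<not> same_source k w (ps ! i) v)}"

definition good_pos :: "nat \<Rightarrow> nat list \<Rightarrow> nat list \<Rightarrow> bool" where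
  "good_pos k w ps \<longleftrightarrow> chain_pos k w ps \<and>
     (follows k w (ps ! (k - 1)) (ps ! 0) \<and> \<not> listed_pos k w ps \<or>
      \<not> follows k w (ps ! (k - 1)) (ps ! 0) \<and>
        (\<exists>h\<le>length w. (ps ! (k - 1), h) \<in> (avoiding_pos k w ps)\<^sup>* \<and> follows k w h (ps ! 0)))"

definition escapes_pos :: "nat \<Rightarrow> nat list \<Rightarrow> nat \<Rightarrow> bool" where
  "escapes_pos k w p \<longleftrightarrow> (\<exists>q\<le>length w. (p, q) \<in> (line_pos k w)\<^sup>* \<and> edge_pos k w q \<and>
     (\<not> (\<exists>s\<le>length w. follows k w q s) \<or>
      (\<exists>ps. length ps = k \<and> set ps \<subseteq> {..length w} \<and> ps ! 0 = q \<and> good_pos k w ps)))"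

definition all_escape :: "nat \<Rightarrow> nat list \<Rightarrow> bool" where
  "all_escape k w \<longleftrightarrow> \<not> (\<exists>p\<le>length w. edge_pos k w p \<and> \<not> escapes_pos k w p)"

lemma dec_at_rel: "x < d \<Longrightarrow> dec d (\<lambda>w e. at_rel w r (e x))"
proof -
  have "set (tk c) \<subseteq> {1..4}" for c using set_bits[of c] by (auto simp: tk_def)
  then show "x < d \<Longrightarrow> dec d (\<lambda>w e. at_rel w r (e x))"
    unfolding at_rel_def by (intro dec_conj dec_start dec_prefix_at)
qed

lemma dec_edge_pos: "x < d \<Longrightarrow> dec d (\<lambda>w e. edge_pos k w (e x))"
  unfolding edge_pos_def by (intro dec_ex_less dec_at_rel)

lemma dec_follows: "x < d \<Longrightarrow> y < d \<Longrightarrow> dec d (\<lambda>w e. follows k w (e x) (e y))"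
  unfolding follows_def by (intro dec_ex_less dec_conj dec_at_rel dec_same_arg)

lemma dec_same_source: "x < d \<Longrightarrow> y < d \<Longrightarrow> dec d (\<lambda>w e. same_source k w (e x) (e y))"
  unfolding same_source_def by (intro dec_ex_less dec_conj dec_at_rel dec_same_arg)

text \<open>Here \<open>xs\<close> lists the indices of the variables that hold a tuple of
  positions; \<open>map e xs\<close> is the tuple itself.\<close>

context
  fixes xs :: "nat list" and k d :: nat
  assumes xs: "length xs = k" "set xs \<subseteq> {..<d}" and k: "2 \<le> k"
begin

lemma nth_vars: "i < k \<Longrightarrow> xs ! i < d" "i < k \<Longrightarrow> map e xs ! i = e (xs ! i)"
  using xs nth_mem by fastforce+

lemma dec_listed_pos: "dec d (\<lambda>w e. listed_pos k w (map e xs))"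
proof -
  have "dec d (\<lambda>w e. \<exists>s\<le>length w. at_rel w S s \<and> (\<forall>i<k. same_arg w i s 0 (e (xs ! i))))"
  proof (rule dec_ex)
    show "dec (Suc d) (\<lambda>w e. at_rel w S (e d) \<and> (\<forall>i<k. same_arg w i (e d) 0 (e (xs ! i))))"
      using nth_vars(1) by (intro dec_conj dec_at_rel dec_all_less dec_same_arg) (auto intro: less_SucI)
  qed (use nth_vars(1) in force)
  then show ?thesis by (simp add: listed_pos_def nth_vars(2))
qed

lemma dec_chain_pos: "dec d (\<lambda>w e. chain_pos k w (map e xs))"
proof -
  have "dec d (\<lambda>w e. (\<forall>i<k. at_rel w (R (Suc i)) (e (xs ! i))) \<and>
      (\<forall>i<k - 1. follows k w (e (xs ! i)) (e (xs ! Suc i))))"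
    using nth_vars(1) by (intro dec_conj dec_all_less dec_at_rel dec_follows) auto
  then show ?thesis by (simp add: chain_pos_def nth_vars(2))
qed

lemma dec_avoiding_pos:
  assumes "x < d" "y < d"
  shows "dec d (\<lambda>w e. (e x, e y) \<in> (avoiding_pos k w (map e xs))\<^sup>*)"
proof -
  have "dec d (\<lambda>w e. (e x, e y) \<in> {(u, v). u \<le> length w \<and> v \<le> length w \<and>
     (follows k w u v \<and> (\<forall>i<k. \<not> same_source k w (e (xs ! i)) v))}\<^sup>*)"
  proof (rule dec_reach)
    show "dec (Suc (Suc d)) (\<lambda>w e. follows k w (e d) (e (Suc d)) \<and> (\<forall>i<k. \<not> same_source k w (e (xs ! i)) (e (Suc d))))"
      using nth_vars(1) by (intro dec_conj dec_all_less dec_not dec_follows dec_same_source) (auto intro: less_SucI)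
  qed (use assms nth_vars(1) in force)+
  moreover have "avoiding_pos k w (map e xs) = {(u, v). u \<le> length w \<and> v \<le> length w \<and>
     (follows k w u v \<and> (\<forall>i<k. \<not> same_source k w (e (xs ! i)) v))}" for w and e :: "nat \<Rightarrow> nat"
    by (auto simp: avoiding_pos_def nth_vars(2))
  ultimately show ?thesis by simp
qed

end

lemma dec_good_pos:
  assumes xs: "length xs = k" "set xs \<subseteq> {..<d}" and k: "2 \<le> k"
  shows "dec d (\<lambda>w e. good_pos k w (map e xs))"
proof -
  note nth = nth_vars[OF xs k]
  have l: "k - 1 < k" "0 < k" using k by auto
  have "dec d (\<lambda>w e. \<exists>h\<le>length w. (e (xs ! (k - 1)), h) \<in> (avoiding_pos k w (map e xs))\<^sup>* \<and> follows k w h (e (xs ! 0)))"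
  proof (rule dec_ex)
    show "dec (Suc d) (\<lambda>w e. (e (xs ! (k - 1)), e d) \<in> (avoiding_pos k w (map e xs))\<^sup>* \<and> follows k w (e d) (e (xs ! 0)))"
      using nth(1)[OF l(1)] nth(1)[OF l(2)] xs k
      by (intro dec_conj dec_avoiding_pos dec_follows) auto
    fix w :: "nat list" and e :: "nat \<Rightarrow> nat" and p
    have eq: "map (e(d := p)) xs = map e xs" using xs(2) by (intro map_cong) auto
    show "((e(d := p)) (xs ! (k - 1)), p) \<in> (avoiding_pos k w (map (e(d := p)) xs))\<^sup>* \<and> follows k w p ((e(d := p)) (xs ! 0))
      \<longleftrightarrow> (e (xs ! (k - 1)), p) \<in> (avoiding_pos k w (map e xs))\<^sup>* \<and> follows k w p (e (xs ! 0))"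
      unfolding eq using nth(1)[OF l(1)] nth(1)[OF l(2)] by simp
  qed
  then have "dec d (\<lambda>w e. chain_pos k w (map e xs) \<and>
     (follows k w (e (xs ! (k - 1))) (e (xs ! 0)) \<and> \<not> listed_pos k w (map e xs) \<or>
      \<not> follows k w (e (xs ! (k - 1))) (e (xs ! 0)) \<and>
        (\<exists>h\<le>length w. (e (xs ! (k - 1)), h) \<in> (avoiding_pos k w (map e xs))\<^sup>* \<and> follows k w h (e (xs ! 0)))))"
    by (intro dec_conj dec_disj dec_not dec_chain_pos[OF xs k] dec_listed_pos[OF xs k] dec_follows nth(1) l)
  then show ?thesis by (simp only: good_pos_def nth(2)[OF l(1)] nth(2)[OF l(2)])
qed

lemma dec_line_pos: "x < d \<Longrightarrow> y < d \<Longrightarrow> dec d (\<lambda>w e. (e x, e y) \<in> (line_pos k w)\<^sup>*)"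
  unfolding line_pos_def
  by (rule dec_reach[where E = "\<lambda>w e u v. follows k w u v"]) (auto intro: dec_follows)

lemma dec_escapes_pos:
  assumes k: "2 \<le> k" and "x < d"
  shows "dec d (\<lambda>w e. escapes_pos k w (e x))"
proof -
  have g: "dec d (\<lambda>w e. \<exists>ps. length ps = k \<and> set ps \<subseteq> {..length w} \<and> (ps ! 0 = e y \<and> good_pos k w ps))" if "y < d" for y d
  proof (rule dec_ex_list)
    have "dec (d + k) (\<lambda>w e. e d = e y \<and> good_pos k w (map e [d..<d + k]))"
      using that k by (intro dec_conj dec_eq dec_good_pos) auto
    then show "dec (d + k) (\<lambda>w e. map e [d..<d + k] ! 0 = e y \<and> good_pos k w (map e [d..<d + k]))"
      using k by simp
  qed (use that in auto)
  have t: "dec d (\<lambda>w e. \<exists>s\<le>length w. follows k w (e y) s)" if "y < d" for y d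
    by (rule dec_ex) (use that in \<open>auto intro: dec_follows\<close>)
  show ?thesis
    unfolding escapes_pos_def
  proof (rule dec_ex)
    show "dec (Suc d) (\<lambda>w e. (e x, e d) \<in> (line_pos k w)\<^sup>* \<and> edge_pos k w (e d) \<and>
     (\<not> (\<exists>s\<le>length w. follows k w (e d) s) \<or>
      (\<exists>ps. length ps = k \<and> set ps \<subseteq> {..length w} \<and> ps ! 0 = e d \<and> good_pos k w ps)))"
      by (intro dec_conj dec_disj dec_not dec_line_pos dec_edge_pos t g) (use assms in auto)
  qed (use assms in simp)
qed

lemma dec_all_escape: "2 \<le> k \<Longrightarrow> dec d (\<lambda>w e. all_escape k w)"
  unfolding all_escape_def
  by (intro dec_not dec_ex dec_conj dec_edge_pos dec_escapes_pos) auto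

section \<open>Repairs as choice functions\<close>

lemma ex_repair:
  assumes "finite db" "s \<subseteq> db" "consistent kl s"
  shows "\<exists>r. repair kl db r \<and> s \<subseteq> r"
proof -
  let ?A = "{r. r \<subseteq> db \<and> consistent kl r}"
  have "finite ?A" by (rule finite_subset[of _ "Pow db"]) (use assms in auto)
  from finite_has_maximal2[OF this, of s] assms
  obtain r where "r \<in> ?A" "s \<subseteq> r" "\<forall>b\<in>?A. r \<subseteq> b \<longrightarrow> r = b" by auto
  then show ?thesis unfolding repair_def by blast
qed

lemma key_equal_sym: "key_equal kl f g \<Longrightarrow> key_equal kl g f"
  unfolding key_equal_def by metis

lemma repair_meets_block:
  assumes r: "repair kl db r" and g: "g \<in> db"
  shows "\<exists>h\<in>r. key_equal kl h g"
proof (rule ccontr)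
  assume n: "\<not> (\<exists>h\<in>r. key_equal kl h g)"
  have "consistent kl (insert g r)"
    unfolding consistent_def
  proof (intro ballI impI)
    fix f h assume fh: "f \<in> insert g r" "h \<in> insert g r" "key_equal kl f h"
    then have "\<not> (f = g \<and> h \<in> r)" "\<not> (h = g \<and> f \<in> r)" using n key_equal_sym by metis+
    then show "f = h" using fh r unfolding repair_def consistent_def by (metis insertE)
  qed
  moreover have "insert g r \<subseteq> db" "r \<subseteq> insert g r" using r g by (auto simp: repair_def)
  ultimately have "insert g r = r" using r unfolding repair_def by metis
  moreover have "key_equal kl g g" by (simp add: key_equal_def)
  ultimately show False using n by blast
qed

text \<open>Layers count from 0, so \<open>R (Suc i)\<close> leaves layer \<open>i\<close> and
  \<open>R k\<close> returns to layer 0. Facts over \<open>R j\<close> with \<open>j\<close> outside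
  1 to \<open>k\<close> contribute no edge.\<close>

definition edges :: "nat \<Rightarrow> (rel, nat) fact set \<Rightarrow> ((nat \<times> nat) \<times> (nat \<times> nat)) set" where
  "edges k db = {((i, a), (Suc i mod k, b)) | i a b. i < k \<and> (R (Suc i), [a, b]) \<in> db}"

definition listed :: "(rel, nat) fact set \<Rightarrow> nat list set" where
  "listed db = {x. (S, x) \<in> db}"

lemma edges_iff: "((i, a), (j, b)) \<in> edges k db \<longleftrightarrow> i < k \<and> j = Suc i mod k \<and> (R (Suc i), [a, b]) \<in> db"
  by (auto simp: edges_def)

lemma satisfies_AC:
  assumes k: "2 \<le> k"
  shows "satisfies r (AC k) \<longleftrightarrow> (\<exists>x. length x = k \<and> (S, x) \<in> r \<and>
    (\<forall>i<k. (R (Suc i), [x ! i, x ! (Suc i mod k)]) \<in> r))"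
proof
  assume "satisfies r (AC k)"
  then obtain s where s: "\<And>a. a \<in> AC k \<Longrightarrow> (fst a, map (inst s) (snd a)) \<in> r"
    by (auto simp: satisfies_def)
  let ?x = "map s [1..<k + 1]"
  have "(S, ?x) \<in> r"
    using s[of "(S, map Var [1..<k+1])"] by (simp add: AC_def comp_def del: upt_Suc)
  moreover have "(R (Suc i), [?x ! i, ?x ! (Suc i mod k)]) \<in> r" if i: "i < k" for i
  proof (cases "Suc i = k")
    case True
    have "(R k, [s k, s 1]) \<in> r" using s[of "(R k, [Var k, Var 1])"] by (simp add: AC_def)
    then show ?thesis using True k by (simp add: nth_append del: upt_Suc)
  next
    case False
    then have "(R (Suc i), [s (Suc i), s (Suc i + 1)]) \<in> r"
      using s[of "(R (Suc i), [Var (Suc i), Var (Suc i + 1)])"] i by (simp add: AC_def)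
    then show ?thesis using False i by (simp del: upt_Suc)
  qed
  ultimately show "\<exists>x. length x = k \<and> (S, x) \<in> r \<and> (\<forall>i<k. (R (Suc i), [x ! i, x ! (Suc i mod k)]) \<in> r)"
    by (intro exI[of _ ?x]) (simp del: upt_Suc)
next
  assume "\<exists>x. length x = k \<and> (S, x) \<in> r \<and> (\<forall>i<k. (R (Suc i), [x ! i, x ! (Suc i mod k)]) \<in> r)"
  then obtain x where x: "length x = k" "(S, x) \<in> r"
    "\<And>i. i < k \<Longrightarrow> (R (Suc i), [x ! i, x ! (Suc i mod k)]) \<in> r" by blast
  define s where "s = (\<lambda>j. x ! (j - 1))"
  have "map s [1..<k + 1] = x"
    by (rule nth_equalityI) (use x(1) in \<open>auto simp: s_def simp del: upt_Suc\<close>)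
  then have 1: "(S, map (inst s) (map Var [1..<k + 1])) \<in> r"
    using x(2) by (simp add: comp_def del: upt_Suc)
  have 2: "(R i, [s i, s (i + 1)]) \<in> r" if "1 \<le> i" "i < k" for i
    using x(3)[of "i - 1"] that by (simp add: s_def)
  have 3: "(R k, [s k, s 1]) \<in> r"
    using x(3)[of "k - 1"] k by (simp add: s_def)
  show "satisfies r (AC k)"
    unfolding satisfies_def
  proof (intro exI[of _ s] ballI)
    fix a :: "(rel, nat, nat) atom" assume "a \<in> AC k"
    then consider i where "1 \<le> i" "i < k" "a = (R i, [Var i, Var (i + 1)])"
      | "a = (R k, [Var k, Var 1])" | "a = (S, map Var [1..<k + 1])" unfolding AC_def by blast
    then show "(fst a, map (inst s) (snd a)) \<in> r"
      using 1 2 3 by cases (simp_all del: upt_Suc)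
  qed
qed

context
  fixes k :: nat and db :: "(rel, nat) fact set"
  assumes k: "2 \<le> k" and db: "uncertain_db (ac_arity k) db"
begin

lemma len_R: "(R i, x) \<in> db \<Longrightarrow> \<exists>a b. x = [a, b]"
  using db by (fastforce simp: uncertain_db_def ac_arity_def length_Suc_conv numeral_2_eq_2)

lemma len_S: "(S, x) \<in> db \<Longrightarrow> length x = k"
  using db by (fastforce simp: uncertain_db_def ac_arity_def)

lemma finite_edges: "finite (edges k db)"
proof (rule finite_surj)
  show "finite db" using db by (simp add: uncertain_db_def)
  show "edges k db \<subseteq> (\<lambda>f. case f of (R j, x) \<Rightarrow> ((j - 1, x ! 0), (j mod k, x ! 1)) | _ \<Rightarrow> ((0, 0), (0, 0))) ` db"
    by (force simp: edges_def image_iff)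
qed

lemma layered_graph_edges: "layered_graph k (edges k db) (listed db)"
  by unfold_locales (use k finite_edges len_S in \<open>auto simp: edges_def listed_def\<close>)

interpretation layered_graph k "edges k db" "listed db"
  by (rule layered_graph_edges)

text \<open>The chosen facts are consistent and meet every block of \<open>R 1\<close> to
  \<open>R k\<close>. A repair containing them thus has no other facts of these relations, and a
  match in it would be a listed cycle of \<open>m\<close>.\<close>

lemma not_certain_of_safe:
  assumes m: "safe m" "dom m = Domain (edges k db)"
  shows "\<not> certain (ac_key k) (AC k) db"
proof -
  have mi: "\<exists>b. m (i, a) = Some (Suc i mod k, b) \<and> (R (Suc i), [a, b]) \<in> db"
    if f: "(R (Suc i), [a, b]) \<in> db" "i < k" for i a b
  proof -
    have "(i, a) \<in> dom m" using f m(2) edges_iff[of i a "Suc i mod k" b k db] by blast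
    then obtain j c where j: "m (i, a) = Some (j, c)" by auto
    then show ?thesis using safe_edge[OF m(1) j] by (auto simp: edges_iff)
  qed
  define s where "s = {(R (Suc i), [a, b]) | i a b. i < k \<and> m (i, a) = Some (Suc i mod k, b) \<and> (R (Suc i), [a, b]) \<in> db}"
  have "s \<subseteq> db" by (auto simp: s_def)
  moreover have "consistent (ac_key k) s"
    by (auto simp: consistent_def s_def key_equal_def ac_key_def)
  moreover have "finite db" using db by (simp add: uncertain_db_def)
  ultimately obtain r where r: "repair (ac_key k) db r" "s \<subseteq> r" using ex_repair by blast
  have "\<not> satisfies r (AC k)"
  proof
    assume "satisfies r (AC k)"
    then obtain x where x: "length x = k" "(S, x) \<in> r"
      "\<And>i. i < k \<Longrightarrow> (R (Suc i), [x ! i, x ! (Suc i mod k)]) \<in> r"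
      by (auto simp: satisfies_AC[OF k])
    have rdb: "r \<subseteq> db" "consistent (ac_key k) r" using r by (auto simp: repair_def)
    have "m (i, x ! i) = Some (Suc i mod k, x ! (Suc i mod k))" if i: "i < k" for i
    proof -
      obtain b where b: "m (i, x ! i) = Some (Suc i mod k, b)" "(R (Suc i), [x ! i, b]) \<in> db"
        using mi[of i "x ! i" "x ! (Suc i mod k)"] x(3)[OF i] rdb(1) i by blast
      then have "(R (Suc i), [x ! i, b]) \<in> r" using r(2) i by (auto simp: s_def)
      moreover have "key_equal (ac_key k) (R (Suc i), [x ! i, b]) (R (Suc i), [x ! i, x ! (Suc i mod k)])"
        by (simp add: key_equal_def ac_key_def)
      ultimately have "b = x ! (Suc i mod k)" using rdb(2) x(3)[OF i] unfolding consistent_def by blast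
      then show ?thesis using b by simp
    qed
    then have "forb m x" by (simp add: forb_def)
    moreover have "x \<in> listed db" using x(2) rdb(1) by (auto simp: listed_def)
    ultimately show False using m(1) by (auto simp: safe_def)
  qed
  then show ?thesis using r(1) by (auto simp: certain_def)
qed

text \<open>A repair meets every block, so it selects an edge at each non-sink. Blocks of
  \<open>S\<close> are single facts, hence all listed tuples are in the repair and a listed cycle
  among the selected edges would be a match.\<close>

lemma safe_of_not_certain:
  assumes "\<not> certain (ac_key k) (AC k) db"
  shows "\<exists>m. safe m \<and> dom m = Domain (edges k db)"
proof -
  obtain r where r: "repair (ac_key k) db r" "\<not> satisfies r (AC k)"
    using assms by (auto simp: certain_def)
  have rdb: "r \<subseteq> db" using r by (auto simp: repair_def)
  define m where "m = (\<lambda>v. if v \<in> Domain (edges k db)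
     then Some (Suc (fst v) mod k, SOME b. (R (Suc (fst v)), [snd v, b]) \<in> r) else None)"
  have mr: "(R (Suc i), [a, b]) \<in> r \<and> i < k" if e: "m (i, a) = Some (j, b)" for i a j b
  proof -
    have "(i, a) \<in> Domain (edges k db)" using e by (auto simp: m_def split: if_splits)
    then obtain c where c: "(R (Suc i), [a, c]) \<in> db" "i < k" by (auto simp: edges_def)
    obtain h where h: "h \<in> r" "key_equal (ac_key k) h (R (Suc i), [a, c])"
      using repair_meets_block[OF r(1) c(1)] by blast
    then obtain a' b' where "h = (R (Suc i), [a', b'])"
      using len_R[of "Suc i" "snd h"] rdb by (cases h) (auto simp: key_equal_def)
    with h have "(R (Suc i), [a, b']) \<in> r" by (auto simp: key_equal_def ac_key_def)
    then have "(R (Suc i), [a, SOME b. (R (Suc i), [a, b]) \<in> r]) \<in> r" by (rule someI)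
    then show ?thesis using e c(2) by (auto simp: m_def split: if_splits)
  qed
  have mj: "j = Suc i mod k" if "m (i, a) = Some (j, b)" for i a j b
    using that by (auto simp: m_def split: if_splits)
  have dom: "dom m = Domain (edges k db)" by (auto simp: m_def dom_def split: if_splits)
  have "safe m"
    unfolding safe_def
  proof (intro conjI allI impI ballI notI)
    fix v w assume e: "m v = Some w"
    obtain i a j b where v: "v = (i, a)" "w = (j, b)" by (metis surj_pair)
    then show "(v, w) \<in> edges k db" using mr[of i a j b] mj[of i a j b] rdb e by (auto simp: edges_iff)
    show "w \<in> dom m \<or> w \<notin> Domain (edges k db)" unfolding dom by blast
  next
    fix x assume x: "x \<in> listed db" "forb m x"
    have S: "(S, x) \<in> db" using x by (simp add: listed_def)
    then obtain h where h: "h \<in> r" "key_equal (ac_key k) h (S, x)" using repair_meets_block[OF r(1)] by blast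
    then obtain y where y: "h = (S, y)" by (cases h) (auto simp: key_equal_def)
    then have "length y = k" using h(1) rdb len_S by blast
    then have "(S, x) \<in> r" using h y len_S[OF S] by (auto simp: key_equal_def ac_key_def)
    moreover have "(R (Suc i), [x ! i, x ! (Suc i mod k)]) \<in> r" if "i < k" for i
      using x(2) that mr by (auto simp: forb_def)
    ultimately have "satisfies r (AC k)" using len_S[OF S] by (auto simp: satisfies_AC[OF k])
    then show False using r(2) by blast
  qed
  with dom show ?thesis by blast
qed

lemma certain_iff_escapes:
  "certain (ac_key k) (AC k) db \<longleftrightarrow> \<not> (\<forall>e\<in>edges k db. escapes e)"
  using not_certain_of_safe safe_of_not_certain safe_iff_escapes by blast

end

section \<open>Positions and edges\<close>

text \<open>The list may repeat a fact, so an edge can have several positions and there is no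
  bijection. The correspondence is a bisimulation, and this lemma serves both of its
  directions.\<close>

lemma rtrancl_simulation:
  assumes "(p, q) \<in> A\<^sup>*" "rel p e"
    and "\<And>p q e. (p, q) \<in> A \<Longrightarrow> rel p e \<Longrightarrow> \<exists>e'. rel q e' \<and> (e, e') \<in> B"
  shows "\<exists>e'. rel q e' \<and> (e, e') \<in> B\<^sup>*"
  using assms(1)
proof (induction rule: rtrancl_induct)
  case base
  then show ?case using assms(2) by blast
next
  case (step y z)
  then show ?case using assms(3) by (meson rtrancl.rtrancl_into_rtrancl)
qed

lemma at_rel_loc: "loc w p f \<Longrightarrow> at_rel w r p \<longleftrightarrow> fst f = r"
  using loc_prefix_at[of w p f "rel_code r"] rel_code_inj by (auto simp: at_rel_def loc_def)

context
  fixes k :: nat and xs :: "(rel, nat) fact list"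
  assumes k: "2 \<le> k" and db: "uncertain_db (ac_arity k) (set xs)"
begin

interpretation layered_graph k "edges k (set xs)" "listed (set xs)"
  by (rule layered_graph_edges[OF k db])

abbreviation "w \<equiv> enc_db xs"

definition edge_at :: "nat \<Rightarrow> (nat \<times> nat) \<times> (nat \<times> nat) \<Rightarrow> bool" where
  "edge_at p e \<longleftrightarrow> (\<exists>i a b. e = ((i, a), (Suc i mod k, b)) \<and> i < k \<and> loc w p (R (Suc i), [a, b]))"

lemma at_rel_loc_ex: "at_rel w r p \<Longrightarrow> \<exists>x. (r, x) \<in> set xs \<and> loc w p (r, x)"
  using start_loc[of xs p] at_rel_loc[of w p _ r] by (metis at_rel_def prod.collapse)

lemma at_ex: "e \<in> edges k (set xs) \<Longrightarrow> \<exists>p. edge_at p e"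
  using loc_exists unfolding edges_def edge_at_def by blast

lemma at_edges: "edge_at p e \<Longrightarrow> e \<in> edges k (set xs)" and at_le: "edge_at p e \<Longrightarrow> p \<le> length w"
  using loc_mem by (fastforce simp: edge_at_def edges_def loc_def start_def)+

lemma at_rel_at: "i < k \<Longrightarrow> at_rel w (R (Suc i)) p \<Longrightarrow> \<exists>e. edge_at p e"
proof -
  assume i: "i < k" and "at_rel w (R (Suc i)) p"
  then obtain x where x: "(R (Suc i), x) \<in> set xs" "loc w p (R (Suc i), x)"
    using at_rel_loc_ex by blast
  obtain a b where "x = [a, b]" using len_R[OF k db x(1)] by blast
  then have "edge_at p ((i, a), (Suc i mod k, b))" using x(2) i by (simp add: edge_at_def)
  then show ?thesis by blast
qed

lemma at_at_rel: "edge_at p e \<Longrightarrow> at_rel w (R (Suc i)) p \<longleftrightarrow> fst (fst e) = i"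
  unfolding edge_at_def by (auto simp: at_rel_loc)

lemma at_layer: "edge_at p e \<Longrightarrow> fst (fst e) < k \<and> fst (snd e) = Suc (fst (fst e)) mod k"
  by (auto simp: edge_at_def)

lemma at_args:
  assumes "edge_at p e"
  shows "\<exists>f. loc w p f \<and> length (snd f) = 2 \<and> snd f ! 0 = snd (fst e) \<and> snd f ! 1 = snd (snd e)"
  using assms unfolding edge_at_def by fastforce

lemma at_same_arg:
  assumes "edge_at p e" "edge_at q e'"
  shows "same_arg w 0 p 0 q \<longleftrightarrow> snd (fst e) = snd (fst e')" "same_arg w 1 p 0 q \<longleftrightarrow> snd (snd e) = snd (fst e')"
proof -
  obtain f g where f: "loc w p f" "length (snd f) = 2" "snd f ! 0 = snd (fst e)" "snd f ! 1 = snd (snd e)"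
    and g: "loc w q g" "length (snd g) = 2" "snd g ! 0 = snd (fst e')"
    using at_args assms by metis
  show "same_arg w 0 p 0 q \<longleftrightarrow> snd (fst e) = snd (fst e')" "same_arg w 1 p 0 q \<longleftrightarrow> snd (snd e) = snd (fst e')"
    using loc_same_arg[OF f(1) _ g(1)] f g by simp_all
qed

lemma at_edge_pos: "edge_pos k w p \<longleftrightarrow> (\<exists>e. edge_at p e)"
  unfolding edge_pos_def using at_rel_at at_at_rel at_layer by metis

lemma at_follows: "edge_at p e \<Longrightarrow> edge_at q e' \<Longrightarrow> follows k w p q \<longleftrightarrow> snd e = fst e'"
proof -
  assume p: "edge_at p e" and q: "edge_at q e'"
  have "follows k w p q \<longleftrightarrow>
      (\<exists>i<k. fst (fst e) = i \<and> fst (fst e') = Suc i mod k \<and> snd (snd e) = snd (fst e'))"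
    unfolding follows_def at_at_rel[OF p] at_at_rel[OF q] at_same_arg[OF p q] ..
  then show ?thesis using at_layer[OF p] by (auto simp: prod_eq_iff)
qed

lemma follows_at: "follows k w p q \<Longrightarrow> (\<exists>e. edge_at p e) \<and> (\<exists>e'. edge_at q e')"
proof -
  assume "follows k w p q"
  then obtain i where i: "i < k" "at_rel w (R (Suc i)) p" "at_rel w (R (Suc (Suc i mod k))) q"
    by (auto simp: follows_def)
  have "Suc i mod k < k" using k by simp
  then show ?thesis using i at_rel_at by blast
qed

lemma at_same_source: "edge_at p e \<Longrightarrow> edge_at q e' \<Longrightarrow> same_source k w p q \<longleftrightarrow> fst e = fst e'"
proof -
  assume p: "edge_at p e" and q: "edge_at q e'"
  have "same_source k w p q \<longleftrightarrow> (\<exists>i<k. fst (fst e) = i \<and> fst (fst e') = i \<and> snd (fst e) = snd (fst e'))"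
    unfolding same_source_def at_at_rel[OF p] at_at_rel[OF q] at_same_arg[OF p q] ..
  then show ?thesis using at_layer[OF p] by (auto simp: prod_eq_iff)
qed

lemma line_pos_line:
  assumes "edge_at p e" "(p, q) \<in> line_pos k w"
  shows "\<exists>e'. edge_at q e' \<and> (e, e') \<in> line"
proof -
  have f: "follows k w p q" using assms by (simp add: line_pos_def)
  then obtain e' where e': "edge_at q e'" using follows_at by blast
  then have "(e, e') \<in> line" using f at_follows[OF assms(1) e'] at_edges assms(1) by (simp add: line_def)
  with e' show ?thesis by blast
qed

lemma line_line_pos:
  assumes "edge_at p e" "(e, e') \<in> line"
  shows "\<exists>q. edge_at q e' \<and> (p, q) \<in> line_pos k w"
proof -
  have e: "e' \<in> edges k (set xs)" "snd e = fst e'" using assms(2) by (simp_all add: line_def)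
  then obtain q where q: "edge_at q e'" using at_ex by blast
  then have "(p, q) \<in> line_pos k w"
    using at_follows[OF assms(1) q] e(2) at_le[OF q] at_le[OF assms(1)] by (simp add: line_pos_def)
  with q show ?thesis by blast
qed

lemma at_terminal: "edge_at p e \<Longrightarrow> (\<exists>s\<le>length w. follows k w p s) \<longleftrightarrow> snd e \<in> Domain (edges k (set xs))"
proof
  assume p: "edge_at p e" and "\<exists>s\<le>length w. follows k w p s"
  then obtain s e' where "follows k w p s" "edge_at s e'" using follows_at by blast
  then have "snd e = fst e'" "e' \<in> edges k (set xs)" using p at_follows at_edges by blast+
  then show "snd e \<in> Domain (edges k (set xs))" by (cases e') auto
next
  assume p: "edge_at p e" and "snd e \<in> Domain (edges k (set xs))"
  then obtain v where "(snd e, v) \<in> edges k (set xs)" by blast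
  then obtain s where s: "edge_at s (snd e, v)" using at_ex by blast
  then show "\<exists>s\<le>length w. follows k w p s" using at_follows[OF p s] at_le[OF s] by auto
qed

context
  fixes ps :: "nat list" and gs :: "((nat \<times> nat) \<times> (nat \<times> nat)) list"
  assumes len: "length ps = k" "length gs = k" and at_nth: "\<And>i. i < k \<Longrightarrow> edge_at (ps ! i) (gs ! i)"
begin

lemma chain_pos_iff: "chain_pos k w ps \<longleftrightarrow> chain gs"
proof -
  have "at_rel w (R (Suc i)) (ps ! i) \<longleftrightarrow> gs ! i \<in> edges k (set xs) \<and> fst (fst (gs ! i)) = i" if "i < k" for i
    using at_at_rel at_edges at_nth that by blast
  moreover have "follows k w (ps ! i) (ps ! Suc i) \<longleftrightarrow> snd (gs ! i) = fst (gs ! Suc i)" if "i < k - 1" for i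
    using at_follows at_nth that by simp
  ultimately show ?thesis using len by (simp add: chain_pos_def chain_def)
qed

lemma listed_pos_iff: "listed_pos k w ps \<longleftrightarrow> map (snd \<circ> fst) gs \<in> listed (set xs)"
proof -
  have arg: "same_arg w i s 0 (ps ! i) \<longleftrightarrow> x ! i = snd (fst (gs ! i))"
    if s: "loc w s (S, x)" "length x = k" "i < k" for s x i
  proof -
    obtain f where "loc w (ps ! i) f" "length (snd f) = 2" "snd f ! 0 = snd (fst (gs ! i))"
      using at_args[OF at_nth[OF s(3)]] by blast
    then show ?thesis using loc_same_arg[OF s(1), of i "ps ! i" f 0] s by simp
  qed
  show ?thesis
  proof
    assume "listed_pos k w ps"
    then obtain s where s: "at_rel w S s" "\<And>i. i < k \<Longrightarrow> same_arg w i s 0 (ps ! i)"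
      by (auto simp: listed_pos_def)
    obtain x where x: "(S, x) \<in> set xs" "loc w s (S, x)" using at_rel_loc_ex[OF s(1)] by blast
    have l: "length x = k" using len_S[OF k db x(1)] .
    have "x = map (snd \<circ> fst) gs"
      by (rule nth_equalityI) (use l len arg[OF x(2) l] s(2) in auto)
    then show "map (snd \<circ> fst) gs \<in> listed (set xs)" using x(1) by (simp add: listed_def)
  next
    assume "map (snd \<circ> fst) gs \<in> listed (set xs)"
    then have "(S, map (snd \<circ> fst) gs) \<in> set xs" by (simp add: listed_def)
    then obtain s where s: "loc w s (S, map (snd \<circ> fst) gs)" using loc_exists by blast
    then have "at_rel w S s" "s \<le> length w" using at_rel_loc[OF s] by (auto simp: loc_def start_def)
    then show "listed_pos k w ps" unfolding listed_pos_def using arg[OF s] len by auto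
  qed
qed

lemma avoiding_pos_iff:
  "edge_at p e \<Longrightarrow> edge_at q e' \<Longrightarrow> (p, q) \<in> avoiding_pos k w ps \<longleftrightarrow> (e, e') \<in> avoiding gs"
proof -
  assume p: "edge_at p e" and q: "edge_at q e'"
  have "same_source k w (ps ! i) q \<longleftrightarrow> fst e' = fst (gs ! i)" if "i < k" for i
    using at_same_source[OF at_nth[OF that] q] by auto
  then show ?thesis
    using at_follows[OF p q] at_edges[OF p] at_edges[OF q] at_le[OF p] at_le[OF q]
    by (simp add: avoiding_pos_def avoiding_def line_def)
qed

lemma good_pos_iff: "good_pos k w ps \<longleftrightarrow> good_chain gs"
proof -
  have l: "k - 1 < k" "0 < k" using k by auto
  note first = at_nth[OF l(2)] and last = at_nth[OF l(1)]
  have "(\<exists>h\<le>length w. (ps ! (k - 1), h) \<in> (avoiding_pos k w ps)\<^sup>* \<and> follows k w h (ps ! 0)) \<longleftrightarrow>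
    (\<exists>h\<in>edges k (set xs). (gs ! (k - 1), h) \<in> (avoiding gs)\<^sup>* \<and> snd h = fst (gs ! 0))"
  proof
    assume "\<exists>h\<le>length w. (ps ! (k - 1), h) \<in> (avoiding_pos k w ps)\<^sup>* \<and> follows k w h (ps ! 0)"
    then obtain h where h: "(ps ! (k - 1), h) \<in> (avoiding_pos k w ps)\<^sup>*" "follows k w h (ps ! 0)" by blast
    have "\<exists>e'. edge_at h e' \<and> (gs ! (k - 1), e') \<in> (avoiding gs)\<^sup>*"
    proof (rule rtrancl_simulation[where rel = edge_at, OF h(1) last])
      fix p q e assume pq: "(p, q) \<in> avoiding_pos k w ps" "edge_at p e"
      then have "follows k w p q" by (simp add: avoiding_pos_def)
      then obtain e' where "edge_at q e'" using follows_at by blast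
      then show "\<exists>e'. edge_at q e' \<and> (e, e') \<in> avoiding gs" using avoiding_pos_iff pq by blast
    qed
    then show "\<exists>h\<in>edges k (set xs). (gs ! (k - 1), h) \<in> (avoiding gs)\<^sup>* \<and> snd h = fst (gs ! 0)"
      using at_follows[OF _ first] h(2) at_edges by blast
  next
    assume "\<exists>h\<in>edges k (set xs). (gs ! (k - 1), h) \<in> (avoiding gs)\<^sup>* \<and> snd h = fst (gs ! 0)"
    then obtain e where e: "(gs ! (k - 1), e) \<in> (avoiding gs)\<^sup>*" "snd e = fst (gs ! 0)" by blast
    have "\<exists>q. edge_at q e \<and> (ps ! (k - 1), q) \<in> (avoiding_pos k w ps)\<^sup>*"
    proof (rule rtrancl_simulation[where rel = "\<lambda>e p. edge_at p e", OF e(1) last])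
      fix e e' p assume ee: "(e, e') \<in> avoiding gs" "edge_at p e"
      then have "e' \<in> edges k (set xs)" by (simp add: avoiding_def line_def)
      then obtain q where "edge_at q e'" using at_ex by blast
      then show "\<exists>q. edge_at q e' \<and> (p, q) \<in> avoiding_pos k w ps" using avoiding_pos_iff ee by blast
    qed
    then show "\<exists>h\<le>length w. (ps ! (k - 1), h) \<in> (avoiding_pos k w ps)\<^sup>* \<and> follows k w h (ps ! 0)"
      using at_follows[OF _ first] e(2) at_le by blast
  qed
  then show ?thesis
    unfolding good_pos_def good_chain_def chain_pos_iff listed_pos_iff at_follows[OF last first] by simp
qed

end

lemma good_start_iff:
  assumes q: "edge_at q e"
  shows "(\<exists>ps. length ps = k \<and> set ps \<subseteq> {..length w} \<and> ps ! 0 = q \<and> good_pos k w ps) \<longleftrightarrow>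
    (\<exists>gs. good_chain gs \<and> gs ! 0 = e)"
proof
  assume "\<exists>ps. length ps = k \<and> set ps \<subseteq> {..length w} \<and> ps ! 0 = q \<and> good_pos k w ps"
  then obtain ps where ps: "length ps = k" "ps ! 0 = q" "good_pos k w ps" by blast
  have ex: "\<exists>e. edge_at (ps ! i) e" if "i < k" for i
    using ps(3) that at_rel_at unfolding good_pos_def chain_pos_def by blast
  define gs where "gs = map (\<lambda>i. if i = 0 then e else SOME e. edge_at (ps ! i) e) [0..<k]"
  have "edge_at (ps ! i) (gs ! i)" if "i < k" for i
    using someI_ex[OF ex[OF that]] q ps(2) that by (simp add: gs_def)
  then have "good_chain gs" using good_pos_iff[of ps gs] ps by (simp add: gs_def)
  moreover have "gs ! 0 = e" using k by (simp add: gs_def)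
  ultimately show "\<exists>gs. good_chain gs \<and> gs ! 0 = e" by blast
next
  assume "\<exists>gs. good_chain gs \<and> gs ! 0 = e"
  then obtain gs where gs: "good_chain gs" "gs ! 0 = e" by blast
  then have len: "length gs = k" and "\<And>i. i < k \<Longrightarrow> gs ! i \<in> edges k (set xs)"
    by (auto simp: good_chain_def chain_def)
  then have ex: "\<exists>p. edge_at p (gs ! i)" if "i < k" for i using at_ex that by blast
  \<comment> \<open>As an edge may occur at several positions, index 0 must keep the given
    \<open>q\<close>; the other positions are arbitrary.\<close>
  define ps where "ps = map (\<lambda>i. if i = 0 then q else SOME p. edge_at p (gs ! i)) [0..<k]"
  have a: "edge_at (ps ! i) (gs ! i)" if "i < k" for i
    using someI_ex[OF ex[OF that]] q gs(2) that by (simp add: ps_def)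
  then have "good_pos k w ps" using good_pos_iff[of ps gs] gs len by (simp add: ps_def)
  moreover have "ps ! 0 = q" using k by (simp add: ps_def)
  moreover have l: "length ps = k" by (simp add: ps_def)
  moreover have "set ps \<subseteq> {..length w}"
    using at_le[OF a] l by (auto simp: in_set_conv_nth)
  ultimately show "\<exists>ps. length ps = k \<and> set ps \<subseteq> {..length w} \<and> ps ! 0 = q \<and> good_pos k w ps" by blast
qed

lemma escapes_pos_iff:
  assumes p: "edge_at p e"
  shows "escapes_pos k w p \<longleftrightarrow> escapes e"
proof
  assume "escapes_pos k w p"
  then obtain q where q: "(p, q) \<in> (line_pos k w)\<^sup>*" and c: "\<not> (\<exists>s\<le>length w. follows k w q s) \<or>
      (\<exists>ps. length ps = k \<and> set ps \<subseteq> {..length w} \<and> ps ! 0 = q \<and> good_pos k w ps)"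
    by (auto simp: escapes_pos_def)
  obtain e' where e': "edge_at q e'" "(e, e') \<in> line\<^sup>*"
    using rtrancl_simulation[where rel = edge_at and B = line, OF q p] line_pos_line by metis
  from c show "escapes e" unfolding at_terminal[OF e'(1)] good_start_iff[OF e'(1)] escapes_def
    using e' at_edges by blast
next
  assume "escapes e"
  then obtain e' where e': "(e, e') \<in> line\<^sup>*" and c: "snd e' \<notin> Domain (edges k (set xs)) \<or>
     (\<exists>gs. good_chain gs \<and> gs ! 0 = e')"
    unfolding escapes_def by blast
  obtain q where q: "edge_at q e'" "(p, q) \<in> (line_pos k w)\<^sup>*"
    using rtrancl_simulation[where rel = "\<lambda>e p. edge_at p e" and B = "line_pos k w", OF e' p]
      line_line_pos by metis
  from c show "escapes_pos k w p"
    unfolding at_terminal[OF q(1), symmetric] good_start_iff[OF q(1), symmetric] escapes_pos_def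
    using q at_le[OF q(1)] at_edge_pos by metis
qed

lemma certain_iff_all_escape: "certain (ac_key k) (AC k) (set xs) \<longleftrightarrow> \<not> all_escape k w"
proof -
  have "all_escape k w \<longleftrightarrow> (\<forall>e\<in>edges k (set xs). escapes e)"
    unfolding all_escape_def at_edge_pos using escapes_pos_iff at_ex at_edges at_le by blast
  then show ?thesis using certain_iff_escapes[OF k db] by simp
qed

end

lemma tm_of_dec:
  assumes "dec 0 (\<lambda>w e. P w)"
  shows "\<exists>M c d. wf_tm M \<and> (\<forall>w. set w \<subseteq> {1..4} \<longrightarrow>
    decides_within M w (c * (length w + 1) ^ d) (P w))"
proof -
  obtain c t where c: "computes c t 0 (\<lambda>w e. P w)" using assms by (auto simp: dec_def)
  \<comment> \<open>The tape conversion already provides the letter registers;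
    \<open>First 0\<close> establishes the remaining requirement of \<open>ok\<close>, the constant
    \<open>{0}\<close>.\<close>
  let ?c = "Seq (Seq (Op (First 0)) c) (Cond 5 (Halt True) (Halt False))"
  obtain M where M: "wf_tm M" "\<And>w t v s t'. set w \<subseteq> {1..4} \<Longrightarrow>
    (sstep (length w) ^^ t) (?c, letters w) = (Halt v, s) \<Longrightarrow>
    2 * length w + 2 + t * (2 * length w + 4) \<le> t' \<Longrightarrow> decides_within M w t' v"
    using tm_of_com[of ?c] by blast
  \<comment> \<open>Conversion takes \<open>2 * n + 2\<close> machine steps and every program step
    one sweep of \<open>2 * n + 4\<close>. The summand 2 stands for discarding \<open>Skip\<close>
    and for the final test.\<close>
  have "poly (\<lambda>n. 2 * n + 2 + ((1 + t n + 1) + 2) * (2 * n + 4))"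
    by (intro poly_intros computes_poly[OF c])
  then obtain a d where ad: "\<And>n. 2 * n + 2 + ((1 + t n + 1) + 2) * (2 * n + 4) \<le> a * (n + 1) ^ d"
    by (auto simp: poly_def)
  have "decides_within M w (a * (length w + 1) ^ d) (P w)" if w: "set w \<subseteq> {1..4}" for w
  proof -
    let ?n = "length w"
    have o: "ok w 0 (\<lambda>_. 0) ((letters w)(0 := {0}))" by (auto simp: ok_def)
    have "wp ?n (1 + t ?n + 1) (Seq (Op (First 0)) c) (\<lambda>s'. s' 5 \<inter> {..?n} \<noteq> {} \<longleftrightarrow> P w) (letters w)"
      by (intro wp_Seq wp_Op) (use computesD[OF c o] in simp)
    from Seq_reaches_second[OF this] obtain t' s' where t': "t' \<le> 1 + t ?n + 1 + 1"
      "(sstep ?n ^^ t') (?c, letters w) = (Cond 5 (Halt True) (Halt False), s')"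
      "s' 5 \<inter> {..?n} \<noteq> {} \<longleftrightarrow> P w" by blast
    then have "(sstep ?n ^^ Suc t') (?c, letters w) = (Halt (P w), s')" by auto
    moreover have "2 * ?n + 2 + Suc t' * (2 * ?n + 4) \<le> a * (?n + 1) ^ d"
    proof -
      have "Suc t' \<le> (1 + t ?n + 1) + 2" using t'(1) by simp
      then have "Suc t' * (2 * ?n + 4) \<le> ((1 + t ?n + 1) + 2) * (2 * ?n + 4)" by (rule mult_le_mono1)
      then show ?thesis using ad[of ?n] by linarith
    qed
    ultimately show ?thesis by (rule M(2)[OF w])
  qed
  with M(1) show ?thesis by blast
qed

theorem theorem4:
  fixes k :: nat
  assumes "2 \<le> k"
  shows "certainty_AC_in_P k"
proof -
  have "dec 0 (\<lambda>w e. \<not> all_escape k w)" by (intro dec_not dec_all_escape assms)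
  from tm_of_dec[OF this] obtain M c d where M: "wf_tm M"
    "\<And>w. set w \<subseteq> {1..4} \<Longrightarrow> decides_within M w (c * (length w + 1) ^ d) (\<not> all_escape k w)"
    by blast
  have "decides_within M (enc_db xs) (c * (length (enc_db xs) + 1) ^ d) (certain (ac_key k) (AC k) (set xs))"
    if "uncertain_db (ac_arity k) (set xs)" for xs
    using M(2)[OF set_enc_db[of xs]] certain_iff_all_escape[OF assms that] by simp
  with M(1) show ?thesis unfolding certainty_AC_in_P_def by blast
qed

end
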